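(* Let $G$ be an arbitrary real Lie group. Then its canonical connection $\overset{c}{\nabla}$ is $\mathcal P$-complete.
   Context: The canonical (Cartan-0) connection $\overset{c}{\nabla}$ of $G$ is the left invariant torsion free Koszul connection on $TG$ determined by $\overset{c}{\nabla}_xy=\frac12[x,y]$ for left invariant vector fields $x,y$. For a Koszul (linear) connection $\nabla$ on a manifold $M$ and $v\in TM$ let $\gamma_v:I_v\to M$ be the maximal $\nabla$-geodesic with $\dot\gamma_v(0)=v$, $\mathbb{C}I_v=\{t+is:t\in I_v,\ s\in\mathbb R\}$ and $\Omega_v:\mathbb{C}I_v\to TM$, $\Omega_v(t+is)=s\dot\gamma_v(t)$. A polarization on an even-dimensional smooth manifold $X$ is a smooth complex subbundle $P\subset\mathbb{C}TX$ closed under Lie brackets of local smooth sections with $\operatorname{rank}_{\mathbb C}P=\frac12\dim X$. An ac-polarization on $TM$ is a polarization $P$ on the manifold $TM$ with $(\Omega_v)_*(T^{1,0}(\mathbb{C}I_v))\subset P$ for all $v\in TM$. $\nabla$ is $\mathcal P$-complete if an ac-polarization exists on $TM$. *)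

theory Defs
  imports "HOL-Analysis.Analysis" "HOL-Algebra.Group"
begin

section \<open>Model spaces and smooth functions\<close>

text \<open>Manifolds are modelled on \<open>\<real>\<^sup>n\<close>, i.e. on a finite-dimensional inner product space. The library
  class \<open>euclidean_space\<close> is not used for this because it excludes dimension \<open>0\<close>.\<close>

class findim_inner = real_inner +
  assumes finite_spanning: "\<exists>B. finite B \<and> (\<forall>x. \<exists>r. x = (\<Sum>b\<in>B. r b *\<^sub>R b))"

lemma finite_spanning_set: "\<exists>B. finite B \<and> span B = (UNIV :: 'a::findim_inner set)"
proof -
  obtain B :: "'a set" where B: "finite B" "\<And>x. \<exists>r. x = (\<Sum>b\<in>B. r b *\<^sub>R b)"
    using finite_spanning by metis
  have "x \<in> span B" for x
  proof -
    obtain r where "x = (\<Sum>b\<in>B. r b *\<^sub>R b)"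
      using B(2) by blast
    then show ?thesis
      by (simp add: span_sum span_scale span_base)
  qed
  then show ?thesis
    using B(1) by blast
qed

instance euclidean_space \<subseteq> findim_inner
proof
  show "\<exists>B. finite B \<and> (\<forall>x::'a. \<exists>r. x = (\<Sum>b\<in>B. r b *\<^sub>R b))"
    by (intro exI[of _ Basis] conjI allI exI[of _ "\<lambda>b. x \<bullet> b" for x])
      (simp_all add: euclidean_representation)
qed

instance prod :: (findim_inner, findim_inner) findim_inner
proof
  obtain B :: "'a set" where B: "finite B" "span B = UNIV"
    using finite_spanning_set by blast
  obtain C :: "'b set" where C: "finite C" "span C = UNIV"
    using finite_spanning_set by blast
  let ?D = "(\<lambda>b. (b, 0)) ` B \<union> (\<lambda>c. (0, c)) ` C"
  have 1: "(b, 0) \<in> span ?D" for b :: 'a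
  proof -
    have "linear (\<lambda>b. (b, 0) :: 'a \<times> 'b)"
      by (rule linearI) auto
    then have "(\<lambda>b. (b, 0) :: 'a \<times> 'b) ` span B = span ((\<lambda>b. (b, 0)) ` B)"
      by (rule linear_span_image[symmetric])
    then have "(b, 0) \<in> span ((\<lambda>b. (b, 0) :: 'a \<times> 'b) ` B)"
      using B(2) by blast
    then show ?thesis
      by (meson Un_upper1 span_mono subsetD)
  qed
  have 2: "(0, c) \<in> span ?D" for c :: 'b
  proof -
    have "linear (\<lambda>c. (0, c) :: 'a \<times> 'b)"
      by (rule linearI) auto
    then have "(\<lambda>c. (0, c) :: 'a \<times> 'b) ` span C = span ((\<lambda>c. (0, c)) ` C)"
      by (rule linear_span_image[symmetric])
    then have "(0, c) \<in> span ((\<lambda>c. (0, c) :: 'a \<times> 'b) ` C)"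
      using C(2) by blast
    then show ?thesis
      by (meson Un_upper2 span_mono subsetD)
  qed
  have "x \<in> span ?D" for x
    using span_add[OF 1[of "fst x"] 2[of "snd x"]] by simp
  moreover have "finite ?D"
    using B(1) C(1) by simp
  ultimately have "\<exists>r. x = (\<Sum>b\<in>?D. r b *\<^sub>R b)" for x
    using span_finite[of ?D] by blast
  then show "\<exists>D. finite D \<and> (\<forall>x::'a \<times> 'b. \<exists>r. x = (\<Sum>b\<in>D. r b *\<^sub>R b))"
    using \<open>finite ?D\<close> by blast
qed

text \<open>\<open>C\<^sup>k\<close> by iterated directional derivatives; used only for finite-dimensional domains
  and open \<open>S\<close>, where it agrees with the usual notion.\<close>

fun Ck_on :: "nat \<Rightarrow> 'a::real_normed_vector set \<Rightarrow> ('a \<Rightarrow> 'b::real_normed_vector) \<Rightarrow> bool" where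
  "Ck_on 0 S f \<longleftrightarrow> continuous_on S f"
| "Ck_on (Suc k) S f \<longleftrightarrow> (\<forall>x\<in>S. f differentiable (at x)) \<and>
     (\<forall>v. Ck_on k S (\<lambda>x. frechet_derivative f (at x) v))"

definition smooth_on :: "'a::real_normed_vector set \<Rightarrow> ('a \<Rightarrow> 'b::real_normed_vector) \<Rightarrow> bool" where
  "smooth_on S f \<longleftrightarrow> (\<forall>k. Ck_on k S f)"


section \<open>Smooth manifolds\<close>

text \<open>A manifold is given by an atlas; its underlying set and its topology are determined
  by the atlas. A chart \<open>(U, \<phi>)\<close> is a domain with a map whose values outside the
  domain are irrelevant.\<close>

type_synonym ('a, 'e) chart = "'a set \<times> ('a \<Rightarrow> 'e)"
type_synonym ('a, 'e) atlas = "('a, 'e) chart set"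

abbreviation cdom :: "('a, 'e) chart \<Rightarrow> 'a set" where "cdom \<equiv> fst"
abbreviation cmap :: "('a, 'e) chart \<Rightarrow> 'a \<Rightarrow> 'e" where "cmap \<equiv> snd"

definition cinv :: "('a, 'e) chart \<Rightarrow> 'e \<Rightarrow> 'a" where
  "cinv c = inv_into (cdom c) (cmap c)"

definition points :: "('a, 'e) atlas \<Rightarrow> 'a set" where
  "points A = (\<Union>c\<in>A. cdom c)"

definition atlas_topology :: "('a, 'e::topological_space) atlas \<Rightarrow> 'a topology" where
  "atlas_topology A =
     topology (\<lambda>W. W \<subseteq> points A \<and> (\<forall>c\<in>A. open (cmap c ` (W \<inter> cdom c))))"

lemma openin_atlas_topology:
  assumes inj: "\<And>c. c \<in> A \<Longrightarrow> inj_on (cmap c) (cdom c)"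
  shows "openin (atlas_topology A) W \<longleftrightarrow>
           W \<subseteq> points A \<and> (\<forall>c\<in>A. open (cmap c ` (W \<inter> cdom c)))"
proof -
  let ?O = "\<lambda>W. W \<subseteq> points A \<and> (\<forall>c\<in>A. open (cmap c ` (W \<inter> cdom c)))"
  have "?O (S \<inter> T)" if "?O S" "?O T" for S T
  proof -
    have "cmap c ` ((S \<inter> T) \<inter> cdom c) = cmap c ` (S \<inter> cdom c) \<inter> cmap c ` (T \<inter> cdom c)"
      if "c \<in> A" for c
      using inj_on_image_Int[OF inj[OF that], of "S \<inter> cdom c" "T \<inter> cdom c"]
      by (simp add: Int_ac Int_left_absorb)
    then show ?thesis
      using that by (auto intro: open_Int)
  qed
  moreover have "?O (\<Union>K)" if "\<forall>S\<in>K. ?O S" for K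
  proof -
    have "open (cmap c ` (\<Union>K \<inter> cdom c))" if "c \<in> A" for c
    proof -
      have "cmap c ` (\<Union>K \<inter> cdom c) = (\<Union>S\<in>K. cmap c ` (S \<inter> cdom c))"
        by blast
      moreover have "open (\<Union>S\<in>K. cmap c ` (S \<inter> cdom c))"
        using \<open>\<forall>S\<in>K. ?O S\<close> \<open>c \<in> A\<close> by (intro open_UN) blast
      ultimately show ?thesis
        by simp
    qed
    then show ?thesis
      using that by blast
  qed
  ultimately have "istopology ?O"
    unfolding istopology_def by blast
  then show ?thesis
    by (simp add: atlas_topology_def topology_inverse')
qed

definition smooth_manifold :: "('a, 'e::findim_inner) atlas \<Rightarrow> bool" where
  "smooth_manifold A \<longleftrightarrow>
     (\<forall>c\<in>A. inj_on (cmap c) (cdom c) \<and> open (cmap c ` cdom c)) \<and>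
     (\<forall>c\<in>A. \<forall>d\<in>A. open (cmap c ` (cdom c \<inter> cdom d)) \<and>
        smooth_on (cmap c ` (cdom c \<inter> cdom d)) (cmap d \<circ> cinv c)) \<and>
     Hausdorff_space (atlas_topology A) \<and> second_countable (atlas_topology A)"

definition smooth_map ::
  "('a, 'e::real_normed_vector) atlas \<Rightarrow> ('b, 'f::real_normed_vector) atlas \<Rightarrow> ('a \<Rightarrow> 'b) \<Rightarrow> bool" where
  "smooth_map A B f \<longleftrightarrow>
     continuous_map (atlas_topology A) (atlas_topology B) f \<and>
     (\<forall>c\<in>A. \<forall>d\<in>B. smooth_on (cmap c ` (cdom c \<inter> f -` cdom d)) (cmap d \<circ> f \<circ> cinv c))"

definition smooth_function :: "('a, 'e::real_normed_vector) atlas \<Rightarrow> ('a \<Rightarrow> real) \<Rightarrow> bool" where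
  "smooth_function A f \<longleftrightarrow> (\<forall>c\<in>A. smooth_on (cmap c ` cdom c) (f \<circ> cinv c))"

definition open_atlas :: "'e set \<Rightarrow> ('e, 'e) atlas" where
  "open_atlas S = {(S, \<lambda>x. x)}"

definition product_atlas :: "('a, 'e) atlas \<Rightarrow> ('b, 'f) atlas \<Rightarrow> ('a \<times> 'b, 'e \<times> 'f) atlas" where
  "product_atlas A B = (\<lambda>(c, d). (cdom c \<times> cdom d, map_prod (cmap c) (cmap d))) ` (A \<times> B)"

definition chart_at :: "('a, 'e) atlas \<Rightarrow> 'a \<Rightarrow> ('a, 'e) chart" where
  "chart_at A p = (SOME c. c \<in> A \<and> p \<in> cdom c)"


section \<open>Tangent vectors and tangent bundle\<close>

text \<open>A tangent vector at \<open>p\<close> is the family of its coordinate representations in all charts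
  of the atlas around \<open>p\<close>; these are related by the derivatives of the coordinate changes.
  The family is extended by \<open>0\<close> to all other pairs \<open>c\<close>. Vector operations are pointwise.\<close>

type_synonym ('a, 'e) tvec = "('a, 'e) chart \<Rightarrow> 'e"

definition tangent_space :: "('a, 'e::real_normed_vector) atlas \<Rightarrow> 'a \<Rightarrow> ('a, 'e) tvec set" where
  "tangent_space A p = {v.
     (\<forall>c\<in>A. \<forall>d\<in>A. p \<in> cdom c \<inter> cdom d \<longrightarrow>
        v d = frechet_derivative (cmap d \<circ> cinv c) (at (cmap c p)) (v c)) \<and>
     (\<forall>c. \<not> (c \<in> A \<and> p \<in> cdom c) \<longrightarrow> v c = 0)}"

definition tangent_atlas ::
  "('a, 'e::real_normed_vector) atlas \<Rightarrow> ('a \<times> ('a, 'e) tvec, 'e \<times> 'e) atlas" where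
  "tangent_atlas A =
     (\<lambda>c. (SIGMA p : cdom c. tangent_space A p, \<lambda>(p, v). (cmap c p, v c))) ` A"

text \<open>Differential at \<open>z\<close>, applied to \<open>h\<close>, of a map from an open subset of a vector space
  to a manifold, and of a map between manifolds.\<close>

definition map_deriv ::
  "('a, 'e::real_normed_vector) atlas \<Rightarrow> ('f::real_normed_vector \<Rightarrow> 'a) \<Rightarrow> 'f \<Rightarrow> 'f \<Rightarrow> ('a, 'e) tvec" where
  "map_deriv A F z h = (\<lambda>c. if c \<in> A \<and> F z \<in> cdom c
     then frechet_derivative (cmap c \<circ> F) (at z) h else 0)"

definition tangent_map ::
  "('a, 'e::real_normed_vector) atlas \<Rightarrow> ('b, 'f::real_normed_vector) atlas \<Rightarrow>
   ('a \<Rightarrow> 'b) \<Rightarrow> 'a \<Rightarrow> ('a, 'e) tvec \<Rightarrow> ('b, 'f) tvec" where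
  "tangent_map A B F p v =
     (let c = chart_at A p in map_deriv B (F \<circ> cinv c) (cmap c p) (v c))"

definition dir_deriv ::
  "('a, 'e::real_normed_vector) atlas \<Rightarrow> ('a \<Rightarrow> real) \<Rightarrow> 'a \<Rightarrow> ('a, 'e) tvec \<Rightarrow> real" where
  "dir_deriv A f p v =
     (let c = chart_at A p in frechet_derivative (f \<circ> cinv c) (at (cmap c p)) (v c))"

text \<open>Smooth sections over \<open>U\<close> with values in the fibres \<open>F p\<close>, where \<open>F\<close> is the tangent
  bundle, the complexified tangent bundle or a subbundle of one of these.\<close>

definition smooth_section ::
  "('a, 'e::real_normed_vector) atlas \<Rightarrow> ('a \<Rightarrow> (('a, 'e) chart \<Rightarrow> 'f::real_normed_vector) set) \<Rightarrow>
   'a set \<Rightarrow> ('a \<Rightarrow> ('a, 'e) chart \<Rightarrow> 'f) \<Rightarrow> bool" where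
  "smooth_section A F U X \<longleftrightarrow>
     (\<forall>p\<in>U. X p \<in> F p) \<and>
     (\<forall>c\<in>A. smooth_on (cmap c ` (U \<inter> cdom c)) (\<lambda>x. X (cinv c x) c))"

abbreviation smooth_vector_field ::
  "('a, 'e::real_normed_vector) atlas \<Rightarrow> ('a \<Rightarrow> ('a, 'e) tvec) \<Rightarrow> bool" where
  "smooth_vector_field A \<equiv> smooth_section A (tangent_space A) (points A)"

definition lie_bracket ::
  "('a, 'e::real_normed_vector) atlas \<Rightarrow> ('a \<Rightarrow> ('a, 'e) tvec) \<Rightarrow> ('a \<Rightarrow> ('a, 'e) tvec) \<Rightarrow>
   'a \<Rightarrow> ('a, 'e) tvec" where
  "lie_bracket A X Y p = (\<lambda>c. if c \<in> A \<and> p \<in> cdom c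
     then frechet_derivative (\<lambda>x. Y (cinv c x) c) (at (cmap c p)) (X p c)
        - frechet_derivative (\<lambda>x. X (cinv c x) c) (at (cmap c p)) (Y p c)
     else 0)"


section \<open>Koszul connections and geodesics\<close>

text \<open>\<open>N X Y\<close> is \<open>\<nabla>\<^sub>X Y\<close>. Real homogeneity in \<open>Y\<close> is the Leibniz rule for constant \<open>f\<close>.\<close>

definition koszul_connection ::
  "('a, 'e::real_normed_vector) atlas \<Rightarrow>
   (('a \<Rightarrow> ('a, 'e) tvec) \<Rightarrow> ('a \<Rightarrow> ('a, 'e) tvec) \<Rightarrow> 'a \<Rightarrow> ('a, 'e) tvec) \<Rightarrow> bool" where
  "koszul_connection A N \<longleftrightarrow>
     (\<forall>X Y. smooth_vector_field A X \<and> smooth_vector_field A Y \<longrightarrow> smooth_vector_field A (N X Y)) \<and>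
     (\<forall>X X' Y. smooth_vector_field A X \<and> smooth_vector_field A X' \<and> smooth_vector_field A Y \<longrightarrow>
        (\<forall>p\<in>points A. N (\<lambda>q c. X q c + X' q c) Y p = (\<lambda>c. N X Y p c + N X' Y p c))) \<and>
     (\<forall>f X Y. smooth_function A f \<and> smooth_vector_field A X \<and> smooth_vector_field A Y \<longrightarrow>
        (\<forall>p\<in>points A. N (\<lambda>q c. f q *\<^sub>R X q c) Y p = (\<lambda>c. f p *\<^sub>R N X Y p c))) \<and>
     (\<forall>X Y Y'. smooth_vector_field A X \<and> smooth_vector_field A Y \<and> smooth_vector_field A Y' \<longrightarrow>
        (\<forall>p\<in>points A. N X (\<lambda>q c. Y q c + Y' q c) p = (\<lambda>c. N X Y p c + N X Y' p c))) \<and>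
     (\<forall>f X Y. smooth_function A f \<and> smooth_vector_field A X \<and> smooth_vector_field A Y \<longrightarrow>
        (\<forall>p\<in>points A. N X (\<lambda>q c. f q *\<^sub>R Y q c) p =
           (\<lambda>c. f p *\<^sub>R N X Y p c + dir_deriv A f p (X p) *\<^sub>R Y p c)))"

definition torsion_free ::
  "('a, 'e::real_normed_vector) atlas \<Rightarrow>
   (('a \<Rightarrow> ('a, 'e) tvec) \<Rightarrow> ('a \<Rightarrow> ('a, 'e) tvec) \<Rightarrow> 'a \<Rightarrow> ('a, 'e) tvec) \<Rightarrow> bool" where
  "torsion_free A N \<longleftrightarrow>
     (\<forall>X Y. smooth_vector_field A X \<and> smooth_vector_field A Y \<longrightarrow>
        (\<forall>p\<in>points A. \<forall>c. N X Y p c - N Y X p c = lie_bracket A X Y p c))"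

text \<open>A smooth curve is a smooth map on an open interval \<open>I\<close>; values of \<open>\<gamma>\<close> outside \<open>I\<close> are
  irrelevant.\<close>

definition smooth_curve ::
  "('a, 'e::real_normed_vector) atlas \<Rightarrow> real set \<Rightarrow> (real \<Rightarrow> 'a) \<Rightarrow> bool" where
  "smooth_curve A I \<gamma> \<longleftrightarrow> open I \<and> is_interval I \<and> smooth_map (open_atlas I) A \<gamma>"

definition velocity ::
  "('a, 'e::real_normed_vector) atlas \<Rightarrow> (real \<Rightarrow> 'a) \<Rightarrow> real \<Rightarrow> ('a, 'e) tvec" where
  "velocity A \<gamma> t = map_deriv A \<gamma> t 1"

definition field_along ::
  "('a, 'e::real_normed_vector) atlas \<Rightarrow> real set \<Rightarrow> (real \<Rightarrow> 'a) \<Rightarrow> (real \<Rightarrow> ('a, 'e) tvec) \<Rightarrow> bool" where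
  "field_along A I \<gamma> V \<longleftrightarrow>
     (\<forall>t\<in>I. V t \<in> tangent_space A (\<gamma> t)) \<and>
     (\<forall>c\<in>A. smooth_on (I \<inter> \<gamma> -` cdom c) (\<lambda>t. V t c))"

text \<open>The covariant derivative along \<open>\<gamma>\<close> is the unique operator \<open>D\<close> on smooth vector fields along
  \<open>\<gamma>\<close> with the following properties. In the last one \<open>N X Y (\<gamma> t)\<close> is \<open>\<nabla>\<^sub>v Y\<close> for
  \<open>v = \<gamma>'(t)\<close>, since \<open>\<nabla>\<close> is tensorial in its first argument.\<close>

definition covariant_derivative_along ::
  "('a, 'e::real_normed_vector) atlas \<Rightarrow>
   (('a \<Rightarrow> ('a, 'e) tvec) \<Rightarrow> ('a \<Rightarrow> ('a, 'e) tvec) \<Rightarrow> 'a \<Rightarrow> ('a, 'e) tvec) \<Rightarrow>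
   real set \<Rightarrow> (real \<Rightarrow> 'a) \<Rightarrow> ((real \<Rightarrow> ('a, 'e) tvec) \<Rightarrow> real \<Rightarrow> ('a, 'e) tvec) \<Rightarrow> bool" where
  "covariant_derivative_along A N I \<gamma> D \<longleftrightarrow>
     (\<forall>V. field_along A I \<gamma> V \<longrightarrow> field_along A I \<gamma> (D V)) \<and>
     (\<forall>V W. field_along A I \<gamma> V \<and> field_along A I \<gamma> W \<longrightarrow>
        (\<forall>t\<in>I. D (\<lambda>s c. V s c + W s c) t = (\<lambda>c. D V t c + D W t c))) \<and>
     (\<forall>f V. smooth_on I f \<and> field_along A I \<gamma> V \<longrightarrow>
        (\<forall>t\<in>I. D (\<lambda>s c. f s *\<^sub>R V s c) t = (\<lambda>c. deriv f t *\<^sub>R V t c + f t *\<^sub>R D V t c))) \<and>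
     (\<forall>X Y. smooth_vector_field A X \<and> smooth_vector_field A Y \<longrightarrow>
        (\<forall>t\<in>I. X (\<gamma> t) = velocity A \<gamma> t \<longrightarrow> D (\<lambda>s. Y (\<gamma> s)) t = N X Y (\<gamma> t)))"

definition geodesic ::
  "('a, 'e::real_normed_vector) atlas \<Rightarrow>
   (('a \<Rightarrow> ('a, 'e) tvec) \<Rightarrow> ('a \<Rightarrow> ('a, 'e) tvec) \<Rightarrow> 'a \<Rightarrow> ('a, 'e) tvec) \<Rightarrow>
   real set \<Rightarrow> (real \<Rightarrow> 'a) \<Rightarrow> bool" where
  "geodesic A N I \<gamma> \<longleftrightarrow> smooth_curve A I \<gamma> \<and>
     (\<exists>D. covariant_derivative_along A N I \<gamma> D \<and> (\<forall>t\<in>I. D (velocity A \<gamma>) t = (\<lambda>c. 0)))"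

definition maximal_geodesic ::
  "('a, 'e::real_normed_vector) atlas \<Rightarrow>
   (('a \<Rightarrow> ('a, 'e) tvec) \<Rightarrow> ('a \<Rightarrow> ('a, 'e) tvec) \<Rightarrow> 'a \<Rightarrow> ('a, 'e) tvec) \<Rightarrow>
   'a \<times> ('a, 'e) tvec \<Rightarrow> real set \<Rightarrow> (real \<Rightarrow> 'a) \<Rightarrow> bool" where
  "maximal_geodesic A N v I \<gamma> \<longleftrightarrow>
     geodesic A N I \<gamma> \<and> 0 \<in> I \<and> (\<gamma> 0, velocity A \<gamma> 0) = v \<and>
     (\<forall>J \<delta>. geodesic A N J \<delta> \<and> I \<subseteq> J \<and> (\<forall>t\<in>I. \<delta> t = \<gamma> t) \<longrightarrow> J = I)"


section \<open>Polarizations\<close>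

text \<open>In the complexification \<open>'e \<times> 'e\<close> of \<open>'e\<close> the pair \<open>(x, y)\<close> stands for \<open>x + \<i> y\<close>.
  A complex tangent vector is a family of such pairs.\<close>

definition cscale :: "complex \<Rightarrow> 'e::real_vector \<times> 'e \<Rightarrow> 'e \<times> 'e" where
  "cscale z = (\<lambda>(x, y). (Re z *\<^sub>R x - Im z *\<^sub>R y, Re z *\<^sub>R y + Im z *\<^sub>R x))"

type_synonym ('a, 'e) ctvec = "('a, 'e) chart \<Rightarrow> 'e \<times> 'e"

definition ctangent_space :: "('a, 'e::real_normed_vector) atlas \<Rightarrow> 'a \<Rightarrow> ('a, 'e) ctvec set" where
  "ctangent_space A p = {w. fst \<circ> w \<in> tangent_space A p \<and> snd \<circ> w \<in> tangent_space A p}"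

text \<open>Complex bilinear extension of the Lie bracket.\<close>

definition clie_bracket ::
  "('a, 'e::real_normed_vector) atlas \<Rightarrow> ('a \<Rightarrow> ('a, 'e) ctvec) \<Rightarrow> ('a \<Rightarrow> ('a, 'e) ctvec) \<Rightarrow>
   'a \<Rightarrow> ('a, 'e) ctvec" where
  "clie_bracket A Z W p =
     (let X = (\<lambda>q. fst \<circ> Z q); X' = (\<lambda>q. snd \<circ> Z q);
          Y = (\<lambda>q. fst \<circ> W q); Y' = (\<lambda>q. snd \<circ> W q)
      in (\<lambda>c. (lie_bracket A X Y p c - lie_bracket A X' Y' p c,
                lie_bracket A X Y' p c + lie_bracket A X' Y p c)))"

definition smooth_complex_subbundle ::
  "('a, 'e::real_normed_vector) atlas \<Rightarrow> nat \<Rightarrow> ('a \<Rightarrow> ('a, 'e) ctvec set) \<Rightarrow> bool" where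
  "smooth_complex_subbundle A k P \<longleftrightarrow>
     (\<forall>p\<in>points A. \<exists>U Z. openin (atlas_topology A) U \<and> p \<in> U \<and>
        (\<forall>i<k. smooth_section A (ctangent_space A) U (Z i)) \<and>
        (\<forall>q\<in>U. P q = range (\<lambda>a :: nat \<Rightarrow> complex. \<lambda>c. \<Sum>i<k. cscale (a i) (Z i q c)) \<and>
           (\<forall>a :: nat \<Rightarrow> complex. (\<forall>c. (\<Sum>i<k. cscale (a i) (Z i q c)) = 0) \<longrightarrow> (\<forall>i<k. a i = 0))))"

definition involutive :: "('a, 'e::real_normed_vector) atlas \<Rightarrow> ('a \<Rightarrow> ('a, 'e) ctvec set) \<Rightarrow> bool" where
  "involutive A P \<longleftrightarrow>
     (\<forall>U Z W. openin (atlas_topology A) U \<and> smooth_section A P U Z \<and> smooth_section A P U W \<longrightarrow>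
        (\<forall>p\<in>U. clie_bracket A Z W p \<in> P p))"

definition polarization :: "('a, 'e::findim_inner) atlas \<Rightarrow> ('a \<Rightarrow> ('a, 'e) ctvec set) \<Rightarrow> bool" where
  "polarization A P \<longleftrightarrow>
     (\<exists>k. 2 * k = dim (UNIV :: 'e set) \<and> smooth_complex_subbundle A k P) \<and> involutive A P"

text \<open>The \<open>(1,0)\<close>-tangent space of \<open>\<complex>\<close> at any point, with \<open>(a, b)\<close> for \<open>a \<otimes> 1 + b \<otimes> \<i>\<close>: the
  eigenspace of the complex structure \<open>J a = \<i> * a\<close> for the eigenvalue \<open>\<i>\<close>.\<close>

definition T10 :: "(complex \<times> complex) set" where
  "T10 = {(a, b). (\<i> * a, \<i> * b) = cscale \<i> (a, b)}"

definition complex_strip :: "real set \<Rightarrow> complex set" where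
  "complex_strip I = {z. Re z \<in> I}"

definition Omega ::
  "('a, 'e::real_normed_vector) atlas \<Rightarrow> (real \<Rightarrow> 'a) \<Rightarrow> complex \<Rightarrow> 'a \<times> ('a, 'e) tvec" where
  "Omega A \<gamma> z = (\<gamma> (Re z), \<lambda>c. Im z *\<^sub>R velocity A \<gamma> (Re z) c)"

definition ac_polarization ::
  "('a, 'e::findim_inner) atlas \<Rightarrow>
   (('a \<Rightarrow> ('a, 'e) tvec) \<Rightarrow> ('a \<Rightarrow> ('a, 'e) tvec) \<Rightarrow> 'a \<Rightarrow> ('a, 'e) tvec) \<Rightarrow>
   ('a \<times> ('a, 'e) tvec \<Rightarrow> ('a \<times> ('a, 'e) tvec, 'e \<times> 'e) ctvec set) \<Rightarrow> bool" where
  "ac_polarization A N P \<longleftrightarrow>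
     polarization (tangent_atlas A) P \<and>
     (\<forall>v\<in>points (tangent_atlas A). \<forall>I \<gamma>. maximal_geodesic A N v I \<gamma> \<longrightarrow>
        (\<forall>z\<in>complex_strip I. \<forall>(a, b)\<in>T10.
           (\<lambda>c. (map_deriv (tangent_atlas A) (Omega A \<gamma>) z a c,
                  map_deriv (tangent_atlas A) (Omega A \<gamma>) z b c)) \<in> P (Omega A \<gamma> z)))"

definition P_complete ::
  "('a, 'e::findim_inner) atlas \<Rightarrow>
   (('a \<Rightarrow> ('a, 'e) tvec) \<Rightarrow> ('a \<Rightarrow> ('a, 'e) tvec) \<Rightarrow> 'a \<Rightarrow> ('a, 'e) tvec) \<Rightarrow> bool" where
  "P_complete A N \<longleftrightarrow> (\<exists>P. ac_polarization A N P)"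


section \<open>Lie groups and the canonical connection\<close>

definition lie_group :: "('a, 'x) monoid_scheme \<Rightarrow> ('a, 'e::findim_inner) atlas \<Rightarrow> bool" where
  "lie_group G A \<longleftrightarrow> group G \<and> smooth_manifold A \<and> points A = carrier G \<and>
     smooth_map (product_atlas A A) A (\<lambda>(g, h). g \<otimes>\<^bsub>G\<^esub> h) \<and>
     smooth_map A A (\<lambda>g. inv\<^bsub>G\<^esub> g)"

definition left_invariant_field ::
  "('a, 'x) monoid_scheme \<Rightarrow> ('a, 'e::real_normed_vector) atlas \<Rightarrow> ('a \<Rightarrow> ('a, 'e) tvec) \<Rightarrow> bool" where
  "left_invariant_field G A X \<longleftrightarrow> smooth_vector_field A X \<and>
     (\<forall>g\<in>carrier G. \<forall>h\<in>carrier G.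
        X (g \<otimes>\<^bsub>G\<^esub> h) = tangent_map A A (\<lambda>k. g \<otimes>\<^bsub>G\<^esub> k) h (X h))"

definition left_push ::
  "('a, 'x) monoid_scheme \<Rightarrow> ('a, 'e::real_normed_vector) atlas \<Rightarrow> 'a \<Rightarrow> ('a \<Rightarrow> ('a, 'e) tvec) \<Rightarrow>
   'a \<Rightarrow> ('a, 'e) tvec" where
  "left_push G A g X q =
     (let h = inv\<^bsub>G\<^esub> g \<otimes>\<^bsub>G\<^esub> q in tangent_map A A (\<lambda>k. g \<otimes>\<^bsub>G\<^esub> k) h (X h))"

definition left_invariant_connection ::
  "('a, 'x) monoid_scheme \<Rightarrow> ('a, 'e::real_normed_vector) atlas \<Rightarrow>
   (('a \<Rightarrow> ('a, 'e) tvec) \<Rightarrow> ('a \<Rightarrow> ('a, 'e) tvec) \<Rightarrow> 'a \<Rightarrow> ('a, 'e) tvec) \<Rightarrow> bool" where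
  "left_invariant_connection G A N \<longleftrightarrow>
     (\<forall>g\<in>carrier G. \<forall>X Y. smooth_vector_field A X \<and> smooth_vector_field A Y \<longrightarrow>
        (\<forall>p\<in>points A. N (left_push G A g X) (left_push G A g Y) p = left_push G A g (N X Y) p))"

definition canonical_connection ::
  "('a, 'x) monoid_scheme \<Rightarrow> ('a, 'e::real_normed_vector) atlas \<Rightarrow>
   (('a \<Rightarrow> ('a, 'e) tvec) \<Rightarrow> ('a \<Rightarrow> ('a, 'e) tvec) \<Rightarrow> 'a \<Rightarrow> ('a, 'e) tvec) \<Rightarrow> bool" where
  "canonical_connection G A N \<longleftrightarrow>
     koszul_connection A N \<and> left_invariant_connection G A N \<and> torsion_free A N \<and>
     (\<forall>X Y. left_invariant_field G A X \<and> left_invariant_field G A Y \<longrightarrow>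
        (\<forall>p\<in>points A. N X Y p = (\<lambda>c. (1/2) *\<^sub>R lie_bracket A X Y p c)))"

end

theory Submission
  imports Defs
begin

text \<open>Left translations identify \<open>TG\<close> with \<open>G \<times> E\<close>, where \<open>E = T\<^sub>eG\<close> is the Lie algebra with bracket \<open>br\<close>.
  To find the polarization, suppose first that \<open>G\<close> lies in a complex Lie group with Lie algebra
  \<open>E\<^sub>\<complex>\<close>, and let \<open>\<Phi>(g, \<xi>) = g exp(-\<i>\<xi>)\<close>. The curves \<open>t + \<i>s \<mapsto> (g exp(tX), sX)\<close> are mapped to
  \<open>g exp((t - \<i>s)X)\<close>, so the vectors \<open>\<partial>\<^sub>t - \<i>\<partial>\<^sub>s\<close>, which span \<open>T\<^sup>1\<^sup>,\<^sup>0\<close>, are sent into the kernel of the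
  complex linear extension of \<open>d\<Phi>\<close>. With \<open>\<psi>(z) = (e\<^sup>z - 1) / z\<close> this kernel is, at \<open>(g, \<xi>)\<close>,
  \<open>{(a(\<xi>)f, f) | f \<in> E\<^sub>\<complex>}\<close> with \<open>a(\<xi>) = \<i>\<psi>(-\<i> ad \<xi>)\<close>, a formula that only involves the Lie algebra
  and therefore makes sense for every \<open>G\<close>. It is taken as the definition of the polarization
  (\<open>pol\<close>, with \<open>a(\<xi>) = slope \<xi>\<close>). Being a graph over \<open>E\<^sub>\<complex>\<close>, it has rank \<open>dim G\<close> at all points, also
  where \<open>\<Phi>\<close> would fail to be a local diffeomorphism.

  Involutivity: left-invariant fields on \<open>G\<close> bracket by \<open>br\<close>, hence the bracket of two sections
  \<open>(a f, f)\<close> and \<open>(a k, k)\<close> is \<open>(a l, l)\<close> for some \<open>l\<close> plus the curvature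
  \<open>(D\<^sub>f a)k - (D\<^sub>k a)f + [a f, a k]\<close> in the first component (\<open>trivfield_bracket\<close>). The curvature
  vanishes by the Maurer-Cartan equation of \<open>\<omega>(u) = \<psi>(ad u)\<close>, the right logarithmic derivative of the
  exponential (\<open>omega_flat\<close>). It is proved inside the Lie algebra: \<open>\<omega>\<close> is a power series, its radial
  derivative is known (\<open>omega_euler\<close>), and along each ray the defect in the Maurer-Cartan equation
  solves a homogeneous linear differential equation with initial value \<open>0\<close>.

  Adaptedness: let \<open>X(t)\<close> be the velocity of a geodesic \<open>\<gamma>\<close> in the left trivialization. As
  \<open>\<nabla>\<^sub>XX = [X, X] / 2 = 0\<close> for left-invariant \<open>X\<close>, the geodesic equation reduces to \<open>X'(t) = 0\<close>
  (\<open>geodesic_left_invariant\<close>). Hence \<open>\<Omega>(t + \<i>s) = (\<gamma>(t), sX)\<close> with constant \<open>X\<close>, and \<open>\<partial>\<^sub>t - \<i>\<partial>\<^sub>s\<close> is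
  sent to \<open>(X, -\<i>X)\<close>. This lies in the polarization because \<open>ad X X = 0\<close> gives
  \<open>a(sX)(-\<i>X) = \<i>(-\<i>X) = X\<close>.\<close>

abbreviation fd :: "('a::real_normed_vector \<Rightarrow> 'b::real_normed_vector) \<Rightarrow> 'a \<Rightarrow> 'a \<Rightarrow> 'b" where
  "fd f x \<equiv> frechet_derivative f (at x)"

section \<open>Orthonormal bases of the model spaces\<close>

lemma ex_orthonormal_basis:
  "\<exists>B :: 'a::findim_inner set. finite B \<and> pairwise orthogonal B \<and> (\<forall>b\<in>B. norm b = 1) \<and> span B = UNIV"
proof -
  obtain B0 :: "'a set" where B0: "finite B0" "span B0 = UNIV"
    using finite_spanning_set by blast
  obtain C where C: "finite C" "span C = span B0" "pairwise orthogonal C"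
    using basis_orthogonal[OF B0(1)] by blast
  let ?B = "(\<lambda>x. x /\<^sub>R norm x) ` (C - {0})"
  have "C \<subseteq> span ?B"
  proof
    fix x assume "x \<in> C"
    show "x \<in> span ?B"
    proof (cases "x = 0")
      case False
      then have "x = norm x *\<^sub>R (x /\<^sub>R norm x)" by simp
      moreover have "x /\<^sub>R norm x \<in> span ?B"
        using \<open>x \<in> C\<close> False by (intro span_base) auto
      ultimately show ?thesis
        by (metis span_scale)
    qed (simp add: span_zero)
  qed
  then have "span ?B = UNIV"
    using C(2) B0(2) span_mono[of C "span ?B"] by (simp add: span_span top.extremum_unique)
  moreover have "pairwise orthogonal ?B"
    using C(3) by (auto simp: pairwise_def orthogonal_def)
  ultimately show ?thesis
    using C(1) by (intro exI[of _ ?B]) auto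
qed

definition onb :: "'a::findim_inner set" where
  "onb = (SOME B. finite B \<and> pairwise orthogonal B \<and> (\<forall>b\<in>B. norm b = 1) \<and> span B = UNIV)"

lemma
  shows finite_onb [simp]: "finite (onb :: 'a::findim_inner set)"
    and orthogonal_onb: "pairwise orthogonal (onb :: 'a set)"
    and norm_onb: "b \<in> (onb :: 'a set) \<Longrightarrow> norm b = 1"
    and span_onb: "span (onb :: 'a set) = UNIV"
  using someI_ex[OF ex_orthonormal_basis[where 'a='a]] unfolding onb_def by blast+

lemma inner_onb:
  assumes "b \<in> onb" "c \<in> onb"
  shows "b \<bullet> c = (if b = c then 1 else 0)"
  using assms orthogonal_onb[where 'a='a] norm_onb[OF assms(1)]
  by (auto simp: pairwise_def orthogonal_def norm_eq_1)

lemma onb_expand: "(\<Sum>b\<in>onb. (x \<bullet> b) *\<^sub>R b) = (x :: 'a::findim_inner)"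
proof -
  define y where "y = x - (\<Sum>b\<in>onb. (x \<bullet> b) *\<^sub>R b)"
  have y: "y \<bullet> c = 0" if "c \<in> onb" for c
    using that by (simp add: y_def inner_diff_left inner_sum_left inner_onb sum.delta if_distrib
        cong: if_cong)
  have "y \<bullet> z = 0" if "z \<in> span onb" for z
    using that by (induction rule: span_induct_alt) (simp_all add: inner_add_right y)
  then have "y \<bullet> y = 0"
    by (simp add: span_onb)
  then show ?thesis
    by (simp add: y_def)
qed

lemma linear_onb:
  fixes f :: "'a::findim_inner \<Rightarrow> 'b::real_vector"
  assumes "linear f"
  shows "f x = (\<Sum>b\<in>onb. (x \<bullet> b) *\<^sub>R f b)"
proof -
  have "f x = f (\<Sum>b\<in>onb. (x \<bullet> b) *\<^sub>R b)"
    by (simp add: onb_expand)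
  also have "\<dots> = (\<Sum>b\<in>onb. (x \<bullet> b) *\<^sub>R f b)"
    by (simp add: linear_sum[OF assms] linear_scale[OF assms])
  finally show ?thesis .
qed

lemma linear_imp_bounded_linear:
  fixes f :: "'a::findim_inner \<Rightarrow> 'b::real_normed_vector"
  assumes "linear f"
  shows "bounded_linear f"
proof -
  have "f = (\<lambda>x. \<Sum>b\<in>onb. (x \<bullet> b) *\<^sub>R f b)"
    using linear_onb[OF assms] by blast
  moreover have "bounded_linear (\<lambda>x. \<Sum>b\<in>onb. (x \<bullet> b) *\<^sub>R f b)"
    by (intro bounded_linear_sum bounded_linear_scaleR_const bounded_linear_inner_left)
  ultimately show ?thesis by simp
qed

lemma dim_onb: "dim (UNIV :: 'a::findim_inner set) = card (onb :: 'a set)"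
proof -
  have "0 \<notin> (onb :: 'a set)"
    using norm_onb by fastforce
  then have "independent (onb :: 'a set)"
    by (intro pairwise_orthogonal_independent orthogonal_onb)
  then show ?thesis
    by (metis dim_eq_card_independent dim_span span_onb)
qed

lemma dim_prod_self: "dim (UNIV :: ('a::findim_inner \<times> 'a) set) = 2 * dim (UNIV :: 'a set)"
proof -
  let ?B = "(\<lambda>b. (b, 0)) ` onb \<union> (\<lambda>b. (0, b)) ` onb :: ('a \<times> 'a) set"
  have z: "0 \<notin> (onb :: 'a set)"
    using norm_onb by fastforce
  have "pairwise orthogonal ?B"
    using orthogonal_onb[where 'a='a] by (auto simp: pairwise_def orthogonal_def) metis+
  moreover have "0 \<notin> ?B"
    using z by (auto simp: zero_prod_def)
  ultimately have ind: "independent ?B"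
    by (rule pairwise_orthogonal_independent)
  have "x \<in> span ?B" for x
  proof -
    have "x = (\<Sum>b\<in>onb. (fst x \<bullet> b) *\<^sub>R (b, 0)) + (\<Sum>b\<in>onb. (snd x \<bullet> b) *\<^sub>R (0, b))"
      by (rule prod_eqI) (simp_all add: fst_sum snd_sum onb_expand)
    moreover have "\<dots> \<in> span ?B"
      by (intro span_add span_sum span_scale span_base) auto
    ultimately show ?thesis by simp
  qed
  then have "dim (UNIV :: ('a \<times> 'a) set) = card ?B"
    by (metis UNIV_eq_I dim_eq_card_independent dim_span ind)
  also have "\<dots> = card ((\<lambda>b. (b, 0)) ` onb :: ('a \<times> 'a) set) + card ((\<lambda>b. (0, b)) ` onb :: ('a \<times> 'a) set)"
    using z by (intro card_Un_disjoint) auto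
  also have "\<dots> = 2 * card (onb :: 'a set)"
    by (simp add: card_image inj_on_def)
  finally show ?thesis
    by (simp add: dim_onb)
qed

text \<open>Completeness is what allows the power series \<open>omega\<close> to be differentiated term by term.\<close>

instance findim_inner \<subseteq> banach
proof
  fix X :: "nat \<Rightarrow> 'a" assume "Cauchy X"
  have "convergent (\<lambda>n. X n \<bullet> b)" for b
    using bounded_linear.Cauchy[OF bounded_linear_inner_left \<open>Cauchy X\<close>] Cauchy_convergent by blast
  then have "\<exists>l. (\<lambda>n. X n \<bullet> b) \<longlonglongrightarrow> l" for b
    by (simp add: convergent_def)
  then obtain l where "(\<lambda>n. X n \<bullet> b) \<longlonglongrightarrow> l b" for b
    by metis
  then have "(\<lambda>n. \<Sum>b\<in>onb. (X n \<bullet> b) *\<^sub>R b) \<longlonglongrightarrow> (\<Sum>b\<in>onb. l b *\<^sub>R b)"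
    by (intro tendsto_intros)
  then show "convergent X"
    by (auto simp: onb_expand convergent_def)
qed

section \<open>Smooth maps between open subsets of vector spaces\<close>

lemma fd_eqI: "(f has_derivative f') (at x) \<Longrightarrow> fd f x = f'"
  by (rule frechet_derivative_at[symmetric])

lemma fd_has_derivative: "f differentiable (at x) \<Longrightarrow> (f has_derivative fd f x) (at x)"
  by (simp add: frechet_derivative_works[symmetric])

lemma has_derivative_cong_open:
  assumes "open S" "x \<in> S" "\<And>y. y \<in> S \<Longrightarrow> f y = g y"
  shows "(f has_derivative f') (at x) \<longleftrightarrow> (g has_derivative f') (at x)"
  using assms has_derivative_transform_within_open[of f f' x UNIV S g]
    has_derivative_transform_within_open[of g f' x UNIV S f] by auto

lemma fd_cong_open:
  assumes "open S" "x \<in> S" "\<And>y. y \<in> S \<Longrightarrow> f y = g y"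
  shows "fd f x = fd g x"
  unfolding frechet_derivative_def by (simp only: has_derivative_cong_open[OF assms])

lemma differentiable_cong_open:
  assumes "open S" "x \<in> S" "\<And>y. y \<in> S \<Longrightarrow> f y = g y"
  shows "f differentiable (at x) \<longleftrightarrow> g differentiable (at x)"
  unfolding differentiable_def by (simp only: has_derivative_cong_open[OF assms])

lemma fd_compose:
  assumes "g differentiable (at x)" "f differentiable (at (g x))"
  shows "fd (\<lambda>y. f (g y)) x = (\<lambda>v. fd f (g x) (fd g x v))"
  using frechet_derivative_compose[OF assms] by (simp add: o_def)

lemma linear_fd: "f differentiable (at x) \<Longrightarrow> linear (fd f x)"
  by (rule linear_frechet_derivative)

lemma Ck_on_cong_imp:
  assumes "open S" "\<And>x. x \<in> S \<Longrightarrow> f x = g x" "Ck_on k S f"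
  shows "Ck_on k S g"
  using assms(2,3)
proof (induction k arbitrary: f g)
  case 0
  then show ?case by (simp cong: continuous_on_cong_simp)
next
  case (Suc k)
  have "fd f x v = fd g x v" if "x \<in> S" for x v
    using fd_cong_open[OF assms(1) that] Suc.prems(1) by metis
  then have "Ck_on k S (\<lambda>x. fd g x v)" for v
    using Suc.IH[of "\<lambda>x. fd f x v" "\<lambda>x. fd g x v"] Suc.prems(2) by simp
  moreover have "g differentiable (at x)" if "x \<in> S" for x
    using differentiable_cong_open[OF assms(1) that, of f g] Suc.prems that by simp
  ultimately show ?case by simp
qed

lemma Ck_on_subset: "Ck_on k S f \<Longrightarrow> T \<subseteq> S \<Longrightarrow> Ck_on k T f"
  by (induction k arbitrary: f) (auto intro: continuous_on_subset)

lemma Ck_on_SucD: "Ck_on (Suc k) S f \<Longrightarrow> Ck_on k S f"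
proof (induction k arbitrary: f)
  case 0
  then show ?case
    by (auto intro!: continuous_at_imp_continuous_on differentiable_imp_continuous_within)
qed simp

lemma Ck_on_local:
  assumes "\<And>x. x \<in> S \<Longrightarrow> \<exists>T. open T \<and> x \<in> T \<and> Ck_on k T f"
  shows "Ck_on k S f"
  using assms
proof (induction k arbitrary: f)
  case 0
  then show ?case
    by (metis Ck_on.simps(1) continuous_at_imp_continuous_on continuous_on_eq_continuous_at)
next
  case (Suc k)
  have "f differentiable (at x)" if "x \<in> S" for x
    using Suc.prems[OF that] by auto
  moreover have "Ck_on k S (\<lambda>x. fd f x v)" for v
    by (rule Suc.IH) (use Suc.prems in \<open>fastforce\<close>)
  ultimately show ?case by simp
qed

lemma Ck_on_const: "Ck_on k S (\<lambda>x. c)"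
  by (induction k arbitrary: c) auto

lemma Ck_on_bounded_linear:
  assumes "bounded_linear h" shows "Ck_on k S h"
proof (cases k)
  case 0
  then show ?thesis
    using assms by (simp add: linear_continuous_on)
next
  case (Suc n)
  have "fd h x = h" for x
    by (rule fd_eqI) (rule bounded_linear_imp_has_derivative[OF assms])
  then show ?thesis
    using Suc assms by (simp add: bounded_linear_imp_differentiable Ck_on_const)
qed

lemma Ck_on_add:
  assumes "open S" "Ck_on k S f" "Ck_on k S g"
  shows "Ck_on k S (\<lambda>x. f x + g x)"
  using assms(2,3)
proof (induction k arbitrary: f g)
  case 0
  then show ?case by (simp add: continuous_on_add)
next
  case (Suc k)
  have 1: "fd f x v + fd g x v = fd (\<lambda>x. f x + g x) x v" if "x \<in> S" for x v
    using fd_eqI[OF has_derivative_add[OF fd_has_derivative fd_has_derivative], of f x g] Suc.prems that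
    by simp
  have "Ck_on k S (\<lambda>x. fd (\<lambda>x. f x + g x) x v)" for v
    by (rule Ck_on_cong_imp[OF assms(1) 1]) (use Suc in simp_all)
  then show ?case
    using Suc.prems by simp
qed

lemma Ck_on_sum:
  assumes "open S" "\<And>i. i \<in> I \<Longrightarrow> Ck_on k S (f i)"
  shows "Ck_on k S (\<lambda>x. \<Sum>i\<in>I. f i x)"
  using assms(2)
  by (induction I rule: infinite_finite_induct) (auto simp: Ck_on_const intro: Ck_on_add[OF assms(1)])

lemma Ck_on_bilinear:
  assumes "bounded_bilinear B" "open S" "Ck_on k S f" "Ck_on k S g"
  shows "Ck_on k S (\<lambda>x. B (f x) (g x))"
  using assms(3,4)
proof (induction k arbitrary: f g)
  case 0
  then show ?case by (simp add: bounded_bilinear.continuous_on[OF assms(1)])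
next
  case (Suc k)
  have hd: "((\<lambda>x. B (f x) (g x)) has_derivative (\<lambda>v. B (f x) (fd g x v) + B (fd f x v) (g x))) (at x)"
    if "x \<in> S" for x
    using bounded_bilinear.FDERIV[OF assms(1) fd_has_derivative fd_has_derivative, of f x g]
      Suc.prems that by simp
  have 1: "B (f x) (fd g x v) + B (fd f x v) (g x) = fd (\<lambda>x. B (f x) (g x)) x v" if "x \<in> S" for x v
    by (simp add: fd_eqI[OF hd[OF that]])
  have "Ck_on k S (\<lambda>x. fd (\<lambda>x. B (f x) (g x)) x v)" for v
    by (rule Ck_on_cong_imp[OF assms(2) 1], assumption)
      (intro Ck_on_add[OF assms(2)] Suc.IH Ck_on_SucD[OF Suc.prems(1)] Ck_on_SucD[OF Suc.prems(2)],
        use Suc.prems in simp_all)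
  moreover have "(\<lambda>x. B (f x) (g x)) differentiable (at x)" if "x \<in> S" for x
    using hd[OF that] by (auto simp: differentiable_def)
  ultimately show ?case by simp
qed

lemma Ck_on_linear_compose:
  assumes "bounded_linear h" "open S" "Ck_on k S f"
  shows "Ck_on k S (\<lambda>x. h (f x))"
  using assms(3)
proof (induction k arbitrary: f)
  case 0
  then show ?case
    using bounded_linear.continuous_on[OF assms(1)] by simp
next
  case (Suc k)
  have hd: "((\<lambda>x. h (f x)) has_derivative (\<lambda>v. h (fd f x v))) (at x)" if "x \<in> S" for x
    by (rule bounded_linear.has_derivative[OF assms(1) fd_has_derivative]) (use Suc.prems that in simp)
  have "Ck_on k S (\<lambda>x. fd (\<lambda>x. h (f x)) x v)" for v
    by (rule Ck_on_cong_imp[OF assms(2), of "\<lambda>x. h (fd f x v)"])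
      (use Suc fd_eqI[OF hd] in simp_all)
  moreover have "(\<lambda>x. h (f x)) differentiable (at x)" if "x \<in> S" for x
    using hd[OF that] by (auto simp: differentiable_def)
  ultimately show ?case by simp
qed

text \<open>Expanding the inner derivative in a basis turns each directional derivative of the composite
  into products of functions one order lower, so that the induction on the order closes.\<close>

lemma Ck_on_compose:
  fixes g :: "'a::real_normed_vector \<Rightarrow> 'b::findim_inner"
    and f :: "'b \<Rightarrow> 'c::real_normed_vector"
  assumes "open S" "open T" "g ` S \<subseteq> T" "Ck_on k T f" "Ck_on k S g"
  shows "Ck_on k S (\<lambda>x. f (g x))"
  using assms(4,5)
proof (induction k arbitrary: f)
  case 0
  then show ?case using assms(3) by (auto intro: continuous_on_compose2)
next
  case (Suc k)
  have dg: "g differentiable (at x)" if "x \<in> S" for x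
    using Suc.prems that by simp
  have df: "f differentiable (at (g x))" if "x \<in> S" for x
    using Suc.prems assms(3) that by auto
  have 1: "(\<Sum>b\<in>onb. (fd g x v \<bullet> b) *\<^sub>R fd f (g x) b) = fd (\<lambda>x. f (g x)) x v" if "x \<in> S" for x v
    by (simp add: fd_compose[OF dg[OF that] df[OF that]] linear_onb[OF linear_fd[OF df[OF that]], symmetric])
  have "Ck_on k S (\<lambda>x. fd (\<lambda>x. f (g x)) x v)" for v
  proof (rule Ck_on_cong_imp[OF assms(1) 1], assumption)
    show "Ck_on k S (\<lambda>x. \<Sum>b\<in>onb. (fd g x v \<bullet> b) *\<^sub>R fd f (g x) b)"
      by (intro Ck_on_sum Ck_on_bilinear[OF bounded_bilinear_scaleR] assms(1)
          Ck_on_linear_compose[OF bounded_linear_inner_left] Suc.IH Ck_on_SucD[OF Suc.prems(2)])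
        (use Suc.prems in simp_all)
  qed
  moreover have "(\<lambda>x. f (g x)) differentiable (at x)" if "x \<in> S" for x
    using differentiable_chain_at[OF dg[OF that] df[OF that]] by (simp add: o_def)
  ultimately show ?case by simp
qed

lemma smooth_on_cong:
  assumes "open S" "\<And>x. x \<in> S \<Longrightarrow> f x = g x"
  shows "smooth_on S f \<longleftrightarrow> smooth_on S g"
proof -
  have "Ck_on k S f \<longleftrightarrow> Ck_on k S g" for k
    using Ck_on_cong_imp[OF assms(1), of f g k] Ck_on_cong_imp[OF assms(1), of g f k] assms(2) by auto
  then show ?thesis by (simp add: smooth_on_def)
qed

lemma smooth_on_cong_imp:
  assumes "open S" "smooth_on S f" "\<And>x. x \<in> S \<Longrightarrow> f x = g x"
  shows "smooth_on S g"
  using smooth_on_cong[OF assms(1,3)] assms(2) by simp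

lemma smooth_on_subset: "smooth_on S f \<Longrightarrow> T \<subseteq> S \<Longrightarrow> smooth_on T f"
  by (auto simp: smooth_on_def intro: Ck_on_subset)

lemma smooth_on_local:
  assumes "\<And>x. x \<in> S \<Longrightarrow> \<exists>T. open T \<and> x \<in> T \<and> smooth_on T f"
  shows "smooth_on S f"
  unfolding smooth_on_def
proof
  show "Ck_on k S f" for k
    by (rule Ck_on_local) (use assms in \<open>auto simp: smooth_on_def\<close>)
qed

lemma smooth_on_Ck: "smooth_on S f \<Longrightarrow> Ck_on k S f"
  by (simp add: smooth_on_def)

lemma smooth_on_differentiable: "smooth_on S f \<Longrightarrow> x \<in> S \<Longrightarrow> f differentiable (at x)"
  using smooth_on_Ck[of S f "Suc 0"] by simp

lemma smooth_on_continuous: "smooth_on S f \<Longrightarrow> continuous_on S f"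
  using smooth_on_Ck[of S f 0] by simp

lemma smooth_on_fd:
  assumes "smooth_on S f" shows "smooth_on S (\<lambda>x. fd f x v)"
proof -
  have "Ck_on k S (\<lambda>x. fd f x v)" for k
    using smooth_on_Ck[OF assms, of "Suc k"] by simp
  then show ?thesis by (simp add: smooth_on_def)
qed

lemma smooth_on_const [simp]: "smooth_on S (\<lambda>x. c)"
  by (simp add: smooth_on_def Ck_on_const)

lemma smooth_on_bounded_linear: "bounded_linear h \<Longrightarrow> smooth_on S h"
  by (simp add: smooth_on_def Ck_on_bounded_linear)

lemma smooth_on_ident [simp]: "smooth_on S (\<lambda>x. x)"
  by (simp add: smooth_on_bounded_linear bounded_linear_ident)

lemma smooth_on_add: "open S \<Longrightarrow> smooth_on S f \<Longrightarrow> smooth_on S g \<Longrightarrow> smooth_on S (\<lambda>x. f x + g x)"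
  by (simp add: smooth_on_def Ck_on_add)

lemma smooth_on_sum: "open S \<Longrightarrow> (\<And>i. i \<in> I \<Longrightarrow> smooth_on S (f i)) \<Longrightarrow> smooth_on S (\<lambda>x. \<Sum>i\<in>I. f i x)"
  by (simp add: smooth_on_def Ck_on_sum)

lemma smooth_on_bilinear:
  "bounded_bilinear B \<Longrightarrow> open S \<Longrightarrow> smooth_on S f \<Longrightarrow> smooth_on S g \<Longrightarrow> smooth_on S (\<lambda>x. B (f x) (g x))"
  by (simp add: smooth_on_def Ck_on_bilinear)

lemmas smooth_on_scaleR = smooth_on_bilinear[OF bounded_bilinear_scaleR]

lemma smooth_on_linear_compose:
  "bounded_linear h \<Longrightarrow> open S \<Longrightarrow> smooth_on S f \<Longrightarrow> smooth_on S (\<lambda>x. h (f x))"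
  by (simp add: smooth_on_def Ck_on_linear_compose)

lemmas smooth_on_fst = smooth_on_linear_compose[OF bounded_linear_fst]
lemmas smooth_on_snd = smooth_on_linear_compose[OF bounded_linear_snd]
lemmas smooth_on_inner_const = smooth_on_linear_compose[OF bounded_linear_inner_left]

lemma smooth_on_compose:
  fixes g :: "'a::real_normed_vector \<Rightarrow> 'b::findim_inner"
  assumes "open S" "open T" "g ` S \<subseteq> T" "smooth_on T f" "smooth_on S g"
  shows "smooth_on S (\<lambda>x. f (g x))"
  using Ck_on_compose[OF assms(1-3)] assms(4,5) by (auto simp: smooth_on_def)

lemma smooth_on_Pair:
  assumes "open S" "smooth_on S f" "smooth_on S g"
  shows "smooth_on S (\<lambda>x. (f x, g x))"
proof -
  have "bounded_linear (\<lambda>x. (x, 0))" "bounded_linear (\<lambda>x. (0, x))"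
    by (auto intro!: bounded_linear_Pair bounded_linear_ident bounded_linear_zero)
  then have "smooth_on S (\<lambda>x. (f x, 0) + (0, g x))"
    by (intro smooth_on_add assms(1)) (auto intro: smooth_on_linear_compose assms)
  then show ?thesis by simp
qed

text \<open>By an expansion in a basis, a family of linear maps is jointly smooth as soon as its columns
  \<open>L x b\<close> are.\<close>

lemma smooth_on_linear_family:
  fixes L :: "'a::findim_inner \<Rightarrow> 'b::findim_inner \<Rightarrow> 'c::real_normed_vector"
  assumes "open S" "open T" "g ` T \<subseteq> S"
    and "\<And>b. smooth_on S (\<lambda>x. L x b)" "\<And>x. x \<in> S \<Longrightarrow> linear (L x)"
    and "smooth_on T g" "smooth_on T h"
  shows "smooth_on T (\<lambda>y. L (g y) (h y))"
proof -
  have 1: "(\<Sum>b\<in>onb. (h y \<bullet> b) *\<^sub>R L (g y) b) = L (g y) (h y)" if "y \<in> T" for y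
    using linear_onb[of "L (g y)" "h y"] assms(3,5) that by (simp add: image_subset_iff)
  have "smooth_on T (\<lambda>y. \<Sum>b\<in>onb. (h y \<bullet> b) *\<^sub>R L (g y) b)"
    by (intro smooth_on_sum smooth_on_scaleR smooth_on_inner_const assms(2,7)
        smooth_on_compose[OF assms(2,1,3) assms(4) assms(6)])
  then show ?thesis
    using smooth_on_cong[OF assms(2) 1] by simp
qed

lemma smooth_on_fd_apply:
  fixes f :: "'a::findim_inner \<Rightarrow> 'c::real_normed_vector"
  assumes "open S" "open T" "g ` T \<subseteq> S" "smooth_on S f" "smooth_on T g" "smooth_on T h"
  shows "smooth_on T (\<lambda>y. fd f (g y) (h y))"
  by (rule smooth_on_linear_family[OF assms(1-3)])
    (auto intro: smooth_on_fd linear_fd smooth_on_differentiable assms)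

text \<open>The product rule for linear maps that vary with the point. It differentiates left-invariant
  frames, push-forwards \<open>fd F z (Y z)\<close> and the slopes of the polarization alike.\<close>

lemma has_derivative_linear_family:
  fixes L :: "'a::real_normed_vector \<Rightarrow> 'b::findim_inner \<Rightarrow> 'c::real_normed_vector"
  assumes "open S" "x \<in> S" "\<And>y. y \<in> S \<Longrightarrow> linear (L y)"
    and "\<And>b. (\<lambda>y. L y b) differentiable (at x)" "(h has_derivative h') (at x)"
  shows "((\<lambda>y. L y (h y)) has_derivative (\<lambda>k. fd (\<lambda>y. L y (h x)) x k + L x (h' k))) (at x)"
proof -
  note d = fd_has_derivative[OF assms(4)]
  have 1: "((\<lambda>y. \<Sum>b\<in>onb. (h y \<bullet> b) *\<^sub>R L y b) has_derivative
      (\<lambda>k. \<Sum>b\<in>onb. (h x \<bullet> b) *\<^sub>R fd (\<lambda>y. L y b) x k + (h' k \<bullet> b) *\<^sub>R L x b)) (at x)"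
    by (intro has_derivative_sum has_derivative_scaleR d has_derivative_inner_left assms(5))
  have "((\<lambda>y. \<Sum>b\<in>onb. (h x \<bullet> b) *\<^sub>R L y b) has_derivative
      (\<lambda>k. \<Sum>b\<in>onb. (h x \<bullet> b) *\<^sub>R fd (\<lambda>y. L y b) x k)) (at x)"
    by (intro has_derivative_sum has_derivative_scaleR_right d)
  then have "((\<lambda>y. L y (h x)) has_derivative (\<lambda>k. \<Sum>b\<in>onb. (h x \<bullet> b) *\<^sub>R fd (\<lambda>y. L y b) x k)) (at x)"
    by (subst has_derivative_cong_open[OF assms(1,2), of _ "\<lambda>y. \<Sum>b\<in>onb. (h x \<bullet> b) *\<^sub>R L y b"])
      (simp_all add: linear_onb[OF assms(3)])
  note 2 = fd_eqI[OF this]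
  have "((\<lambda>y. L y (h y)) has_derivative
      (\<lambda>k. \<Sum>b\<in>onb. (h x \<bullet> b) *\<^sub>R fd (\<lambda>y. L y b) x k + (h' k \<bullet> b) *\<^sub>R L x b)) (at x)"
    by (subst has_derivative_cong_open[OF assms(1,2), of _ "\<lambda>y. \<Sum>b\<in>onb. (h y \<bullet> b) *\<^sub>R L y b"])
      (use 1 linear_onb[OF assms(3)] in simp_all)
  then show ?thesis
    by (simp add: 2 sum.distrib linear_onb[OF assms(3)[OF assms(2)], symmetric])
qed

text \<open>The mean value theorem in direction \<open>v\<close>, then in direction \<open>w\<close>.\<close>

lemma second_difference:
  fixes f :: "'a::real_normed_vector \<Rightarrow> real"
  assumes S: "open S" "\<And>s t. s \<in> {0..h} \<Longrightarrow> t \<in> {0..h} \<Longrightarrow> x + s *\<^sub>R v + t *\<^sub>R w \<in> S"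
    and h: "0 < h" and f: "smooth_on S f"
  shows "\<exists>s\<in>{0..h}. \<exists>t\<in>{0..h}.
    f (x + h *\<^sub>R v + h *\<^sub>R w) - f (x + h *\<^sub>R v) - f (x + h *\<^sub>R w) + f x
      = h * h * fd (\<lambda>y. fd f y v) (x + s *\<^sub>R v + t *\<^sub>R w) w"
proof -
  have chain: "((\<lambda>s. g (y + s *\<^sub>R u)) has_field_derivative fd g (y + s *\<^sub>R u) u) (at s within T)"
    if "smooth_on S g" "y + s *\<^sub>R u \<in> S" for g :: "'a \<Rightarrow> real" and y s u T
  proof -
    have d: "(g has_derivative fd g (y + s *\<^sub>R u)) (at (y + s *\<^sub>R u))"
      using smooth_on_differentiable[OF that] by (rule fd_has_derivative)
    have "((\<lambda>s. g (y + s *\<^sub>R u)) has_derivative (\<lambda>k. fd g (y + s *\<^sub>R u) (k *\<^sub>R u))) (at s)"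
      by (rule has_derivative_compose[of "\<lambda>s. y + s *\<^sub>R u" _ s UNIV g, OF _ d])
        (auto intro!: derivative_eq_intros)
    moreover have "(\<lambda>k. fd g (y + s *\<^sub>R u) (k *\<^sub>R u)) = (*) (fd g (y + s *\<^sub>R u) u)"
      by (rule ext) (simp add: linear_scale[OF has_derivative_linear[OF d]])
    ultimately have "((\<lambda>s. g (y + s *\<^sub>R u)) has_derivative (*) (fd g (y + s *\<^sub>R u) u)) (at s)"
      by metis
    then show ?thesis
      by (simp add: has_field_derivative_def has_derivative_at_withinI)
  qed
  let ?p = "\<lambda>s. f ((x + h *\<^sub>R w) + s *\<^sub>R v) - f (x + s *\<^sub>R v)"
  have "\<exists>s. 0 < s \<and> s < h \<and> ?p h - ?p 0 = (h - 0) * (fd f ((x + h *\<^sub>R w) + s *\<^sub>R v) v - fd f (x + s *\<^sub>R v) v)"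
  proof (rule MVT2[OF h])
    fix s assume "0 \<le> s" "s \<le> h"
    then show "(?p has_real_derivative fd f ((x + h *\<^sub>R w) + s *\<^sub>R v) v - fd f (x + s *\<^sub>R v) v) (at s)"
      using S(2)[of s h] S(2)[of s 0] h by (intro DERIV_diff chain f) (auto simp: add.commute add.left_commute)
  qed
  then obtain s where s: "0 < s" "s < h"
    "?p h - ?p 0 = h * (fd f ((x + h *\<^sub>R w) + s *\<^sub>R v) v - fd f (x + s *\<^sub>R v) v)" by auto
  let ?q = "\<lambda>t. fd f ((x + s *\<^sub>R v) + t *\<^sub>R w) v"
  have "\<exists>t. 0 < t \<and> t < h \<and> ?q h - ?q 0 = (h - 0) * fd (\<lambda>y. fd f y v) ((x + s *\<^sub>R v) + t *\<^sub>R w) w"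
  proof (rule MVT2[OF h])
    fix t assume "0 \<le> t" "t \<le> h"
    then show "(?q has_real_derivative fd (\<lambda>y. fd f y v) ((x + s *\<^sub>R v) + t *\<^sub>R w) w) (at t)"
      using S(2)[of s t] s by (intro chain smooth_on_fd f) auto
  qed
  then obtain t where t: "0 < t" "t < h" "?q h - ?q 0 = h * fd (\<lambda>y. fd f y v) ((x + s *\<^sub>R v) + t *\<^sub>R w) w"
    by auto
  have "?p h - ?p 0 = h * (?q h - ?q 0)"
    using s(3) by (simp add: add.commute add.left_commute)
  then show ?thesis
    using s t by (intro bexI[of _ s] bexI[of _ t]) (simp_all add: add.commute add.left_commute algebra_simps)
qed

text \<open>The second difference is symmetric in \<open>v\<close> and \<open>w\<close>, and after division by \<open>h\<^sup>2\<close> it is a value of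
  either mixed derivative near \<open>x\<close>.\<close>

lemma fd_commute_real:
  fixes f :: "'a::real_normed_vector \<Rightarrow> real"
  assumes "open S" "x \<in> S" "smooth_on S f"
  shows "fd (\<lambda>y. fd f y v) x w = fd (\<lambda>y. fd f y w) x v"
proof -
  define A where "A = (\<lambda>y. fd (\<lambda>y. fd f y v) y w)"
  define B where "B = (\<lambda>y. fd (\<lambda>y. fd f y w) y v)"
  have cA: "isCont A x" and cB: "isCont B x"
    using smooth_on_continuous[OF smooth_on_fd[OF smooth_on_fd[OF assms(3)]]] assms(1,2)
    unfolding A_def B_def by (auto simp: continuous_on_eq_continuous_at)
  have "\<bar>A x - B x\<bar> \<le> e" if "e > 0" for e
  proof -
    obtain d1 where d1: "d1 > 0" "\<And>y. dist y x < d1 \<Longrightarrow> dist (A y) (A x) < e / 2"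
      using cA \<open>e > 0\<close> unfolding continuous_at_eps_delta
      by (metis dist_commute half_gt_zero)
    obtain d2 where d2: "d2 > 0" "\<And>y. dist y x < d2 \<Longrightarrow> dist (B y) (B x) < e / 2"
      using cB \<open>e > 0\<close> unfolding continuous_at_eps_delta
      by (metis dist_commute half_gt_zero)
    obtain d3 where d3: "d3 > 0" "ball x d3 \<subseteq> S"
      using assms(1,2) openE by blast
    define r where "r = min d1 (min d2 d3)"
    define m where "m = norm v + norm w + 1"
    define h where "h = r / m / 2"
    have r: "r > 0" using d1 d2 d3 by (simp add: r_def)
    have n: "m > 0"
      unfolding m_def by (smt (verit) norm_ge_zero)
    have h: "h > 0" using r n by (simp add: h_def)
    have near: "dist (x + s *\<^sub>R v + t *\<^sub>R w) x < r" if "s \<in> {0..h}" "t \<in> {0..h}" for s t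
    proof -
      have "dist (x + s *\<^sub>R v + t *\<^sub>R w) x = norm (s *\<^sub>R v + t *\<^sub>R w)"
        by (simp add: dist_norm)
      also have "\<dots> \<le> h * norm v + h * norm w"
        using that by (intro norm_triangle_le add_mono) (auto intro!: mult_right_mono)
      also have "\<dots> \<le> h * m"
        using h by (simp add: m_def algebra_simps)
      also have "\<dots> = r / 2"
        using n by (simp add: h_def field_simps)
      also have "\<dots> < r" using r by simp
      finally show ?thesis .
    qed
    have inS: "x + s *\<^sub>R v + t *\<^sub>R w \<in> S" if "s \<in> {0..h}" "t \<in> {0..h}" for s t
      using near[OF that] d3(2) by (auto simp: r_def dist_commute)
    have inS': "x + s *\<^sub>R w + t *\<^sub>R v \<in> S" if "s \<in> {0..h}" "t \<in> {0..h}" for s t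
      using inS[OF that(2,1)] by (simp add: add.commute add.left_commute)
    obtain s t where st: "s \<in> {0..h}" "t \<in> {0..h}"
      "f (x + h *\<^sub>R v + h *\<^sub>R w) - f (x + h *\<^sub>R v) - f (x + h *\<^sub>R w) + f x = h * h * A (x + s *\<^sub>R v + t *\<^sub>R w)"
      using second_difference[OF assms(1) inS h assms(3)] unfolding A_def by blast
    obtain s' t' where st': "s' \<in> {0..h}" "t' \<in> {0..h}"
      "f (x + h *\<^sub>R w + h *\<^sub>R v) - f (x + h *\<^sub>R w) - f (x + h *\<^sub>R v) + f x = h * h * B (x + s' *\<^sub>R w + t' *\<^sub>R v)"
      using second_difference[OF assms(1) inS' h assms(3)] unfolding B_def by blast
    have "h * h * A (x + s *\<^sub>R v + t *\<^sub>R w) = h * h * B (x + s' *\<^sub>R w + t' *\<^sub>R v)"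
      using st(3) st'(3) unfolding add.assoc add.commute[of "h *\<^sub>R w" "h *\<^sub>R v"] by linarith
    then have "A (x + s *\<^sub>R v + t *\<^sub>R w) = B (x + t' *\<^sub>R v + s' *\<^sub>R w)"
      using h by (simp add: add.commute add.left_commute)
    moreover have "dist (A (x + s *\<^sub>R v + t *\<^sub>R w)) (A x) < e / 2"
      using near[OF st(1,2)] by (intro d1) (simp add: r_def)
    moreover have "dist (B (x + t' *\<^sub>R v + s' *\<^sub>R w)) (B x) < e / 2"
      using near[OF st'(2,1)] by (intro d2) (simp add: r_def)
    moreover have "\<bar>a' - b'\<bar> \<le> e" if "a = b" "\<bar>a - a'\<bar> < e / 2" "\<bar>b - b'\<bar> < e / 2" for a b a' b' :: real
      using that by linarith
    ultimately show ?thesis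
      unfolding dist_real_def by blast
  qed
  then have "\<bar>A x - B x\<bar> \<le> 0"
    by (rule field_le_epsilon) simp
  then have "A x = B x"
    by simp
  then show ?thesis unfolding A_def B_def .
qed

lemma fd_commute:
  fixes f :: "'a::real_normed_vector \<Rightarrow> 'b::real_inner"
  assumes "open S" "x \<in> S" "smooth_on S f"
  shows "fd (\<lambda>y. fd f y v) x w = fd (\<lambda>y. fd f y w) x v"
proof -
  have inn: "fd (\<lambda>y. g y \<bullet> c) y u = fd g y u \<bullet> c" if "g differentiable (at y)" for g :: "'a \<Rightarrow> 'b" and y u c
    using fd_eqI[OF has_derivative_inner_left[OF fd_has_derivative[OF that]]] by (rule fun_cong)
  have key: "fd (\<lambda>y. fd f y v) x w \<bullet> c = fd (\<lambda>y. fd (\<lambda>y. f y \<bullet> c) y v) x w" for c v w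
  proof -
    have "fd (\<lambda>y. fd f y v) x w \<bullet> c = fd (\<lambda>y. fd f y v \<bullet> c) x w"
      by (rule inn[symmetric]) (rule smooth_on_differentiable[OF smooth_on_fd[OF assms(3)] assms(2)])
    also have "fd (\<lambda>y. fd f y v \<bullet> c) x = fd (\<lambda>y. fd (\<lambda>y. f y \<bullet> c) y v) x"
      by (rule fd_cong_open[OF assms(1,2)]) (simp add: inn smooth_on_differentiable[OF assms(3)])
    finally show ?thesis .
  qed
  have "fd (\<lambda>y. fd f y v) x w \<bullet> c = fd (\<lambda>y. fd f y w) x v \<bullet> c" for c
    unfolding key[of v w c] key[of w v c]
    by (rule fd_commute_real[OF assms(1,2) smooth_on_inner_const[OF assms(1,3)]])
  then show ?thesis
    by (rule vector_eq_rdot[THEN iffD1, OF allI])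
qed

text \<open>Differentiating the relations \<open>X' \<circ> F = DF X\<close> and \<open>Y' \<circ> F = DF Y\<close> produces second derivatives of
  \<open>F\<close>, which cancel by symmetry. This is the only form in which naturality of brackets is used:
  for coordinate changes, left translations and the trivialization of \<open>TG\<close>.\<close>

lemma related_fields_bracket:
  fixes F :: "'a::findim_inner \<Rightarrow> 'b::real_inner"
  assumes "open S" "x \<in> S" "smooth_on S F"
    and "X differentiable (at x)" "Y differentiable (at x)"
    and "X' differentiable (at (F x))" "Y' differentiable (at (F x))"
    and X: "\<And>z. z \<in> S \<Longrightarrow> X' (F z) = fd F z (X z)" and Y: "\<And>z. z \<in> S \<Longrightarrow> Y' (F z) = fd F z (Y z)"
  shows "fd Y' (F x) (X' (F x)) - fd X' (F x) (Y' (F x)) = fd F x (fd Y x (X x) - fd X x (Y x))"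
proof -
  have dF: "F differentiable (at z)" if "z \<in> S" for z
    using smooth_on_differentiable[OF assms(3) that] .
  have main: "fd Y' (F x) (fd F x k) = fd (\<lambda>z. fd F z (Y x)) x k + fd F x (fd Y x k)"
    if "Y differentiable (at x)" "Y' differentiable (at (F x))" "\<And>z. z \<in> S \<Longrightarrow> Y' (F z) = fd F z (Y z)"
    for Y Y' k
  proof -
    have "fd (\<lambda>z. Y' (F z)) x = fd (\<lambda>z. fd F z (Y z)) x"
      by (rule fd_cong_open[OF assms(1,2) that(3)])
    also have "\<dots> = (\<lambda>k. fd (\<lambda>z. fd F z (Y x)) x k + fd F x (fd Y x k))"
      by (rule fd_eqI, rule has_derivative_linear_family[OF assms(1,2)])
        (auto intro: linear_fd dF smooth_on_differentiable[OF smooth_on_fd[OF assms(3)] assms(2)]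
          fd_has_derivative that)
    finally show ?thesis
      by (simp add: fd_compose[OF dF[OF assms(2)] that(2)] fun_eq_iff)
  qed
  have "fd (\<lambda>z. fd F z (Y x)) x (X x) = fd (\<lambda>z. fd F z (X x)) x (Y x)"
    by (rule fd_commute[OF assms(1-3)])
  moreover note main[OF assms(5,7) Y, of "X x"] main[OF assms(4,6) X, of "Y x"]
  ultimately show ?thesis
    unfolding linear_diff[OF linear_fd[OF dF[OF assms(2)]]] X[OF assms(2)] Y[OF assms(2)]
    by (simp only: add_diff_cancel_left)
qed

section \<open>The logarithmic derivative of the exponential in a Lie algebra\<close>

locale lie_algebra =
  fixes br :: "'a::findim_inner \<Rightarrow> 'a \<Rightarrow> 'a"
  assumes bilinear: "bounded_bilinear br"
    and antisym: "br x y = - br y x"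
    and jacobi: "br x (br y z) + br y (br z x) + br z (br x y) = 0"
begin

sublocale b: bounded_bilinear br
  by (rule bilinear)

lemma br_self [simp]: "br x x = 0"
  using antisym[of x x] by (simp add: eq_neg_iff_add_eq_0 flip: scaleR_2)

lemma derivation: "br x (br y z) = br (br x y) z + br y (br x z)"
proof -
  have "br z (br x y) = - br (br x y) z" "br y (br z x) = - br y (br x z)"
    by (rule antisym) (simp add: antisym[of z x] b.minus_right)
  then show ?thesis
    using jacobi[of x y z] by (simp add: algebra_simps)
qed

text \<open>\<open>ad_deriv vs k u w\<close> is the derivative of \<open>u \<mapsto> (ad u)\<^sup>k w\<close> in the directions \<open>vs\<close>. The recursion is the
  Leibniz rule for \<open>(ad u)\<^sup>k\<^sup>+\<^sup>1 = ad u (ad u)\<^sup>k\<close>: at most one direction falls on the outer factor.\<close>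

fun ad_deriv :: "'a list \<Rightarrow> nat \<Rightarrow> 'a \<Rightarrow> 'a \<Rightarrow> 'a" where
  "ad_deriv vs 0 u w = (if vs = [] then w else 0)"
| "ad_deriv vs (Suc k) u w = br u (ad_deriv vs k u w) +
     (\<Sum>i<length vs. br (vs ! i) (ad_deriv (take i vs @ drop (Suc i) vs) k u w))"

lemma ad_deriv_has_derivative:
  "((\<lambda>u. ad_deriv vs k u w) has_derivative (\<lambda>v. ad_deriv (v # vs) k u w)) (at u)"
proof (induction k arbitrary: vs)
  case (Suc k)
  have "((\<lambda>u. ad_deriv vs (Suc k) u w) has_derivative
      (\<lambda>v. (br u (ad_deriv (v # vs) k u w) + br v (ad_deriv vs k u w)) +
        (\<Sum>i<length vs. br (vs ! i) (ad_deriv (v # take i vs @ drop (Suc i) vs) k u w)))) (at u)"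
    unfolding ad_deriv.simps
    by (intro has_derivative_add has_derivative_sum b.FDERIV Suc has_derivative_ident
        bounded_linear.has_derivative[OF b.bounded_linear_right])
  moreover have "(\<lambda>v. ad_deriv (v # vs) (Suc k) u w) = (\<lambda>v. (br u (ad_deriv (v # vs) k u w) + br v (ad_deriv vs k u w)) +
        (\<Sum>i<length vs. br (vs ! i) (ad_deriv (v # take i vs @ drop (Suc i) vs) k u w)))"
    by (simp add: sum.lessThan_Suc_shift add.assoc del: sum.lessThan_Suc)
  ultimately show ?case by simp
qed simp

definition K :: real where
  "K = (SOME K. 0 < K \<and> (\<forall>x y. norm (br x y) \<le> norm x * norm y * K))"

lemma K_pos: "0 < K" and norm_br: "norm (br x y) \<le> K * norm x * norm y"
proof -
  have "0 < K \<and> (\<forall>x y. norm (br x y) \<le> norm x * norm y * K)"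
    unfolding K_def using b.pos_bounded by (rule someI_ex)
  then show "0 < K" "norm (br x y) \<le> K * norm x * norm y"
    by (simp_all add: mult.commute mult.left_commute)
qed

lemma sum_list_remove:
  assumes "i < length vs"
  shows "sum_list (map f vs) = f (vs ! i) + sum_list (map f (take i vs @ drop (Suc i) vs) :: real list)"
proof -
  have "vs = take i vs @ vs ! i # drop (Suc i) vs"
    using assms by (rule id_take_nth_drop)
  then have "sum_list (map f vs) = sum_list (map f (take i vs @ vs ! i # drop (Suc i) vs))"
    by simp
  then show ?thesis by simp
qed

text \<open>The directions still available in a recursive call have smaller total norm, so the geometric
  bound with \<open>norm u\<close> enlarged by the norms of all directions reproduces itself.\<close>

lemma norm_ad_deriv:
  "norm (ad_deriv vs k u w) \<le> norm w * (K * (norm u + sum_list (map norm vs))) ^ k"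
proof (induction k arbitrary: vs)
  case (Suc k)
  define s where "s = norm u + sum_list (map norm vs)"
  have s0: "0 \<le> sum_list (map norm vs)" for vs :: "'a list"
    by (rule sum_list_nonneg) auto
  then have s: "0 \<le> s" by (simp add: s_def)
  have br: "norm (br x (ad_deriv ys k u w)) \<le> norm x * (K * (norm w * (K * s) ^ k))"
    if "sum_list (map norm ys) \<le> sum_list (map norm vs)" for x ys
  proof -
    have "norm (ad_deriv ys k u w) \<le> norm w * (K * (norm u + sum_list (map norm ys))) ^ k"
      by (rule Suc)
    also have "\<dots> \<le> norm w * (K * s) ^ k"
      using that K_pos s0[of ys] by (intro mult_left_mono power_mono) (auto simp: s_def)
    finally have "K * norm x * norm (ad_deriv ys k u w) \<le> K * norm x * (norm w * (K * s) ^ k)"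
      using K_pos by (intro mult_left_mono) auto
    with norm_br[of x "ad_deriv ys k u w"] show ?thesis
      by (simp only: mult.assoc mult.left_commute[of "norm x" K])
  qed
  have "norm (ad_deriv vs (Suc k) u w) \<le> norm u * (K * (norm w * (K * s) ^ k))
      + (\<Sum>i<length vs. norm (vs ! i) * (K * (norm w * (K * s) ^ k)))"
    unfolding ad_deriv.simps
  proof (intro order.trans[OF norm_triangle_ineq] add_mono order.trans[OF norm_sum] sum_mono br)
    fix i assume "i \<in> {..<length vs}"
    then show "sum_list (map norm (take i vs @ drop (Suc i) vs)) \<le> sum_list (map norm vs)"
      using sum_list_remove[of i vs norm] by simp
  qed simp
  also have "(\<Sum>i<length vs. norm (vs ! i) * (K * (norm w * (K * s) ^ k)))
      = sum_list (map norm vs) * (K * (norm w * (K * s) ^ k))"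
    by (simp add: sum_distrib_right[symmetric] sum_list_sum_nth atLeast0LessThan)
  also have "norm u * (K * (norm w * (K * s) ^ k)) + \<dots> = norm w * (K * s) ^ Suc k"
    unfolding distrib_right[symmetric] s_def[symmetric] power_Suc by (simp only: ac_simps)
  finally show ?case by (simp only: s_def)
qed simp

lemma linear_ad_deriv_Cons: "linear (\<lambda>v. ad_deriv (v # vs) k u w)"
  using ad_deriv_has_derivative by (rule has_derivative_linear)

lemma linear_ad_deriv: "linear (ad_deriv vs k u)"
proof (induction k arbitrary: vs)
  case 0
  then show ?case by (intro linearI) auto
next
  case (Suc k)
  have "linear (\<lambda>w. br u (ad_deriv vs k u w) +
     (\<Sum>i<length vs. br (vs ! i) (ad_deriv (take i vs @ drop (Suc i) vs) k u w)))"
    by (intro linear_compose_add linear_compose_sum ballI linear_compose[OF Suc, unfolded o_def]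
        bounded_linear.linear[OF b.bounded_linear_right])
  then show ?case by (simp add: fun_eq_iff[symmetric])
qed

text \<open>Proportionality to \<open>norm v\<close> is what the uniform convergence of the differentiated series in
  operator norm requires.\<close>

lemma norm_ad_deriv_Cons:
  "norm (ad_deriv (v # vs) k u w) \<le> norm v * (norm w * (K * (norm u + 1 + sum_list (map norm vs))) ^ k)"
proof (cases "v = 0")
  case True
  then show ?thesis using linear_0[OF linear_ad_deriv_Cons] by simp
next
  case False
  then have "ad_deriv (v # vs) k u w = norm v *\<^sub>R ad_deriv ((v /\<^sub>R norm v) # vs) k u w"
    by (subst linear_scale[OF linear_ad_deriv_Cons, symmetric]) simp
  then have "norm (ad_deriv (v # vs) k u w) = norm v * norm (ad_deriv ((v /\<^sub>R norm v) # vs) k u w)"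
    by simp
  also have "\<dots> \<le> norm v * (norm w * (K * (norm u + sum_list (map norm ((v /\<^sub>R norm v) # vs)))) ^ k)"
    by (intro mult_left_mono norm_ad_deriv) simp
  finally show ?thesis using False by (simp add: add.assoc)
qed

text \<open>With \<open>\<psi>(z) = (e\<^sup>z - 1) / z = \<Sum>k. z\<^sup>k / (k+1)!\<close> the map \<open>omega u\<close> is \<open>\<psi>(ad u)\<close>, the right logarithmic
  derivative of the exponential at \<open>u\<close>. Carrying the list of directions along makes the class of
  functions \<open>omega_deriv vs\<close> closed under differentiation, which gives smoothness at once.\<close>

definition omega_term :: "'a list \<Rightarrow> nat \<Rightarrow> 'a \<Rightarrow> 'a \<Rightarrow> 'a" where
  "omega_term vs k u w = ad_deriv vs k u w /\<^sub>R fact (Suc k)"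

definition omega_deriv :: "'a list \<Rightarrow> 'a \<Rightarrow> 'a \<Rightarrow> 'a" where
  "omega_deriv vs u w = (\<Sum>k. omega_term vs k u w)"

abbreviation omega :: "'a \<Rightarrow> 'a \<Rightarrow> 'a" where
  "omega \<equiv> omega_deriv []"

lemma summable_exp_tail: "summable (\<lambda>k. c * R ^ k / fact (Suc k) :: real)"
proof (rule summable_comparison_test')
  show "summable (\<lambda>k. \<bar>c\<bar> * (inverse (fact k) * \<bar>R\<bar> ^ k))"
    by (intro summable_mult summable_exp)
  show "norm (c * R ^ k / fact (Suc k)) \<le> \<bar>c\<bar> * (inverse (fact k) * \<bar>R\<bar> ^ k)" for k
  proof -
    have "inverse (fact (Suc k)) \<le> (inverse (fact k) :: real)"
      by (intro le_imp_inverse_le fact_mono) auto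
    then have "\<bar>c\<bar> * (inverse (fact (Suc k)) * \<bar>R\<bar> ^ k) \<le> \<bar>c\<bar> * (inverse (fact k) * \<bar>R\<bar> ^ k)"
      by (rule mult_left_mono[OF mult_right_mono]) simp_all
    moreover have "norm (c * R ^ k / fact (Suc k)) = \<bar>c\<bar> * (inverse (fact (Suc k)) * \<bar>R\<bar> ^ k)"
      by (simp add: abs_mult power_abs divide_inverse del: fact_Suc)
    ultimately show ?thesis by (simp only:)
  qed
qed

lemma norm_omega_term:
  "norm (omega_term vs k u w) \<le> norm w * (K * (norm u + sum_list (map norm vs))) ^ k / fact (Suc k)"
  unfolding omega_term_def norm_scaleR divide_inverse
  by (subst mult.commute) (simp add: norm_ad_deriv mult_right_mono del: fact_Suc)

lemma summable_omega_term: "summable (\<lambda>k. omega_term vs k u w)"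
  by (rule summable_comparison_test'[OF summable_exp_tail norm_omega_term])

lemma omega_deriv_has_derivative:
  "((\<lambda>u. omega_deriv vs u w) has_derivative (\<lambda>v. omega_deriv (v # vs) u w)) (at u)"
proof -
  define R where "R = norm u + 1"
  define s where "s = sum_list (map norm vs)"
  have s: "0 \<le> s" unfolding s_def by (rule sum_list_nonneg) auto
  define t where "t = (\<lambda>k. norm w * (K * (R + 1 + s)) ^ k / fact (Suc k))"
  have t: "norm (omega_term (v # vs) k x w) \<le> norm v * t k" if "x \<in> ball 0 R" for v k x
  proof -
    have "norm (ad_deriv (v # vs) k x w) \<le> norm v * (norm w * (K * (norm x + 1 + s)) ^ k)"
      unfolding s_def by (rule norm_ad_deriv_Cons)
    also have "\<dots> \<le> norm v * (norm w * (K * (R + 1 + s)) ^ k)"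
      using that K_pos s by (intro mult_left_mono power_mono) auto
    finally have "norm (ad_deriv (v # vs) k x w) * inverse (fact (Suc k))
        \<le> norm v * (norm w * (K * (R + 1 + s)) ^ k) * inverse (fact (Suc k))"
      by (rule mult_right_mono) simp
    then show ?thesis
      by (simp add: omega_term_def t_def divide_inverse ac_simps del: fact_Suc)
  qed
  have st: "summable t" unfolding t_def by (rule summable_exp_tail)
  have "\<exists>g. \<forall>x\<in>ball 0 R. (\<lambda>n. omega_term vs n x w) sums (g x) \<and>
    (g has_derivative (\<lambda>v. omega_deriv (v # vs) x w)) (at x within ball 0 R)"
  proof (rule has_derivative_series)
    show "((\<lambda>x. omega_term vs n x w) has_derivative (\<lambda>v. omega_term (v # vs) n x w)) (at x within ball 0 R)"
      for n x
      unfolding omega_term_def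
      by (rule has_derivative_at_withinI[OF has_derivative_scaleR_right[OF ad_deriv_has_derivative]])
    show "(\<lambda>n. omega_term vs n u w) sums omega_deriv vs u w"
      unfolding omega_deriv_def by (rule summable_sums[OF summable_omega_term])
    show "\<forall>\<^sub>F n in sequentially. \<forall>x\<in>ball 0 R. \<forall>h.
      norm ((\<Sum>i<n. omega_term (h # vs) i x w) - omega_deriv (h # vs) x w) \<le> e * norm h" if "e > 0" for e
    proof -
      obtain N where N: "\<And>n. n \<ge> N \<Longrightarrow> norm (\<Sum>i. t (i + n)) < e"
        using suminf_exist_split[OF \<open>e > 0\<close> st] by blast
      have "norm ((\<Sum>i<n. omega_term (h # vs) i x w) - omega_deriv (h # vs) x w) \<le> e * norm h"
        if "n \<ge> N" "x \<in> ball 0 R" for n x h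
      proof -
        have "(\<Sum>i<n. omega_term (h # vs) i x w) - omega_deriv (h # vs) x w
            = - (\<Sum>i. omega_term (h # vs) (i + n) x w)"
          using suminf_split_initial_segment[OF summable_omega_term, of "h # vs" x w n]
          by (simp add: omega_deriv_def)
        also have "norm \<dots> \<le> (\<Sum>i. norm h * t (i + n))"
          unfolding norm_minus_cancel
          by (intro norm_suminf_le t summable_mult that(2)) (simp add: summable_iff_shift st)
        also have "\<dots> = norm h * (\<Sum>i. t (i + n))"
          by (rule suminf_mult) (simp add: summable_iff_shift st)
        also have "\<dots> \<le> norm h * e"
          using N[OF that(1)] by (intro mult_left_mono) auto
        finally show ?thesis by (simp add: mult.commute)
      qed
      then show ?thesis
        unfolding eventually_sequentially by blast
    qed
  qed (auto simp: R_def)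
  then obtain g where g: "\<And>x. x \<in> ball 0 R \<Longrightarrow> (\<lambda>n. omega_term vs n x w) sums (g x)"
    "\<And>x. x \<in> ball 0 R \<Longrightarrow> (g has_derivative (\<lambda>v. omega_deriv (v # vs) x w)) (at x within ball 0 R)"
    by blast
  have u: "u \<in> ball 0 R" by (simp add: R_def)
  have "g x = omega_deriv vs x w" if "x \<in> ball 0 R" for x
    using g(1)[OF that] unfolding omega_deriv_def by (rule sums_unique)
  moreover have "(g has_derivative (\<lambda>v. omega_deriv (v # vs) u w)) (at u)"
    using g(2)[OF u] at_within_open[OF u] by simp
  ultimately show ?thesis
    using has_derivative_cong_open[OF open_ball u, of g "\<lambda>x. omega_deriv vs x w"] by blast
qed

lemma fd_omega_deriv: "fd (\<lambda>u. omega_deriv vs u w) u v = omega_deriv (v # vs) u w"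
  by (simp add: fd_eqI[OF omega_deriv_has_derivative])

lemma omega_deriv_differentiable: "(\<lambda>u. omega_deriv vs u w) differentiable (at u)"
  unfolding differentiable_def using omega_deriv_has_derivative by blast

lemma smooth_omega_deriv: "smooth_on UNIV (\<lambda>u. omega_deriv vs u w)"
proof -
  have "Ck_on k UNIV (\<lambda>u. omega_deriv vs u w)" for k
  proof (induction k arbitrary: vs)
    case 0
    then show ?case
      using has_derivative_continuous[OF omega_deriv_has_derivative]
      by (auto intro: continuous_at_imp_continuous_on)
  next
    case (Suc k)
    then show ?case
      by (simp add: fd_omega_deriv omega_deriv_differentiable)
  qed
  then show ?thesis by (simp add: smooth_on_def)
qed

lemma linear_omega_deriv: "linear (omega_deriv vs u)"
proof (rule linearI)
  show "omega_deriv vs u (x + y) = omega_deriv vs u x + omega_deriv vs u y" for x y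
    unfolding omega_deriv_def suminf_add[OF summable_omega_term summable_omega_term]
    by (simp add: omega_term_def linear_add[OF linear_ad_deriv] scaleR_add_right)
  show "omega_deriv vs u (c *\<^sub>R x) = c *\<^sub>R omega_deriv vs u x" for c x
    unfolding omega_deriv_def suminf_scaleR_right[OF summable_omega_term]
    by (simp add: omega_term_def linear_scale[OF linear_ad_deriv] mult.commute)
qed

lemma linear_omega_deriv_Cons: "linear (\<lambda>v. omega_deriv (v # vs) u w)"
  using omega_deriv_has_derivative by (rule has_derivative_linear)

lemma omega_of_commuting: "br u w = 0 \<Longrightarrow> omega u w = w"
proof -
  assume a: "br u w = 0"
  have "ad_deriv [] (Suc k) u w = 0" for k
    by (induction k) (simp_all add: a b.zero_right)
  then have "omega_term [] k u w = 0" if "k \<notin> {0}" for k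
    using that by (cases k) (auto simp: omega_term_def simp del: ad_deriv.simps)
  then have "omega u w = (\<Sum>k\<in>{0}. omega_term [] k u w)"
    unfolding omega_deriv_def by (intro suminf_finite) auto
  then show ?thesis by (simp add: omega_term_def)
qed

text \<open>The term of degree \<open>k\<close> is homogeneous, so the left-hand side multiplies it by \<open>k + 1\<close>. That turns
  the series of \<open>\<psi>(ad u)\<close> into the series of \<open>exp(ad u) = 1 + ad u \<psi>(ad u)\<close>.\<close>

lemma omega_euler: "omega u w + omega_deriv [u] u w = w + br u (omega u w)"
proof -
  have d: "ad_deriv [u] k u w = k *\<^sub>R ad_deriv [] k u w" for k
    by (induction k) (simp_all add: b.scaleR_right scaleR_add_left)
  have "omega_term [] k u w + omega_term [u] k u w = ad_deriv [] k u w /\<^sub>R fact k" for k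
  proof -
    have "inverse (fact k) = (1 + real k) * inverse (fact (Suc k) :: real)"
      by (simp add: inverse_mult_distrib)
    then show ?thesis
      unfolding omega_term_def d
      by (simp add: scaleR_left_distrib distrib_right mult.commute[of "real k"] del: ad_deriv.simps fact_Suc)
  qed
  then have 1: "omega u w + omega_deriv [u] u w = (\<Sum>k. ad_deriv [] k u w /\<^sub>R fact k)"
    and s: "summable (\<lambda>k. ad_deriv [] k u w /\<^sub>R fact k)"
    using summable_add[OF summable_omega_term summable_omega_term, of "[]" u w "[u]" u w]
    unfolding omega_deriv_def suminf_add[OF summable_omega_term summable_omega_term] by simp_all
  have "ad_deriv [] (Suc k) u w /\<^sub>R fact (Suc k) = br u (omega_term [] k u w)" for k
    by (simp add: omega_term_def b.scaleR_right del: fact_Suc)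
  then have "(\<Sum>k. ad_deriv [] (Suc k) u w /\<^sub>R fact (Suc k)) = br u (omega u w)"
    by (simp only: omega_deriv_def bounded_linear.suminf[OF b.bounded_linear_right summable_omega_term])
  then show ?thesis
    using suminf_split_head[OF s] 1 by simp
qed

lemma omega_deriv_swap: "omega_deriv [v, w] u x = omega_deriv [w, v] u x"
  using fd_commute[OF open_UNIV UNIV_I smooth_omega_deriv[of "[]" x], where x = u and v = w and w = v]
  by (simp only: fd_omega_deriv)

text \<open>The derivative of \<open>omega_euler\<close> in the direction \<open>v\<close>.\<close>

lemma omega_euler_deriv:
  "omega_deriv [v] u w + (omega_deriv [u, v] u w + omega_deriv [v] u w)
    = br v (omega u w) + br u (omega_deriv [v] u w)"
proof -
  have l: "((\<lambda>u. omega u w + omega_deriv [u] u w) has_derivative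
      (\<lambda>k. omega_deriv [k] u w + (fd (\<lambda>y. omega_deriv [u] y w) u k + omega_deriv [k] u w))) (at u)"
    by (intro has_derivative_add omega_deriv_has_derivative
        has_derivative_linear_family[OF open_UNIV UNIV_I, where L = "\<lambda>y b. omega_deriv [b] y w"]
        has_derivative_ident linear_omega_deriv_Cons)
      (simp_all add: omega_deriv_differentiable)
  have r: "((\<lambda>u. w + br u (omega u w)) has_derivative
      (\<lambda>k. 0 + (br u (omega_deriv [k] u w) + br k (omega u w)))) (at u)"
    by (intro has_derivative_add has_derivative_const b.FDERIV has_derivative_ident
        omega_deriv_has_derivative)
  have "fd (\<lambda>u. omega u w + omega_deriv [u] u w) u v = fd (\<lambda>u. w + br u (omega u w)) u v"
    by (simp only: omega_euler)
  then show ?thesis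
    unfolding fd_eqI[OF l] fd_eqI[OF r] fd_omega_deriv omega_deriv_swap[of v u]
    by (simp only: add_0_left add.commute)
qed

text \<open>A Gronwall argument: \<open>exp(-2ct) |G|\<^sup>2\<close> is nonincreasing if \<open>c\<close> bounds the norm of \<open>ad u\<close>.\<close>

lemma linear_ode_zero:
  fixes G :: "real \<Rightarrow> 'a"
  assumes G: "\<And>t. (G has_vector_derivative br u (G t)) (at t)" and "G 0 = 0"
  shows "G 1 = 0"
proof -
  define c where "c = K * norm u"
  define h where "h = (\<lambda>t. exp (- 2 * c * t) * (G t \<bullet> G t))"
  have d: "(h has_real_derivative exp (- 2 * c * t) * (2 * (G t \<bullet> br u (G t)) - 2 * c * (G t \<bullet> G t))) (at t)" for t
  proof -
    have "((\<lambda>t. G t \<bullet> G t) has_vector_derivative (G t \<bullet> br u (G t) + br u (G t) \<bullet> G t)) (at t)"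
      by (rule bounded_bilinear.has_vector_derivative[OF bounded_bilinear_inner G G])
    then have "((\<lambda>t. G t \<bullet> G t) has_real_derivative (2 * (G t \<bullet> br u (G t)))) (at t)"
      by (simp add: has_real_derivative_iff_has_vector_derivative inner_commute)
    then show ?thesis
      unfolding h_def by (auto intro!: derivative_eq_intros simp: algebra_simps)
  qed
  have le: "\<exists>y. (h has_real_derivative y) (at t) \<and> y \<le> 0" for t
  proof -
    have "G t \<bullet> br u (G t) \<le> norm (G t) * norm (br u (G t))"
      by (rule norm_cauchy_schwarz)
    also have "\<dots> \<le> norm (G t) * (c * norm (G t))"
      unfolding c_def by (intro mult_left_mono norm_br) simp
    also have "\<dots> = c * (G t \<bullet> G t)"
      by (simp add: dot_square_norm power2_eq_square)
    finally have "exp (- 2 * c * t) * (2 * (G t \<bullet> br u (G t)) - 2 * c * (G t \<bullet> G t)) \<le> 0"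
      by (intro mult_nonneg_nonpos) auto
    then show ?thesis
      using d by blast
  qed
  have "h 1 \<le> h 0"
    using DERIV_nonpos_imp_nonincreasing[of 0 1 h] le by auto
  then have "exp (- 2 * c) * (G 1 \<bullet> G 1) \<le> 0"
    using assms(2) by (simp add: h_def)
  then have "\<not> 0 < G 1 \<bullet> G 1"
    by (meson exp_gt_zero mult_pos_pos not_le)
  then show ?thesis unfolding inner_gt_zero_iff by blast
qed

text \<open>The Maurer-Cartan equation of \<open>omega\<close>. By the two Euler identities and the Jacobi identity, the
  radial derivative of the defect \<open>C\<close> is \<open>[x, C x] - 2 C x\<close>. Therefore \<open>t\<^sup>2 C(tu)\<close> solves
  \<open>G' = [u, G]\<close> with \<open>G(0) = 0\<close>.\<close>

theorem omega_flat:
  "omega_deriv [v] u w - omega_deriv [w] u v = br (omega u v) (omega u w)"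
proof -
  define C where "C = (\<lambda>u. omega_deriv [v] u w - omega_deriv [w] u v - br (omega u v) (omega u w))"
  define C' where "C' = (\<lambda>u k. omega_deriv [k, v] u w - omega_deriv [k, w] u v
    - (br (omega u v) (omega_deriv [k] u w) + br (omega_deriv [k] u v) (omega u w)))"
  have dC: "(C has_derivative C' x) (at x)" for x
    unfolding C_def C'_def by (intro has_derivative_diff omega_deriv_has_derivative b.FDERIV)
  have radial: "C' x x = br x (C x) - 2 *\<^sub>R C x" for x
  proof -
    have e: "omega_deriv [x] x z = z + br x (omega x z) - omega x z" for z
      using omega_euler[of x z] by (simp add: algebra_simps)
    have e2: "omega_deriv [x, y] x z = br y (omega x z) + br x (omega_deriv [y] x z) - 2 *\<^sub>R omega_deriv [y] x z"
      for y z
      using omega_euler_deriv[of y x z] by (simp add: algebra_simps scaleR_2)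
    show ?thesis
      unfolding C'_def C_def e e2
      by (simp add: b.add_left b.add_right b.diff_left b.diff_right derivation[of x "omega x v"]
          antisym[of w "omega x v"] scaleR_2 algebra_simps)
  qed
  define G where "G = (\<lambda>t. (t * t) *\<^sub>R C (t *\<^sub>R u))"
  have "G 1 = 0"
  proof (rule linear_ode_zero)
    fix t
    have "((\<lambda>t. C (t *\<^sub>R u)) has_derivative (\<lambda>k. C' (t *\<^sub>R u) (k *\<^sub>R u))) (at t)"
      by (rule has_derivative_compose[of "\<lambda>t. t *\<^sub>R u" _ t UNIV C, OF _ dC]) (auto intro!: derivative_eq_intros)
    then have cv: "((\<lambda>t. C (t *\<^sub>R u)) has_vector_derivative C' (t *\<^sub>R u) u) (at t)"
      by (simp add: has_vector_derivative_def linear_scale[OF has_derivative_linear[OF dC]])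
    have "(G has_vector_derivative ((t * t) *\<^sub>R C' (t *\<^sub>R u) u + (2 * t) *\<^sub>R C (t *\<^sub>R u))) (at t)"
      unfolding G_def
      by (rule has_vector_derivative_scaleR[OF _ cv]) (auto intro!: derivative_eq_intros)
    moreover have "(t * t) *\<^sub>R C' (t *\<^sub>R u) u = t *\<^sub>R C' (t *\<^sub>R u) (t *\<^sub>R u)"
      by (simp add: linear_scale[OF has_derivative_linear[OF dC]])
    moreover have "t *\<^sub>R C' (t *\<^sub>R u) (t *\<^sub>R u) + (2 * t) *\<^sub>R C (t *\<^sub>R u) = br u (G t)"
      unfolding radial G_def by (simp add: scaleR_diff_right b.scaleR_left b.scaleR_right)
    ultimately show "(G has_vector_derivative br u (G t)) (at t)"
      by simp
  qed (simp add: G_def)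
  then show ?thesis by (simp add: G_def C_def)
qed

lemma omega_commute:
  assumes J: "linear J" "\<And>x y. br x (J y) = J (br x y)"
  shows "omega u (J w) = J (omega u w)"
proof -
  have "ad_deriv [] k u (J w) = J (ad_deriv [] k u w)" for k
    by (induction k) (simp_all add: J)
  then show ?thesis
    using bounded_linear.suminf[OF linear_imp_bounded_linear[OF J(1)] summable_omega_term, of "[]" u w]
    by (simp add: omega_deriv_def omega_term_def linear_scale[OF J(1)])
qed

lemma omega_deriv_commute:
  assumes J: "linear J" "\<And>x y. br x (J y) = J (br x y)"
  shows "omega_deriv [J v] u w = J (omega_deriv [v] u w)"
proof -
  have J': "br (J x) y = J (br x y)" for x y
    using J(2)[of y x] antisym[of "J x" y] antisym[of x y] by (simp add: linear_neg[OF J(1)])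
  have "ad_deriv [J v] k u w = J (ad_deriv [v] k u w)" for k
    by (induction k) (simp_all add: J J' linear_add[OF J(1)] linear_0[OF J(1)])
  then show ?thesis
    using bounded_linear.suminf[OF linear_imp_bounded_linear[OF J(1)] summable_omega_term, of "[v]" u w]
    by (simp add: omega_deriv_def omega_term_def linear_scale[OF J(1)])
qed

end

section \<open>Complexification\<close>

lemma bilinear_imp_bounded_bilinear:
  fixes f :: "'a::findim_inner \<Rightarrow> 'b::findim_inner \<Rightarrow> 'c::real_normed_vector"
  assumes l: "\<And>x. linear (f x)" and r: "\<And>y. linear (\<lambda>x. f x y)"
  shows "bounded_bilinear f"
proof
  show "f (a + a') b = f a b + f a' b" for a a' b by (rule linear_add[OF r])
  show "f a (b + b') = f a b + f a b'" for a b b' by (rule linear_add[OF l])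
  show "f (c *\<^sub>R a) b = c *\<^sub>R f a b" for a b c by (rule linear_scale[OF r])
  show "f a (c *\<^sub>R b) = c *\<^sub>R f a b" for a b c by (rule linear_scale[OF l])
  show "\<exists>K. \<forall>a b. norm (f a b) \<le> norm a * norm b * K"
  proof (intro exI allI)
    fix x y
    have "f x y = (\<Sum>b\<in>onb. \<Sum>c\<in>onb. (x \<bullet> b) *\<^sub>R (y \<bullet> c) *\<^sub>R f b c)"
      by (subst linear_onb[OF r], intro sum.cong refl, subst linear_onb[OF l, of _ y])
        (simp only: scaleR_sum_right)
    also have "norm \<dots> \<le> (\<Sum>b\<in>onb. \<Sum>c\<in>onb. norm x * norm y * norm (f b c))"
    proof (intro order.trans[OF norm_sum] sum_mono)
      fix b :: 'a and c :: 'b assume "b \<in> onb" "c \<in> onb"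
      then have "\<bar>x \<bullet> b\<bar> \<le> norm x" "\<bar>y \<bullet> c\<bar> \<le> norm y"
        using Cauchy_Schwarz_ineq2[of x b] Cauchy_Schwarz_ineq2[of y c] norm_onb[of b] norm_onb[of c] by auto
      then show "norm ((x \<bullet> b) *\<^sub>R (y \<bullet> c) *\<^sub>R f b c) \<le> norm x * norm y * norm (f b c)"
        unfolding norm_scaleR mult.assoc[symmetric] by (intro mult_right_mono mult_mono) auto
    qed
    also have "\<dots> = norm x * norm y * (\<Sum>b\<in>onb. \<Sum>c\<in>onb. norm (f b c))"
      by (simp add: sum_distrib_left)
    finally show "norm (f x y) \<le> norm x * norm y * (\<Sum>b\<in>onb. \<Sum>c\<in>onb. norm (f b c))" .
  qed
qed

lemma linear_cscale: "linear (cscale z :: 'a::real_vector \<times> 'a \<Rightarrow> _)"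
  by (rule linearI) (auto simp: cscale_def algebra_simps)

lemma cscale_ii [simp]: "cscale \<i> (x, y) = (- y, x)"
  by (simp add: cscale_def)

lemma cscale_expand: "cscale z x = Re z *\<^sub>R x + Im z *\<^sub>R cscale \<i> x"
  by (cases x) (simp add: cscale_def)

definition complexify_bracket :: "('a::findim_inner \<Rightarrow> 'a \<Rightarrow> 'a) \<Rightarrow> 'a \<times> 'a \<Rightarrow> 'a \<times> 'a \<Rightarrow> 'a \<times> 'a" where
  "complexify_bracket br x y = (br (fst x) (fst y) - br (snd x) (snd y), br (fst x) (snd y) + br (snd x) (fst y))"

context lie_algebra
begin

abbreviation cbr :: "'a \<times> 'a \<Rightarrow> 'a \<times> 'a \<Rightarrow> 'a \<times> 'a" where
  "cbr \<equiv> complexify_bracket br"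

lemma lie_algebra_complexify: "lie_algebra cbr"
proof (rule lie_algebra.intro)
  show "bounded_bilinear cbr"
    by (rule bilinear_imp_bounded_bilinear; rule linearI)
      (simp_all add: complexify_bracket_def b.add_left b.add_right b.scaleR_left b.scaleR_right algebra_simps)
  show "cbr x y = - cbr y x" for x y
    using antisym[of "fst x" "fst y"] antisym[of "snd x" "snd y"] antisym[of "fst x" "snd y"]
      antisym[of "snd x" "fst y"]
    by (simp add: complexify_bracket_def)
  have j: "br x (br y z) = - br y (br z x) - br z (br x y)" for x y z
    using jacobi[of x y z] by (simp add: eq_neg_iff_add_eq_0 algebra_simps)
  show "cbr x (cbr y z) + cbr y (cbr z x) + cbr z (cbr x y) = 0" for x y z
  proof -
    obtain a b where x: "x = (a, b)" by (cases x)
    show ?thesis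
      unfolding x
      by (cases y; cases z)
        (simp add: complexify_bracket_def b.add_right b.diff_right zero_prod_def j[of a] j[of b])
  qed
qed

interpretation c: lie_algebra cbr
  by (rule lie_algebra_complexify)

lemma cbr_ii: "cbr x (cscale \<i> y) = cscale \<i> (cbr x y)"
  by (cases x; cases y) (simp add: complexify_bracket_def b.minus_right)

text \<open>In complex notation this is \<open>\<i>\<psi>(-\<i> ad x) f\<close>: the pair \<open>(0, - x)\<close> stands for \<open>-\<i>x\<close>.\<close>

definition slope :: "'a \<Rightarrow> 'a \<times> 'a \<Rightarrow> 'a \<times> 'a" where
  "slope x f = c.omega (0, - x) (cscale \<i> f)"

lemma linear_slope: "linear (slope x)"
  using linear_compose[OF linear_cscale c.linear_omega_deriv] by (simp add: slope_def[abs_def] o_def)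

lemma slope_ii: "slope x (cscale \<i> f) = cscale \<i> (slope x f)"
  unfolding slope_def by (rule c.omega_commute[OF linear_cscale cbr_ii])

lemma slope_has_derivative:
  "((\<lambda>x. slope x f) has_derivative (\<lambda>v. c.omega_deriv [(0, - v)] (0, - x) (cscale \<i> f))) (at x)"
  unfolding slope_def
  by (rule has_derivative_compose[of "\<lambda>x. (0, - x)" _ x UNIV, OF _ c.omega_deriv_has_derivative])
    (auto intro!: derivative_eq_intros)

lemma smooth_slope: "smooth_on UNIV (\<lambda>x. slope x f)"
  unfolding slope_def
  by (rule smooth_on_compose[OF open_UNIV open_UNIV _ c.smooth_omega_deriv])
    (auto intro!: smooth_on_bounded_linear bounded_linear_Pair bounded_linear_zero bounded_linear_minus bounded_linear_ident)

lemma slope_of_commuting: "br x (fst f) = 0 \<Longrightarrow> br x (snd f) = 0 \<Longrightarrow> slope x f = cscale \<i> f"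
  unfolding slope_def
  by (rule c.omega_of_commuting) (cases f, simp add: complexify_bracket_def b.minus_left b.minus_right b.zero_left zero_prod_def)

text \<open>The Maurer-Cartan equation pulled back along \<open>x \<mapsto> -\<i>x\<close>. The derivative in a complex direction \<open>f\<close> is
  the derivative along \<open>fst f\<close> plus \<open>\<i>\<close> times the one along \<open>snd f\<close>; complex linearity of
  \<open>omega_deriv\<close> in its direction merges the two.\<close>

lemma slope_flat:
  "(fd (\<lambda>x. slope x k) x (fst f) + cscale \<i> (fd (\<lambda>x. slope x k) x (snd f)))
    - (fd (\<lambda>x. slope x f) x (fst k) + cscale \<i> (fd (\<lambda>x. slope x f) x (snd k)))
    + cbr (slope x f) (slope x k) = 0"
proof -
  have key: "fd (\<lambda>x. slope x k) x (fst f) + cscale \<i> (fd (\<lambda>x. slope x k) x (snd f))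
      = - c.omega_deriv [cscale \<i> f] (0, - x) (cscale \<i> k)" for f k
  proof -
    have "(0, - fst f) + cscale \<i> (0, - snd f) = - cscale \<i> f"
      by (cases f) simp
    then show ?thesis
      unfolding fd_eqI[OF slope_has_derivative] c.omega_deriv_commute[OF linear_cscale cbr_ii, symmetric]
      by (simp only: linear_add[OF c.linear_omega_deriv_Cons, symmetric] linear_neg[OF c.linear_omega_deriv_Cons, symmetric])
  qed
  show ?thesis
    unfolding key unfolding slope_def c.omega_flat[symmetric] by simp
qed

end

section \<open>Charts and smooth maps\<close>

abbreviation cimg :: "('a, 'e) chart \<Rightarrow> 'e set" where
  "cimg c \<equiv> cmap c ` cdom c"

lemma cinv_cmap: "inj_on (cmap c) (cdom c) \<Longrightarrow> p \<in> cdom c \<Longrightarrow> cinv c (cmap c p) = p"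
  by (simp add: cinv_def)

lemma cmap_cinv: "x \<in> cimg c \<Longrightarrow> cmap c (cinv c x) = x"
  by (simp add: cinv_def f_inv_into_f)

lemma cinv_in_cdom: "x \<in> cimg c \<Longrightarrow> cinv c x \<in> cdom c"
  by (simp add: cinv_def inv_into_into)

lemma cmap_image_eq:
  assumes "inj_on (cmap c) (cdom c)" "W \<subseteq> cdom c"
  shows "cmap c ` W = {x \<in> cimg c. cinv c x \<in> W}"
proof -
  have "cinv c (cmap c p) = p" if "p \<in> cdom c" for p
    using cinv_cmap[OF assms(1) that] .
  then show ?thesis
    using assms(2) by (auto simp: image_iff)
qed

lemma openin_subset_chart:
  assumes "\<And>c. c \<in> A \<Longrightarrow> inj_on (cmap c) (cdom c)" "openin (atlas_topology A) W" "c \<in> A"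
  shows "open (cmap c ` (W \<inter> cdom c))"
  using assms openin_atlas_topology by blast

lemma topspace_atlas_topology:
  assumes "\<And>c. c \<in> A \<Longrightarrow> inj_on (cmap c) (cdom c)"
    and "\<And>c. c \<in> A \<Longrightarrow> open (cimg c)"
  shows "topspace (atlas_topology A) = points A"
proof -
  have "points A \<inter> cdom c = cdom c" if "c \<in> A" for c
    using that by (auto simp: points_def)
  then have "openin (atlas_topology A) (points A)"
    using assms(2) by (subst openin_atlas_topology[OF assms(1)]) auto
  moreover have "openin (atlas_topology A) W \<Longrightarrow> W \<subseteq> points A" for W
    by (subst (asm) openin_atlas_topology[OF assms(1)]) auto
  ultimately show ?thesis
    by (meson openin_subset openin_topspace subset_antisym)
qed

text \<open>The conditions on charts alone, stated separately so that they pass from an atlas to its tangent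
  atlas.\<close>

definition smooth_atlas :: "('a, 'e::findim_inner) atlas \<Rightarrow> bool" where
  "smooth_atlas A \<longleftrightarrow>
     (\<forall>c\<in>A. inj_on (cmap c) (cdom c) \<and> open (cimg c)) \<and>
     (\<forall>c\<in>A. \<forall>d\<in>A. open (cmap c ` (cdom c \<inter> cdom d)) \<and>
        smooth_on (cmap c ` (cdom c \<inter> cdom d)) (\<lambda>x. cmap d (cinv c x)))"

lemma smooth_map_local:
  assumes A: "\<And>c. c \<in> A \<Longrightarrow> inj_on (cmap c) (cdom c)" "\<And>c. c \<in> A \<Longrightarrow> open (cimg c)"
    and B: "smooth_atlas B" and f: "smooth_map A B f" and "c \<in> A" "d \<in> B"
  shows "open {x \<in> cimg c. f (cinv c x) \<in> cdom d}"
    and "smooth_on {x \<in> cimg c. f (cinv c x) \<in> cdom d} (\<lambda>x. cmap d (f (cinv c x)))"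
proof -
  have Bi: "\<And>c. c \<in> B \<Longrightarrow> inj_on (cmap c) (cdom c)"
    and Bo: "\<And>c d. c \<in> B \<Longrightarrow> d \<in> B \<Longrightarrow> open (cmap c ` (cdom d \<inter> cdom c))"
    using B by (auto simp: smooth_atlas_def Int_commute)
  have eq: "cmap c ` (cdom c \<inter> f -` cdom d) = {x \<in> cimg c. f (cinv c x) \<in> cdom d}"
    using cmap_image_eq[OF A(1)[OF \<open>c \<in> A\<close>], of "cdom c \<inter> f -` cdom d"] cinv_in_cdom[of _ c] by auto
  have "openin (atlas_topology B) (cdom d)"
    using Bo \<open>d \<in> B\<close> by (subst openin_atlas_topology[OF Bi]) (auto simp: points_def)
  moreover have "continuous_map (atlas_topology A) (atlas_topology B) f"
    using f by (simp add: smooth_map_def)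
  ultimately have "openin (atlas_topology A) {x \<in> topspace (atlas_topology A). f x \<in> cdom d}"
    by (rule openin_continuous_map_preimage[rotated])
  then have "open (cmap c ` ({x \<in> topspace (atlas_topology A). f x \<in> cdom d} \<inter> cdom c))"
    using openin_atlas_topology[of A] A(1) \<open>c \<in> A\<close> by blast
  moreover have "{x \<in> topspace (atlas_topology A). f x \<in> cdom d} \<inter> cdom c = cdom c \<inter> f -` cdom d"
    using \<open>c \<in> A\<close> by (auto simp: topspace_atlas_topology[OF A] points_def)
  ultimately show "open {x \<in> cimg c. f (cinv c x) \<in> cdom d}"
    by (simp add: eq)
  show "smooth_on {x \<in> cimg c. f (cinv c x) \<in> cdom d} (\<lambda>x. cmap d (f (cinv c x)))"
    using f \<open>c \<in> A\<close> \<open>d \<in> B\<close> unfolding smooth_map_def eq[symmetric] by (auto simp: o_def)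
qed

locale manifold_charts =
  fixes A :: "('g, 'e::findim_inner) atlas"
  assumes manifold: "smooth_atlas A"
begin

lemma chart_inj: "c \<in> A \<Longrightarrow> inj_on (cmap c) (cdom c)"
  and open_cimg: "c \<in> A \<Longrightarrow> open (cimg c)"
  using manifold by (auto simp: smooth_atlas_def)

lemma cinv_cmap': "c \<in> A \<Longrightarrow> p \<in> cdom c \<Longrightarrow> cinv c (cmap c p) = p"
  by (rule cinv_cmap[OF chart_inj])

lemma transition:
  assumes "c \<in> A" "d \<in> A"
  shows "open (cmap c ` (cdom c \<inter> cdom d))"
    and "smooth_on (cmap c ` (cdom c \<inter> cdom d)) (\<lambda>x. cmap d (cinv c x))"
  using manifold assms by (auto simp: smooth_atlas_def)

lemma transition_differentiable:
  "c \<in> A \<Longrightarrow> d \<in> A \<Longrightarrow> p \<in> cdom c \<Longrightarrow> p \<in> cdom d \<Longrightarrow>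
    (\<lambda>x. cmap d (cinv c x)) differentiable (at (cmap c p))"
  by (rule smooth_on_differentiable[OF transition(2)]) auto

lemma points_chart: "p \<in> points A \<Longrightarrow> \<exists>c\<in>A. p \<in> cdom c"
  by (auto simp: points_def)

lemma chart_at: "p \<in> points A \<Longrightarrow> chart_at A p \<in> A \<and> p \<in> cdom (chart_at A p)"
  unfolding chart_at_def by (rule someI_ex) (auto simp: points_def)

lemma tangent_space_transition:
  "v \<in> tangent_space A p \<Longrightarrow> c \<in> A \<Longrightarrow> d \<in> A \<Longrightarrow> p \<in> cdom c \<Longrightarrow> p \<in> cdom d \<Longrightarrow>
    v d = fd (\<lambda>x. cmap d (cinv c x)) (cmap c p) (v c)"
  unfolding tangent_space_def o_def by blast

lemma tangent_space_zero:
  "v \<in> tangent_space A p \<Longrightarrow> \<not> (c \<in> A \<and> p \<in> cdom c) \<Longrightarrow> v c = 0"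
  unfolding tangent_space_def by blast

lemma tangent_space_eqI:
  assumes "v \<in> tangent_space A p" "w \<in> tangent_space A p" "c \<in> A" "p \<in> cdom c" "v c = w c"
  shows "v = w"
proof
  fix d
  show "v d = w d"
  proof (cases "d \<in> A \<and> p \<in> cdom d")
    case True
    then show ?thesis
      using assms tangent_space_transition[of v p c d] tangent_space_transition[of w p c d] by simp
  next
    case False
    then show ?thesis
      by (simp add: tangent_space_zero[OF assms(1) False] tangent_space_zero[OF assms(2) False])
  qed
qed

text \<open>The chain rule for coordinate changes. All tangent vectors below arise as derivatives of
  parametrized families, so this is how they are seen to be tangent vectors.\<close>

lemma map_deriv_tangent:
  assumes "\<And>c. c \<in> A \<Longrightarrow> F z \<in> cdom c \<Longrightarrow>
    \<exists>N. open N \<and> z \<in> N \<and> (\<forall>y\<in>N. F y \<in> cdom c) \<and> (\<lambda>y. cmap c (F y)) differentiable (at z)"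
  shows "map_deriv A F z h \<in> tangent_space A (F z)"
proof -
  have key: "fd (\<lambda>y. cmap d (F y)) z h = fd (\<lambda>x. cmap d (cinv c x)) (cmap c (F z)) (fd (\<lambda>y. cmap c (F y)) z h)"
    if c: "c \<in> A" "F z \<in> cdom c" and d: "d \<in> A" "F z \<in> cdom d" for c d
  proof -
    obtain N where N: "open N" "z \<in> N" "\<And>y. y \<in> N \<Longrightarrow> F y \<in> cdom c"
      and diff: "(\<lambda>y. cmap c (F y)) differentiable (at z)"
      using assms[OF c] by blast
    have "fd (\<lambda>y. cmap d (F y)) z = fd (\<lambda>y. cmap d (cinv c (cmap c (F y)))) z"
      by (rule fd_cong_open[OF N(1,2)]) (simp add: cinv_cmap'[OF c(1) N(3)])
    also have "\<dots> = (\<lambda>h. fd (\<lambda>x. cmap d (cinv c x)) (cmap c (F z)) (fd (\<lambda>y. cmap c (F y)) z h))"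
      by (rule fd_compose[OF diff]) (rule transition_differentiable; fact)
    finally show ?thesis by simp
  qed
  show ?thesis
    unfolding tangent_space_def
  proof (intro CollectI conjI ballI allI impI)
    fix c d assume "c \<in> A" "d \<in> A" "F z \<in> cdom c \<inter> cdom d"
    then show "map_deriv A F z h d = fd (cmap d \<circ> cinv c) (cmap c (F z)) (map_deriv A F z h c)"
      using key[of c d] by (simp add: map_deriv_def o_def)
  qed (auto simp: map_deriv_def)
qed

lemma tangent_space_ex:
  assumes "c \<in> A" "p \<in> cdom c"
  shows "\<exists>v\<in>tangent_space A p. v c = y"
proof (rule bexI[of _ "map_deriv A (cinv c) (cmap c p) y"])
  have img: "cmap c p \<in> cimg c" using assms by simp
  show "map_deriv A (cinv c) (cmap c p) y c = y"
  proof -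
    have "fd (\<lambda>x. cmap c (cinv c x)) (cmap c p) = fd (\<lambda>x. x) (cmap c p)"
      by (rule fd_cong_open[OF open_cimg[OF assms(1)] img]) (rule cmap_cinv)
    then show ?thesis
      using assms by (simp add: map_deriv_def cinv_cmap' o_def)
  qed
  have "map_deriv A (cinv c) (cmap c p) y \<in> tangent_space A (cinv c (cmap c p))"
  proof (rule map_deriv_tangent)
    fix d assume d: "d \<in> A" "cinv c (cmap c p) \<in> cdom d"
    let ?N = "cmap c ` (cdom c \<inter> cdom d)"
    have p: "p \<in> cdom d" using d assms by (simp add: cinv_cmap')
    have "\<forall>y\<in>?N. cinv c y \<in> cdom d"
      using assms(1) by (auto simp: cinv_cmap')
    then show "\<exists>N. open N \<and> cmap c p \<in> N \<and> (\<forall>y\<in>N. cinv c y \<in> cdom d)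
        \<and> (\<lambda>y. cmap d (cinv c y)) differentiable (at (cmap c p))"
      using transition[OF assms(1) d(1)] transition_differentiable[OF assms(1) d(1) assms(2) p] p assms(2)
      by (intro exI[of _ ?N]) auto
  qed
  then show "map_deriv A (cinv c) (cmap c p) y \<in> tangent_space A p"
    by (simp add: cinv_cmap' assms)
qed

text \<open>Coordinate changes relate the coordinate expressions of a vector field, so
  \<open>related_fields_bracket\<close> applies.\<close>

lemma lie_bracket_tangent:
  assumes U: "openin (atlas_topology A) U" "p \<in> U"
    and X: "\<And>q. q \<in> U \<Longrightarrow> X q \<in> tangent_space A q" and Y: "\<And>q. q \<in> U \<Longrightarrow> Y q \<in> tangent_space A q"
    and dX: "\<And>c. c \<in> A \<Longrightarrow> p \<in> cdom c \<Longrightarrow> (\<lambda>x. X (cinv c x) c) differentiable (at (cmap c p))"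
    and dY: "\<And>c. c \<in> A \<Longrightarrow> p \<in> cdom c \<Longrightarrow> (\<lambda>x. Y (cinv c x) c) differentiable (at (cmap c p))"
  shows "lie_bracket A X Y p \<in> tangent_space A p"
  unfolding tangent_space_def
proof (intro CollectI conjI ballI allI impI)
  fix c d assume c: "c \<in> A" and d: "d \<in> A" and "p \<in> cdom c \<inter> cdom d"
  then have p: "p \<in> cdom c" "p \<in> cdom d" by auto
  let ?F = "\<lambda>x. cmap d (cinv c x)"
  define S where "S = cmap c ` (U \<inter> cdom c) \<inter> cmap c ` (cdom c \<inter> cdom d)"
  have opS: "open S"
    unfolding S_def using openin_subset_chart[OF chart_inj U(1) c] transition(1)[OF c d] by blast
  have inS: "cmap c p \<in> S" using U(2) p by (auto simp: S_def)
  have S: "cinv c z \<in> U" "cinv c z \<in> cdom c" "cinv c z \<in> cdom d" "cmap c (cinv c z) = z" if "z \<in> S" for z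
  proof -
    obtain u w where uw: "u \<in> U" "u \<in> cdom c" "z = cmap c u" "w \<in> cdom c" "w \<in> cdom d" "z = cmap c w"
      using \<open>z \<in> S\<close> unfolding S_def by blast
    have u: "cinv c z = u"
      unfolding uw(3) by (rule cinv_cmap'[OF c uw(2)])
    have w: "cinv c z = w"
      unfolding uw(6) by (rule cinv_cmap'[OF c uw(4)])
    show "cinv c z \<in> U" "cinv c z \<in> cdom c" by (simp_all only: u uw(1,2))
    show "cinv c z \<in> cdom d" by (simp only: w uw(5))
    show "cmap c (cinv c z) = z" by (simp only: u uw(3)[symmetric])
  qed
  have smF: "smooth_on S ?F"
    by (rule smooth_on_subset[OF transition(2)[OF c d]]) (simp add: S_def)
  have rel: "X (cinv d (?F z)) d = fd ?F z (X (cinv c z) c)"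
    if "\<And>q. q \<in> U \<Longrightarrow> X q \<in> tangent_space A q" "z \<in> S" for X z
    using tangent_space_transition[OF that(1) c d, of "cinv c z"] S[OF that(2)] by (simp add: cinv_cmap' d)
  have "fd (\<lambda>x. Y (cinv d x) d) (?F (cmap c p)) (X (cinv d (?F (cmap c p))) d)
      - fd (\<lambda>x. X (cinv d x) d) (?F (cmap c p)) (Y (cinv d (?F (cmap c p))) d)
    = fd ?F (cmap c p) (fd (\<lambda>x. Y (cinv c x) c) (cmap c p) (X (cinv c (cmap c p)) c)
      - fd (\<lambda>x. X (cinv c x) c) (cmap c p) (Y (cinv c (cmap c p)) c))"
    by (rule related_fields_bracket[OF opS inS smF])
      (use rel[of X] rel[of Y] X Y dX dY c d p in \<open>simp_all add: cinv_cmap'\<close>)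
  then show "lie_bracket A X Y p d = fd (cmap d \<circ> cinv c) (cmap c p) (lie_bracket A X Y p c)"
    using c d p by (simp add: lie_bracket_def cinv_cmap' o_def)
qed (auto simp: lie_bracket_def)

lemma linear_map_deriv:
  assumes "\<And>c. c \<in> A \<Longrightarrow> F z \<in> cdom c \<Longrightarrow> (\<lambda>y. cmap c (F y)) differentiable (at z)"
  shows "linear (\<lambda>h. map_deriv A F z h c)"
  using assms linear_fd[of "\<lambda>y. cmap c (F y)" z]
  by (cases "c \<in> A \<and> F z \<in> cdom c") (auto simp: map_deriv_def o_def module_hom_zero linear_zero)

end

section \<open>Left-invariant vector fields\<close>

locale lie_group_chart =
  fixes G :: "('g, 'x) monoid_scheme" (structure)
    and A :: "('g, 'e::findim_inner) atlas"
    and c0 :: "('g, 'e) chart"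
  assumes lie_group: "lie_group G A"
    and c0: "c0 \<in> A" "\<one> \<in> cdom c0"
begin

sublocale manifold_charts A
  by unfold_locales (use lie_group in \<open>simp add: lie_group_def smooth_manifold_def smooth_atlas_def o_def\<close>)

sublocale group G
  using lie_group by (simp add: lie_group_def)

definition x0 :: 'e where "x0 = cmap c0 \<one>"

lemma points_eq: "points A = carrier G"
  using lie_group by (simp add: lie_group_def)

lemma cdom_carrier: "c \<in> A \<Longrightarrow> p \<in> cdom c \<Longrightarrow> p \<in> carrier G"
  using points_eq by (auto simp: points_def)

lemma ex_chart: "g \<in> carrier G \<Longrightarrow> \<exists>c\<in>A. g \<in> cdom c"
  using points_chart points_eq by blast

lemma cinv_carrier: "c \<in> A \<Longrightarrow> x \<in> cimg c \<Longrightarrow> cinv c x \<in> carrier G"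
  by (rule cdom_carrier[OF _ cinv_in_cdom])

lemma x0: "x0 \<in> cimg c0" "cinv c0 x0 = \<one>"
  using c0 by (auto simp: x0_def cinv_cmap')

definition mult_dom :: "('g, 'e) chart \<Rightarrow> ('g, 'e) chart \<Rightarrow> ('g, 'e) chart \<Rightarrow> ('e \<times> 'e) set" where
  "mult_dom c d e = {z \<in> cimg c \<times> cimg d. cinv c (fst z) \<otimes> cinv d (snd z) \<in> cdom e}"

definition mult_chart :: "('g, 'e) chart \<Rightarrow> ('g, 'e) chart \<Rightarrow> ('g, 'e) chart \<Rightarrow> 'e \<times> 'e \<Rightarrow> 'e" where
  "mult_chart c d e z = cmap e (cinv c (fst z) \<otimes> cinv d (snd z))"

lemma mult_smooth:
  assumes "c \<in> A" "d \<in> A" "e \<in> A"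
  shows "open (mult_dom c d e)" "smooth_on (mult_dom c d e) (mult_chart c d e)"
proof -
  let ?C = "(cdom c \<times> cdom d, map_prod (cmap c) (cmap d))"
  have inj: "inj_on (cmap C) (cdom C)" and op: "open (cimg C)"
    if CA: "C \<in> product_atlas A A" for C
  proof -
    obtain c d where C: "C = (cdom c \<times> cdom d, map_prod (cmap c) (cmap d))" "c \<in> A" "d \<in> A"
    proof -
      obtain p where p: "p \<in> A \<times> A" "C = (\<lambda>(c, d). (cdom c \<times> cdom d, map_prod (cmap c) (cmap d))) p"
        using CA unfolding product_atlas_def by blast
      show thesis
        by (rule that[of "fst p" "snd p"]) (use p in \<open>auto simp: case_prod_unfold\<close>)
    qed
    show "inj_on (cmap C) (cdom C)"
      using chart_inj[OF C(2)] chart_inj[OF C(3)] by (simp add: C(1) map_prod_inj_on)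
    have "cimg C = cimg c \<times> cimg d"
      by (simp add: C(1) map_prod_image)
    then show "open (cimg C)"
      using open_cimg C by (simp add: open_Times)
  qed
  have C: "?C \<in> product_atlas A A"
    unfolding product_atlas_def using assms by (intro image_eqI[of _ _ "(c, d)"]) auto
  have f: "smooth_map (product_atlas A A) A (\<lambda>(g, h). g \<otimes> h)"
    using lie_group by (simp add: lie_group_def)
  have ci: "cinv ?C z = (cinv c (fst z), cinv d (snd z))" if "z \<in> cimg c \<times> cimg d" for z
    unfolding cinv_def[of ?C]
    by (rule inv_into_f_eq[OF inj[OF C]])
      (use that in \<open>auto simp: cinv_cmap' assms\<close>)
  have eq: "{x \<in> cimg ?C. (\<lambda>(g, h). g \<otimes> h) (cinv ?C x) \<in> cdom e} = mult_dom c d e"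
    using ci by (auto simp: mult_dom_def map_prod_image)
  note sm = smooth_map_local[OF inj op manifold f C assms(3)]
  show op': "open (mult_dom c d e)"
    using sm(1) by (simp only: eq)
  have "smooth_on (mult_dom c d e) (\<lambda>x. cmap e ((\<lambda>(g, h). g \<otimes> h) (cinv ?C x)))"
    using sm(2) by (simp only: eq)
  moreover have "cmap e ((\<lambda>(g, h). g \<otimes> h) (cinv ?C x)) = mult_chart c d e x" if "x \<in> mult_dom c d e" for x
  proof -
    have "x \<in> cimg c \<times> cimg d" using that by (simp add: mult_dom_def)
    then show ?thesis by (simp add: mult_chart_def ci)
  qed
  ultimately show "smooth_on (mult_dom c d e) (mult_chart c d e)"
    by (rule smooth_on_cong_imp[OF op'])
qed

definition inv_dom :: "('g, 'e) chart \<Rightarrow> ('g, 'e) chart \<Rightarrow> 'e set" where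
  "inv_dom c d = {x \<in> cimg c. inv (cinv c x) \<in> cdom d}"

lemma inv_smooth:
  assumes "c \<in> A" "d \<in> A"
  shows "open (inv_dom c d)" "smooth_on (inv_dom c d) (\<lambda>x. cmap d (inv (cinv c x)))"
  using smooth_map_local[OF chart_inj open_cimg manifold _ assms, of "\<lambda>g. inv g"] lie_group
  by (simp_all add: inv_dom_def lie_group_def)

definition ltrans :: "'g \<Rightarrow> ('g, 'e) chart \<Rightarrow> ('g, 'e) chart \<Rightarrow> 'e \<Rightarrow> 'e" where
  "ltrans g d c x = cmap c (g \<otimes> cinv d x)"

definition ltrans_dom :: "'g \<Rightarrow> ('g, 'e) chart \<Rightarrow> ('g, 'e) chart \<Rightarrow> 'e set" where
  "ltrans_dom g d c = {x \<in> cimg d. g \<otimes> cinv d x \<in> cdom c}"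

lemma ltrans_smooth:
  assumes "g \<in> carrier G" "c \<in> A" "d \<in> A"
  shows "open (ltrans_dom g d c)" "smooth_on (ltrans_dom g d c) (ltrans g d c)"
proof -
  obtain e where e: "e \<in> A" "g \<in> cdom e" using ex_chart assms(1) by blast
  have eq: "ltrans_dom g d c = (\<lambda>x. (cmap e g, x)) -` mult_dom e d c"
    using e by (auto simp: ltrans_dom_def mult_dom_def cinv_cmap')
  show op: "open (ltrans_dom g d c)"
    unfolding eq by (rule open_vimage[OF mult_smooth(1)]) (auto intro!: continuous_intros assms e)
  have "smooth_on (ltrans_dom g d c) (\<lambda>x. mult_chart e d c (cmap e g, x))"
    by (rule smooth_on_compose[OF op mult_smooth(1) _ mult_smooth(2)])
      (auto simp: eq intro!: assms e smooth_on_Pair op[unfolded eq])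
  then show "smooth_on (ltrans_dom g d c) (ltrans g d c)"
    by (simp add: mult_chart_def ltrans_def[abs_def] cinv_cmap' e)
qed

lemma ltrans_differentiable:
  "g \<in> carrier G \<Longrightarrow> c \<in> A \<Longrightarrow> d \<in> A \<Longrightarrow> x \<in> ltrans_dom g d c \<Longrightarrow> ltrans g d c differentiable (at x)"
  by (rule smooth_on_differentiable[OF ltrans_smooth(2)])

lemma ltrans_compose:
  assumes "g \<in> carrier G" "h \<in> carrier G" "c \<in> A" "d \<in> A" "e \<in> A"
    and "x \<in> ltrans_dom h e d" "ltrans h e d x \<in> ltrans_dom g d c"
  shows "fd (ltrans (g \<otimes> h) e c) x v = fd (ltrans g d c) (ltrans h e d x) (fd (ltrans h e d) x v)"
proof -
  have "fd (ltrans (g \<otimes> h) e c) x = fd (\<lambda>y. ltrans g d c (ltrans h e d y)) x"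
  proof (rule fd_cong_open[OF ltrans_smooth(1) assms(6)])
    fix y assume "y \<in> ltrans_dom h e d"
    then show "ltrans (g \<otimes> h) e c y = ltrans g d c (ltrans h e d y)"
      using assms(1-5) by (simp add: ltrans_def ltrans_dom_def cinv_cmap' m_assoc cinv_carrier)
  qed (use assms in auto)
  also have "\<dots> = (\<lambda>v. fd (ltrans g d c) (ltrans h e d x) (fd (ltrans h e d) x v))"
    by (rule fd_compose; rule ltrans_differentiable; fact)
  finally show ?thesis by simp
qed

lemma ltrans_one:
  assumes "c \<in> A" "x \<in> cimg c"
  shows "x \<in> ltrans_dom \<one> c c" "ltrans \<one> c c x = x" "fd (ltrans \<one> c c) x v = v"
proof -
  have *: "\<one> \<otimes> cinv c y = cinv c y" if "y \<in> cimg c" for y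
    using assms(1) that by (simp add: cinv_carrier)
  show "x \<in> ltrans_dom \<one> c c" "ltrans \<one> c c x = x"
    using assms by (auto simp: ltrans_dom_def ltrans_def * cinv_in_cdom cmap_cinv)
  have "fd (ltrans \<one> c c) x = fd (\<lambda>x. x) x"
    by (rule fd_cong_open[OF open_cimg[OF assms(1)] assms(2)]) (simp only: ltrans_def * cmap_cinv)
  then show "fd (ltrans \<one> c c) x v = v" by simp
qed

text \<open>The left-invariant field whose value at the identity has the coordinates \<open>\<zeta>\<close> in \<open>c0\<close>.\<close>

definition lfield :: "'e \<Rightarrow> 'g \<Rightarrow> ('g, 'e) tvec" where
  "lfield \<zeta> g = map_deriv A (\<lambda>x. g \<otimes> cinv c0 x) x0 \<zeta>"

lemma x0_ltrans_dom: "c \<in> A \<Longrightarrow> g \<in> cdom c \<Longrightarrow> x0 \<in> ltrans_dom g c0 c"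
  by (simp add: ltrans_dom_def x0 cdom_carrier)

lemma ltrans_x0: "c \<in> A \<Longrightarrow> g \<in> cdom c \<Longrightarrow> ltrans g c0 c x0 = cmap c g"
  by (simp add: ltrans_def x0 cdom_carrier)

lemma lfield_chart: "c \<in> A \<Longrightarrow> g \<in> cdom c \<Longrightarrow> lfield \<zeta> g c = fd (ltrans g c0 c) x0 \<zeta>"
  by (simp add: lfield_def map_deriv_def x0 cdom_carrier o_def ltrans_def[abs_def])

lemma lfield_tangent:
  assumes "g \<in> carrier G" shows "lfield \<zeta> g \<in> tangent_space A g"
proof -
  have "lfield \<zeta> g \<in> tangent_space A (g \<otimes> cinv c0 x0)"
    unfolding lfield_def
  proof (rule map_deriv_tangent)
    fix c assume c: "c \<in> A" "g \<otimes> cinv c0 x0 \<in> cdom c"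
    then have "g \<in> cdom c" using assms by (simp add: x0)
    then show "\<exists>N. open N \<and> x0 \<in> N \<and> (\<forall>y\<in>N. g \<otimes> cinv c0 y \<in> cdom c)
        \<and> (\<lambda>y. cmap c (g \<otimes> cinv c0 y)) differentiable (at x0)"
      using ltrans_smooth(1)[OF assms c(1) c0(1)] x0_ltrans_dom[OF c(1)]
        ltrans_differentiable[OF assms c(1) c0(1), of x0]
      by (intro exI[of _ "ltrans_dom g c0 c"]) (auto simp: ltrans_dom_def ltrans_def[abs_def])
  qed
  then show ?thesis using assms by (simp add: x0)
qed

lemma lfield_invariant:
  assumes "g \<in> carrier G" "d \<in> A" "c \<in> A" "h \<in> cdom d" "g \<otimes> h \<in> cdom c"
  shows "lfield \<zeta> (g \<otimes> h) c = fd (ltrans g d c) (cmap d h) (lfield \<zeta> h d)"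
proof -
  have h: "h \<in> carrier G" using assms cdom_carrier by blast
  have "fd (ltrans (g \<otimes> h) c0 c) x0 \<zeta> = fd (ltrans g d c) (ltrans h c0 d x0) (fd (ltrans h c0 d) x0 \<zeta>)"
    by (rule ltrans_compose[OF assms(1) h assms(3,2) c0(1) x0_ltrans_dom[OF assms(2,4)]])
      (use assms in \<open>auto simp: ltrans_x0 ltrans_dom_def cinv_cmap'\<close>)
  then show ?thesis
    using assms by (simp add: lfield_chart ltrans_x0)
qed

text \<open>The left-invariant frame in the chart \<open>c\<close>. Its inverse \<open>M\<close> below is the Maurer-Cartan form: the
  derivative of left translation back to the identity.\<close>

definition L :: "('g, 'e) chart \<Rightarrow> 'e \<Rightarrow> 'e \<Rightarrow> 'e" where
  "L c x \<zeta> = lfield \<zeta> (cinv c x) c"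

lemma lfield_L: "c \<in> A \<Longrightarrow> g \<in> cdom c \<Longrightarrow> lfield \<zeta> g c = L c (cmap c g) \<zeta>"
  by (simp add: L_def cinv_cmap')

lemma L_eq: "c \<in> A \<Longrightarrow> x \<in> cimg c \<Longrightarrow> L c x \<zeta> = fd (ltrans (cinv c x) c0 c) x0 \<zeta>"
  by (simp add: L_def lfield_chart cinv_in_cdom)

lemma linear_L: "c \<in> A \<Longrightarrow> x \<in> cimg c \<Longrightarrow> linear (L c x)"
proof -
  assume c: "c \<in> A" "x \<in> cimg c"
  have "linear (fd (ltrans (cinv c x) c0 c) x0)"
    by (intro linear_fd ltrans_differentiable cinv_carrier c c0 x0_ltrans_dom cinv_in_cdom)
  moreover have "L c x = fd (ltrans (cinv c x) c0 c) x0"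
    by (rule ext) (rule L_eq[OF c])
  ultimately show ?thesis by simp
qed

lemma smooth_L:
  assumes c: "c \<in> A"
  shows "smooth_on (cimg c) (\<lambda>x. L c x \<zeta>)"
proof -
  have dom: "(x, x0) \<in> mult_dom c c0 c" if "x \<in> cimg c" for x
    using that c x0 by (simp add: mult_dom_def cinv_carrier cinv_in_cdom)
  have 1: "fd (mult_chart c c0 c) (x, x0) (0, \<zeta>) = L c x \<zeta>" if x: "x \<in> cimg c" for x
  proof -
    have d: "mult_chart c c0 c differentiable (at (x, x0))"
      by (rule smooth_on_differentiable[OF mult_smooth(2) dom[OF x]]) (use c c0 in auto)
    have p: "((\<lambda>y. (x, y)) has_derivative (\<lambda>k. (0, k))) (at x0)"
      by (auto intro!: derivative_eq_intros)
    have "ltrans (cinv c x) c0 c = (\<lambda>y. mult_chart c c0 c (x, y))"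
      by (simp add: ltrans_def mult_chart_def fun_eq_iff)
    then show ?thesis
      using fd_eqI[OF has_derivative_compose[OF p fd_has_derivative[OF d]]] L_eq[OF c x] by simp
  qed
  have "smooth_on (cimg c) (\<lambda>x. fd (mult_chart c c0 c) (x, x0) (0, \<zeta>))"
    by (rule smooth_on_fd_apply[OF mult_smooth(1) open_cimg _ mult_smooth(2)])
      (use c c0 dom in \<open>auto intro!: smooth_on_Pair open_cimg\<close>)
  then show ?thesis
    by (rule smooth_on_cong_imp[OF open_cimg[OF c]]) (rule 1)
qed

definition M :: "('g, 'e) chart \<Rightarrow> 'e \<Rightarrow> 'e \<Rightarrow> 'e" where
  "M c x y = fd (ltrans (inv (cinv c x)) c c0) x y"

lemma M_dom:
  assumes "c \<in> A" "x \<in> cimg c"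
  shows "x \<in> ltrans_dom (inv (cinv c x)) c c0" "ltrans (inv (cinv c x)) c c0 x = x0"
  using assms c0 by (auto simp: ltrans_dom_def ltrans_def x0_def cinv_carrier simp del: image_eqI)

lemma M_L: "c \<in> A \<Longrightarrow> x \<in> cimg c \<Longrightarrow> M c x (L c x \<zeta>) = \<zeta>"
proof -
  assume c: "c \<in> A" "x \<in> cimg c"
  let ?g = "cinv c x"
  have g: "?g \<in> carrier G" "?g \<in> cdom c" using c by (auto simp: cinv_carrier cinv_in_cdom)
  have "fd (ltrans (inv ?g \<otimes> ?g) c0 c0) x0 \<zeta>
      = fd (ltrans (inv ?g) c c0) (ltrans ?g c0 c x0) (fd (ltrans ?g c0 c) x0 \<zeta>)"
    by (rule ltrans_compose)
      (use g c c0 M_dom[OF c] in \<open>auto simp: ltrans_x0 x0_ltrans_dom cmap_cinv\<close>)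
  then show ?thesis
    using c g by (simp add: M_def L_eq ltrans_x0 cmap_cinv ltrans_one(3)[OF c0(1) x0(1)])
qed

lemma L_M: "c \<in> A \<Longrightarrow> x \<in> cimg c \<Longrightarrow> L c x (M c x y) = y"
proof -
  assume c: "c \<in> A" "x \<in> cimg c"
  let ?g = "cinv c x"
  have g: "?g \<in> carrier G" "?g \<in> cdom c" using c by (auto simp: cinv_carrier cinv_in_cdom)
  have "fd (ltrans (?g \<otimes> inv ?g) c c) x y
      = fd (ltrans ?g c0 c) (ltrans (inv ?g) c c0 x) (fd (ltrans (inv ?g) c c0) x y)"
    by (rule ltrans_compose)
      (use g c c0 M_dom[OF c] in \<open>auto simp: x0_ltrans_dom\<close>)
  then show ?thesis
    using c g M_dom[OF c] by (simp add: M_def L_eq ltrans_one(3)[OF c])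
qed

lemma linear_M: "c \<in> A \<Longrightarrow> x \<in> cimg c \<Longrightarrow> linear (M c x)"
  unfolding M_def
  by (intro linear_fd ltrans_differentiable inv_closed cinv_carrier c0 M_dom)

text \<open>Near \<open>x1\<close> the inverses stay in the domain of one chart \<open>d\<close>. There \<open>M\<close> is the partial derivative of
  the multiplication in its second argument, evaluated at a point depending smoothly on \<open>x\<close>.\<close>

lemma smooth_M:
  assumes c: "c \<in> A"
  shows "smooth_on (cimg c) (\<lambda>x. M c x y)"
proof (rule smooth_on_local)
  fix x1 assume x1: "x1 \<in> cimg c"
  obtain d where d: "d \<in> A" "inv (cinv c x1) \<in> cdom d"
    using ex_chart c x1 by (meson inv_closed cinv_carrier)
  have op: "open (inv_dom c d)" and sm: "smooth_on (inv_dom c d) (\<lambda>x. cmap d (inv (cinv c x)))"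
    using inv_smooth[OF c d(1)] by auto
  have dom: "(cmap d (inv (cinv c x)), x) \<in> mult_dom d c c0" if "x \<in> inv_dom c d" for x
    using that c d c0 by (simp add: mult_dom_def inv_dom_def cinv_cmap' cinv_carrier)
  have 1: "fd (mult_chart d c c0) (cmap d (inv (cinv c x)), x) (0, y) = M c x y"
    if x: "x \<in> inv_dom c d" for x
  proof -
    have df: "mult_chart d c c0 differentiable (at (cmap d (inv (cinv c x)), x))"
      by (rule smooth_on_differentiable[OF mult_smooth(2) dom[OF x]]) (use c c0 d in auto)
    have p: "((\<lambda>y. (cmap d (inv (cinv c x)), y)) has_derivative (\<lambda>k. (0, k))) (at x)"
      by (auto intro!: derivative_eq_intros)
    have "ltrans (inv (cinv c x)) c c0 = (\<lambda>y. mult_chart d c c0 (cmap d (inv (cinv c x)), y))"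
      using x d by (simp add: ltrans_def mult_chart_def fun_eq_iff inv_dom_def cinv_cmap')
    then show ?thesis
      using fd_eqI[OF has_derivative_compose[OF p fd_has_derivative[OF df]]] by (simp add: M_def)
  qed
  have "smooth_on (inv_dom c d) (\<lambda>x. fd (mult_chart d c c0) (cmap d (inv (cinv c x)), x) (0, y))"
    by (rule smooth_on_fd_apply[OF mult_smooth(1) op _ mult_smooth(2)])
      (use c c0 d dom in \<open>auto intro!: smooth_on_Pair op sm\<close>)
  then have "smooth_on (inv_dom c d) (\<lambda>x. M c x y)"
    by (rule smooth_on_cong_imp[OF op]) (rule 1)
  moreover have "x1 \<in> inv_dom c d" using x1 d by (simp add: inv_dom_def)
  ultimately show "\<exists>T. open T \<and> x1 \<in> T \<and> smooth_on T (\<lambda>x. M c x y)"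
    using op by blast
qed

lemma ex_lfield:
  assumes "g \<in> carrier G" "v \<in> tangent_space A g"
  shows "\<exists>\<zeta>. v = lfield \<zeta> g"
proof -
  obtain c where c: "c \<in> A" "g \<in> cdom c" using ex_chart assms by blast
  then have "v = lfield (M c (cmap c g) (v c)) g"
    by (intro tangent_space_eqI[OF assms(2) lfield_tangent[OF assms(1)] c]) (simp add: lfield_L L_M)
  then show ?thesis by blast
qed

lemma left_invariant_lfield: "left_invariant_field G A (lfield \<zeta>)"
  unfolding left_invariant_field_def smooth_section_def
proof (intro conjI ballI)
  fix g assume "g \<in> points A"
  then show "lfield \<zeta> g \<in> tangent_space A g" using lfield_tangent points_eq by simp
next
  fix c assume c: "c \<in> A"
  have "points A \<inter> cdom c = cdom c" using c by (auto simp: points_def)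
  then show "smooth_on (cmap c ` (points A \<inter> cdom c)) (\<lambda>x. lfield \<zeta> (cinv c x) c)"
    using smooth_L[OF c] by (simp add: L_def)
next
  fix g h assume g: "g \<in> carrier G" and h: "h \<in> carrier G"
  define d where "d = chart_at A h"
  have d: "d \<in> A" "h \<in> cdom d" using chart_at h by (auto simp: d_def points_eq)
  show "lfield \<zeta> (g \<otimes> h) = tangent_map A A (\<lambda>k. g \<otimes> k) h (lfield \<zeta> h)"
  proof
    fix c
    show "lfield \<zeta> (g \<otimes> h) c = tangent_map A A (\<lambda>k. g \<otimes> k) h (lfield \<zeta> h) c"
    proof (cases "c \<in> A \<and> g \<otimes> h \<in> cdom c")
      case True
      then show ?thesis
        using lfield_invariant[OF g d(1) _ d(2), of c \<zeta>] d
        by (simp add: tangent_map_def Let_def d_def[symmetric] map_deriv_def cinv_cmap' o_def ltrans_def[abs_def])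
    next
      case False
      then show ?thesis
        using g h d by (auto simp: tangent_map_def Let_def d_def[symmetric] map_deriv_def cinv_cmap' lfield_def x0)
    qed
  qed
qed

section \<open>The Lie algebra\<close>

definition bracket_at :: "('g, 'e) chart \<Rightarrow> 'e \<Rightarrow> 'e \<Rightarrow> 'e \<Rightarrow> 'e" where
  "bracket_at c x v w = fd (\<lambda>y. L c y w) x (L c x v) - fd (\<lambda>y. L c y v) x (L c x w)"

definition br :: "'e \<Rightarrow> 'e \<Rightarrow> 'e" where
  "br = bracket_at c0 x0"

lemma L_differentiable: "c \<in> A \<Longrightarrow> x \<in> cimg c \<Longrightarrow> (\<lambda>y. L c y w) differentiable (at x)"
  by (rule smooth_on_differentiable[OF smooth_L])

lemma L_x0: "L c0 x0 \<zeta> = \<zeta>"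
  using L_eq[OF c0(1) x0(1)] ltrans_one(3)[OF c0(1) x0(1)] by (simp add: x0)

text \<open>A left-invariant field is related to itself by left translations, hence so is the bracket of two
  of them, and its components in the left-invariant frame are constant.\<close>

lemma bracket_at_eq:
  assumes c: "c \<in> A" "x \<in> cimg c"
  shows "bracket_at c x v w = L c x (br v w)"
proof -
  let ?g = "cinv c x" let ?F = "ltrans ?g c0 c" let ?S = "ltrans_dom ?g c0 c"
  have g: "?g \<in> carrier G" "?g \<in> cdom c" using c by (auto simp: cinv_carrier cinv_in_cdom)
  have F: "?F x0 = x" using c g by (simp add: ltrans_x0 cmap_cinv)
  have rel: "L c (?F z) \<zeta> = fd ?F z (L c0 z \<zeta>)" if "z \<in> ?S" for z \<zeta>
    using lfield_invariant[OF g(1) c0(1) c(1), of "cinv c0 z" \<zeta>] that c(1)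
    by (simp add: ltrans_dom_def ltrans_def lfield_L cinv_in_cdom cmap_cinv c0(1))
  have "fd (\<lambda>y. L c y w) (?F x0) (L c (?F x0) v) - fd (\<lambda>y. L c y v) (?F x0) (L c (?F x0) w)
    = fd ?F x0 (fd (\<lambda>y. L c0 y w) x0 (L c0 x0 v) - fd (\<lambda>y. L c0 y v) x0 (L c0 x0 w))"
    by (rule related_fields_bracket[OF ltrans_smooth(1) x0_ltrans_dom ltrans_smooth(2)])
      (use c g c0 x0 rel F in \<open>auto intro!: L_differentiable\<close>)
  then show ?thesis
    unfolding F by (simp add: bracket_at_def br_def L_eq[OF c])
qed

lemma fd_L_linear: "c \<in> A \<Longrightarrow> x \<in> cimg c \<Longrightarrow> linear (\<lambda>w. fd (\<lambda>y. L c y w) x k)"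
proof (rule linearI)
  assume c: "c \<in> A" "x \<in> cimg c"
  note d = fd_has_derivative[OF L_differentiable[OF c]]
  fix v w r
  have "fd (\<lambda>y. L c y (v + w)) x = fd (\<lambda>y. L c y v + L c y w) x"
    by (rule fd_cong_open[OF open_cimg[OF c(1)] c(2)]) (simp add: linear_add[OF linear_L[OF c(1)]])
  then show "fd (\<lambda>y. L c y (v + w)) x k = fd (\<lambda>y. L c y v) x k + fd (\<lambda>y. L c y w) x k"
    by (simp add: fd_eqI[OF has_derivative_add[OF d d]])
  have "fd (\<lambda>y. L c y (r *\<^sub>R w)) x = fd (\<lambda>y. r *\<^sub>R L c y w) x"
    by (rule fd_cong_open[OF open_cimg[OF c(1)] c(2)]) (simp add: linear_scale[OF linear_L[OF c(1)]])
  then show "fd (\<lambda>y. L c y (r *\<^sub>R w)) x k = r *\<^sub>R fd (\<lambda>y. L c y w) x k"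
    by (simp add: fd_eqI[OF has_derivative_scaleR_right[OF d]])
qed

lemma br_x0: "br v w = fd (\<lambda>y. L c0 y w) x0 v - fd (\<lambda>y. L c0 y v) x0 w"
  by (simp add: br_def bracket_at_def L_x0)

sublocale lie_algebra br
proof (rule lie_algebra.intro)
  let ?X = "\<lambda>v y. L c0 y v"
  note lin1 = fd_L_linear[OF c0(1) x0(1)]
  note lin2 = linear_fd[OF L_differentiable[OF c0(1) x0(1)]]
  show "bounded_bilinear br"
  proof (rule bilinear_imp_bounded_bilinear)
    show "linear (br v)" for v
      unfolding br_x0[abs_def] by (intro linear_compose_sub lin1 lin2)
    show "linear (\<lambda>v. br v w)" for w
      unfolding br_x0 by (intro linear_compose_sub lin1 lin2)
  qed
  show "br v w = - br w v" for v w
    by (simp add: br_x0)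
  have op: "open (cimg c0)" by (rule open_cimg[OF c0(1)])
  \<comment> \<open>The fields \<open>?X v\<close> are closed under brackets near \<open>x0\<close>, so the Jacobi identity for \<open>br\<close> is that for
    vector fields: after inserting the first derivative of \<open>?X (br v w)\<close>, the mixed second
    derivatives cancel in the cyclic sum by symmetry.\<close>
  have D2: "fd (?X (br v w)) x0 k =
      (fd (\<lambda>y. fd (?X w) y v) x0 k + fd (?X w) x0 (fd (?X v) x0 k))
      - (fd (\<lambda>y. fd (?X v) y w) x0 k + fd (?X v) x0 (fd (?X w) x0 k))" for v w k
  proof -
    have "fd (?X (br v w)) x0 = fd (\<lambda>y. fd (?X w) y (?X v y) - fd (?X v) y (?X w y)) x0"
      by (rule fd_cong_open[OF op x0(1)])
        (simp add: bracket_at_eq[OF c0(1), symmetric] bracket_at_def)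
    also have "\<dots> = (\<lambda>k. (fd (\<lambda>y. fd (?X w) y (?X v x0)) x0 k + fd (?X w) x0 (fd (?X v) x0 k))
      - (fd (\<lambda>y. fd (?X v) y (?X w x0)) x0 k + fd (?X v) x0 (fd (?X w) x0 k)))"
      by (intro fd_eqI has_derivative_diff has_derivative_linear_family[OF op x0(1)] linear_fd
          fd_has_derivative L_differentiable[OF c0(1)] x0(1)
          smooth_on_differentiable[OF smooth_on_fd[OF smooth_L[OF c0(1)]]])
    finally show ?thesis by (simp add: L_x0)
  qed
  have sym: "fd (\<lambda>y. fd (?X w) y v) x0 u = fd (\<lambda>y. fd (?X w) y u) x0 v" for u v w
    by (rule fd_commute[OF op x0(1) smooth_L[OF c0(1)]])
  have e: "br u (br v w) =
      ((fd (\<lambda>y. fd (?X w) y v) x0 u + fd (?X w) x0 (fd (?X v) x0 u))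
      - (fd (\<lambda>y. fd (?X v) y w) x0 u + fd (?X v) x0 (fd (?X w) x0 u)))
      - (fd (?X u) x0 (fd (?X w) x0 v) - fd (?X u) x0 (fd (?X v) x0 w))" for u v w
  proof -
    have "fd (?X u) x0 (br v w) = fd (?X u) x0 (fd (?X w) x0 v) - fd (?X u) x0 (fd (?X v) x0 w)"
      unfolding br_x0[of v w] by (rule linear_diff[OF lin2])
    then show ?thesis
      by (simp only: br_x0[of u "br v w"] D2)
  qed
  show "br u (br v w) + br v (br w u) + br w (br u v) = 0" for u v w
    unfolding e sym[of u w v] sym[of v u w] sym[of w v u] by simp
qed

end

section \<open>The tangent bundle\<close>

definition tchart :: "('a, 'e::real_normed_vector) atlas \<Rightarrow> ('a, 'e) chart \<Rightarrow> ('a \<times> ('a, 'e) tvec, 'e \<times> 'e) chart" where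
  "tchart A c = (SIGMA p : cdom c. tangent_space A p, \<lambda>(p, v). (cmap c p, v c))"

lemma tangent_atlas_eq: "tangent_atlas A = tchart A ` A"
  by (simp add: tangent_atlas_def tchart_def[abs_def])

lemma cdom_tchart: "q \<in> cdom (tchart A c) \<longleftrightarrow> fst q \<in> cdom c \<and> snd q \<in> tangent_space A (fst q)"
  by (cases q) (simp add: tchart_def)

lemma cmap_tchart: "cmap (tchart A c) q = (cmap c (fst q), snd q c)"
  by (simp add: tchart_def case_prod_unfold)

context manifold_charts
begin

lemma cimg_tchart:
  assumes "c \<in> A" shows "cimg (tchart A c) = cimg c \<times> UNIV"
proof (intro equalityI subsetI)
  fix z assume "z \<in> cimg c \<times> (UNIV :: 'e set)"
  then obtain p y where z: "z = (cmap c p, y)" "p \<in> cdom c" by auto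
  obtain v where "v \<in> tangent_space A p" "v c = y"
    using tangent_space_ex[OF assms z(2)] by blast
  then show "z \<in> cimg (tchart A c)"
    by (intro image_eqI[of _ _ "(p, v)"]) (simp_all add: z cmap_tchart cdom_tchart)
qed (auto simp: cmap_tchart cdom_tchart)

lemma inj_tchart:
  assumes "c \<in> A" shows "inj_on (cmap (tchart A c)) (cdom (tchart A c))"
proof (rule inj_onI)
  fix q r assume q: "q \<in> cdom (tchart A c)" and r: "r \<in> cdom (tchart A c)"
    and eq: "cmap (tchart A c) q = cmap (tchart A c) r"
  have "fst q = fst r"
    using q r eq inj_onD[OF chart_inj[OF assms]] by (auto simp: cdom_tchart cmap_tchart)
  moreover have "snd q = snd r"
    using q r eq \<open>fst q = fst r\<close> by (intro tangent_space_eqI[of _ "fst q" _ c]) (auto simp: cdom_tchart cmap_tchart assms)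
  ultimately show "q = r" by (rule prod_eqI)
qed

lemma cinv_tchart:
  assumes "c \<in> A" "z \<in> cimg c \<times> UNIV"
  shows "fst (cinv (tchart A c) z) = cinv c (fst z)" "snd (cinv (tchart A c) z) c = snd z"
    "snd (cinv (tchart A c) z) \<in> tangent_space A (cinv c (fst z))"
proof -
  have z: "z \<in> cimg (tchart A c)" using assms by (simp add: cimg_tchart)
  have "fst (cinv (tchart A c) z) \<in> cdom c"
    using cinv_in_cdom[OF z] by (simp add: cdom_tchart)
  moreover have "(cmap c (fst (cinv (tchart A c) z)), snd (cinv (tchart A c) z) c) = z"
    using cmap_cinv[OF z] by (simp add: cmap_tchart)
  ultimately show 1: "fst (cinv (tchart A c) z) = cinv c (fst z)"
    and "snd (cinv (tchart A c) z) c = snd z"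
    using cinv_cmap'[OF assms(1)] by (metis fst_conv, metis snd_conv)
  show "snd (cinv (tchart A c) z) \<in> tangent_space A (cinv c (fst z))"
    using cinv_in_cdom[OF z] 1 by (simp add: cdom_tchart)
qed

lemma smooth_atlas_tangent: "smooth_atlas (tangent_atlas A)"
  unfolding smooth_atlas_def tangent_atlas_eq
proof (intro conjI ballI)
  fix C assume "C \<in> tchart A ` A"
  then obtain c where c: "c \<in> A" "C = tchart A c" by blast
  show "inj_on (cmap C) (cdom C)" "open (cimg C)"
    using inj_tchart[OF c(1)] open_cimg[OF c(1)] cimg_tchart[OF c(1)] by (simp_all add: c(2) open_Times)
  fix D assume "D \<in> tchart A ` A"
  then obtain d where d: "d \<in> A" "D = tchart A d" by blast
  let ?S = "cmap c ` (cdom c \<inter> cdom d)" let ?f = "\<lambda>x. cmap d (cinv c x)"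
  have eq: "cmap C ` (cdom C \<inter> cdom D) = ?S \<times> UNIV"
  proof (intro equalityI subsetI)
    fix z assume "z \<in> ?S \<times> (UNIV :: 'e set)"
    then obtain p y where z: "z = (cmap c p, y)" "p \<in> cdom c" "p \<in> cdom d" by auto
    obtain v where "v \<in> tangent_space A p" "v c = y"
      using tangent_space_ex[OF c(1) z(2)] by blast
    then show "z \<in> cmap C ` (cdom C \<inter> cdom D)"
      by (intro image_eqI[of _ _ "(p, v)"]) (simp_all add: z c d cmap_tchart cdom_tchart)
  qed (auto simp: c d cmap_tchart cdom_tchart)
  have op: "open (?S \<times> (UNIV :: 'e set))" using transition(1)[OF c(1) d(1)] by (simp add: open_Times)
  show "open (cmap C ` (cdom C \<inter> cdom D))" unfolding eq by (rule op)
  have "smooth_on (?S \<times> UNIV) (\<lambda>z. (?f (fst z), fd ?f (fst z) (snd z)))"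
    by (intro smooth_on_Pair op smooth_on_compose[OF op transition(1)[OF c(1) d(1)] _ transition(2)[OF c(1) d(1)]]
        smooth_on_fd_apply[OF transition(1)[OF c(1) d(1)] op _ transition(2)[OF c(1) d(1)]]
        smooth_on_fst smooth_on_snd smooth_on_ident) auto
  then show "smooth_on (cmap C ` (cdom C \<inter> cdom D)) (\<lambda>x. cmap D (cinv C x))"
    unfolding eq
  proof (rule smooth_on_cong_imp[OF op])
    fix z assume z: "z \<in> ?S \<times> (UNIV :: 'e set)"
    then have p: "cinv c (fst z) \<in> cdom c" "cinv c (fst z) \<in> cdom d" "cmap c (cinv c (fst z)) = fst z"
      by (auto simp: cinv_cmap' c)
    have zc: "z \<in> cimg c \<times> UNIV" using z by auto
    note t = cinv_tchart[OF c(1) zc]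
    show "(?f (fst z), fd ?f (fst z) (snd z)) = cmap D (cinv C z)"
      using tangent_space_transition[OF t(3) c(1) d(1) p(1,2)] by (simp add: d c cmap_tchart t p(3))
  qed
qed

lemma tchart_in: "c \<in> A \<Longrightarrow> tchart A c \<in> tangent_atlas A"
  by (simp add: tangent_atlas_eq)

lemma tchart_cases: "C \<in> tangent_atlas A \<Longrightarrow> (\<And>c. c \<in> A \<Longrightarrow> C = tchart A c \<Longrightarrow> P) \<Longrightarrow> P"
  by (auto simp: tangent_atlas_eq)

lemma points_tangent_atlas:
  "q \<in> points (tangent_atlas A) \<longleftrightarrow> fst q \<in> points A \<and> snd q \<in> tangent_space A (fst q)"
  by (auto simp: points_def tangent_atlas_eq cdom_tchart)

end

section \<open>The left trivialization of the tangent bundle\<close>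

context lie_group_chart
begin

sublocale T: manifold_charts "tangent_atlas A"
  by unfold_locales (rule smooth_atlas_tangent)

abbreviation TA :: "('g \<times> ('g, 'e) tvec, 'e \<times> 'e) atlas" where
  "TA \<equiv> tangent_atlas A"

abbreviation TG :: "('g \<times> ('g, 'e) tvec) set" where
  "TG \<equiv> points TA"

definition triv :: "'g \<Rightarrow> 'e \<Rightarrow> 'g \<times> ('g, 'e) tvec" where
  "triv g \<xi> = (g, lfield \<xi> g)"

definition tau :: "'g \<times> ('g, 'e) tvec \<Rightarrow> 'e" where
  "tau q = (SOME \<xi>. snd q = lfield \<xi> (fst q))"

lemma TG_iff: "q \<in> TG \<longleftrightarrow> fst q \<in> carrier G \<and> snd q \<in> tangent_space A (fst q)"
  by (simp add: points_tangent_atlas points_eq)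

lemma TG_tchart: "q \<in> TG \<Longrightarrow> q \<in> cdom (tchart A c) \<longleftrightarrow> fst q \<in> cdom c"
  by (simp add: cdom_tchart TG_iff)

lemma cdom_tchart_TG: "c \<in> A \<Longrightarrow> q \<in> cdom (tchart A c) \<Longrightarrow> q \<in> TG \<and> fst q \<in> cdom c"
  by (simp add: cdom_tchart TG_iff cdom_carrier)

lemma triv_TG: "g \<in> carrier G \<Longrightarrow> triv g \<xi> \<in> TG"
  by (simp add: triv_def TG_iff lfield_tangent)

lemma triv_tau: "q \<in> TG \<Longrightarrow> triv (fst q) (tau q) = q"
proof -
  assume "q \<in> TG"
  then have "\<exists>\<xi>. snd q = lfield \<xi> (fst q)"
    using ex_lfield by (simp add: TG_iff)
  then have "snd q = lfield (tau q) (fst q)"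
    unfolding tau_def by (rule someI_ex)
  then show ?thesis by (simp add: triv_def prod_eq_iff)
qed

text \<open>The left trivialization \<open>triv\<close> and its inverse, in the coordinates of \<open>c\<close> on \<open>G\<close> and of \<open>tchart A c\<close> on
  \<open>TG\<close>.\<close>

definition Tmap :: "('g, 'e) chart \<Rightarrow> 'e \<times> 'e \<Rightarrow> 'e \<times> 'e" where
  "Tmap c z = (fst z, L c (fst z) (snd z))"

definition Tinv :: "('g, 'e) chart \<Rightarrow> 'e \<times> 'e \<Rightarrow> 'e \<times> 'e" where
  "Tinv c z = (fst z, M c (fst z) (snd z))"

lemma Tmap_Tinv: "c \<in> A \<Longrightarrow> fst z \<in> cimg c \<Longrightarrow> Tmap c (Tinv c z) = z"
  and Tinv_Tmap: "c \<in> A \<Longrightarrow> fst z \<in> cimg c \<Longrightarrow> Tinv c (Tmap c z) = z"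
  by (simp_all add: Tmap_def Tinv_def L_M M_L)

lemma fst_Tmap [simp]: "fst (Tmap c z) = fst z" and fst_Tinv [simp]: "fst (Tinv c z) = fst z"
  by (simp_all add: Tmap_def Tinv_def)

lemma open_tcimg: "c \<in> A \<Longrightarrow> open (cimg c \<times> (UNIV :: 'e set))"
  by (simp add: open_Times open_cimg)

lemma smooth_Tmap: "c \<in> A \<Longrightarrow> smooth_on (cimg c \<times> UNIV) (Tmap c)"
  and smooth_Tinv: "c \<in> A \<Longrightarrow> smooth_on (cimg c \<times> UNIV) (Tinv c)"
proof -
  assume c: "c \<in> A"
  note op = open_tcimg[OF c]
  have f: "smooth_on (cimg c \<times> (UNIV :: 'e set)) fst" and s: "smooth_on (cimg c \<times> (UNIV :: 'e set)) snd"
    by (rule smooth_on_bounded_linear[OF bounded_linear_fst] smooth_on_bounded_linear[OF bounded_linear_snd])+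
  have img: "fst ` (cimg c \<times> (UNIV :: 'e set)) \<subseteq> cimg c" by auto
  show "smooth_on (cimg c \<times> UNIV) (Tmap c)"
    unfolding Tmap_def[abs_def]
    by (rule smooth_on_Pair[OF op f smooth_on_linear_family[OF open_cimg[OF c] op img smooth_L[OF c] linear_L[OF c] f s]])
  show "smooth_on (cimg c \<times> UNIV) (Tinv c)"
    unfolding Tinv_def[abs_def]
    by (rule smooth_on_Pair[OF op f smooth_on_linear_family[OF open_cimg[OF c] op img smooth_M[OF c] linear_M[OF c] f s]])
qed

lemma Tmap_differentiable: "c \<in> A \<Longrightarrow> fst z \<in> cimg c \<Longrightarrow> Tmap c differentiable (at z)"
  by (rule smooth_on_differentiable[OF smooth_Tmap]) (auto simp: mem_Times_iff)

lemma Tinv_differentiable: "c \<in> A \<Longrightarrow> fst z \<in> cimg c \<Longrightarrow> Tinv c differentiable (at z)"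
  by (rule smooth_on_differentiable[OF smooth_Tinv]) (auto simp: mem_Times_iff)

lemma fd_Tinv_Tmap:
  assumes "c \<in> A" "fst z \<in> cimg c"
  shows "fd (Tinv c) (Tmap c z) (fd (Tmap c) z h) = h"
proof -
  have z: "z \<in> cimg c \<times> UNIV" using assms by (simp add: mem_Times_iff)
  have "fd (\<lambda>z. Tinv c (Tmap c z)) z = fd (\<lambda>z. z) z"
    by (rule fd_cong_open[OF open_tcimg[OF assms(1)] z]) (auto simp: Tinv_Tmap assms)
  then have "(\<lambda>h. fd (Tinv c) (Tmap c z) (fd (Tmap c) z h)) = (\<lambda>h. h)"
    using fd_compose[OF Tmap_differentiable[OF assms] Tinv_differentiable[OF assms(1), of "Tmap c z"]]
    by (simp add: assms)
  from fun_cong[OF this, of h] show ?thesis .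
qed

lemma cmap_triv:
  "c \<in> A \<Longrightarrow> g \<in> cdom c \<Longrightarrow> cmap (tchart A c) (triv g \<xi>) = Tmap c (cmap c g, \<xi>)"
  by (simp add: cmap_tchart triv_def Tmap_def lfield_L)

lemma cmap_tau:
  "c \<in> A \<Longrightarrow> q \<in> TG \<Longrightarrow> fst q \<in> cdom c \<Longrightarrow> cmap (tchart A c) q = Tmap c (cmap c (fst q), tau q)"
  using cmap_triv[of c "fst q" "tau q"] triv_tau[of q] by simp

lemma Tinv_cmap:
  "c \<in> A \<Longrightarrow> q \<in> TG \<Longrightarrow> fst q \<in> cdom c \<Longrightarrow> Tinv c (cmap (tchart A c) q) = (cmap c (fst q), tau q)"
  by (simp add: cmap_tau Tinv_Tmap)

text \<open>The tangent vector of \<open>TG\<close> at \<open>q\<close> with components \<open>fst h\<close> along \<open>G\<close> and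
  \<open>snd h\<close> along the fibre in the left trivialization.\<close>

definition trivec :: "'g \<times> ('g, 'e) tvec \<Rightarrow> 'e \<times> 'e \<Rightarrow> ('g \<times> ('g, 'e) tvec, 'e \<times> 'e) tvec" where
  "trivec q h = map_deriv TA (\<lambda>z. triv (fst q \<otimes> cinv c0 (fst z)) (snd z)) (x0, tau q) h"

text \<open>The parametrization of \<open>TG\<close> around \<open>q\<close> that defines \<open>trivec\<close> factors in a chart through \<open>Tmap\<close>; the other
  factor is a left translation on the base, whose derivative at \<open>x0\<close> is the frame \<open>L\<close>.\<close>

lemma triv_path:
  assumes q: "q \<in> TG" and c: "c \<in> A" "fst q \<in> cdom c"
  defines "F \<equiv> \<lambda>z. triv (fst q \<otimes> cinv c0 (fst z)) (snd z)"
    and "H \<equiv> \<lambda>z. (ltrans (fst q) c0 c (fst z), snd z)"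
    and "N \<equiv> ltrans_dom (fst q) c0 c \<times> UNIV"
  shows "open N" "(x0, tau q) \<in> N" "\<And>z. z \<in> N \<Longrightarrow> F z \<in> cdom (tchart A c)"
    and "\<And>z. z \<in> N \<Longrightarrow> cmap (tchart A c) (F z) = Tmap c (H z)"
    and "H (x0, tau q) = (cmap c (fst q), tau q)"
    and "(H has_derivative (\<lambda>h. (L c (cmap c (fst q)) (fst h), snd h))) (at (x0, tau q))"
proof -
  have g: "fst q \<in> carrier G" using q by (simp add: TG_iff)
  show "open N" unfolding N_def using ltrans_smooth(1)[OF g c(1) c0(1)] by (simp add: open_Times)
  show "(x0, tau q) \<in> N" using x0_ltrans_dom[OF c] by (simp add: N_def)
  have *: "fst q \<otimes> cinv c0 (fst z) \<in> cdom c" if "z \<in> N" for z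
    using that by (auto simp: N_def ltrans_dom_def)
  show "F z \<in> cdom (tchart A c)" if "z \<in> N" for z
    using *[OF that] c(1) by (simp add: F_def triv_def cdom_tchart lfield_tangent cdom_carrier)
  show "cmap (tchart A c) (F z) = Tmap c (H z)" if "z \<in> N" for z
    unfolding F_def H_def using *[OF that] c(1) by (simp add: cmap_triv ltrans_def)
  show "H (x0, tau q) = (cmap c (fst q), tau q)"
    using c by (simp add: H_def ltrans_x0)
  have d: "(ltrans (fst q) c0 c has_derivative fd (ltrans (fst q) c0 c) x0) (at (fst (x0, tau q)))"
    using ltrans_differentiable[OF g c(1) c0(1) x0_ltrans_dom[OF c]] by (simp add: fd_has_derivative)
  have e: "L c (cmap c (fst q)) v = fd (ltrans (fst q) c0 c) x0 v" for v
    using c by (simp add: L_eq cinv_cmap')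
  show "(H has_derivative (\<lambda>h. (L c (cmap c (fst q)) (fst h), snd h))) (at (x0, tau q))"
    unfolding H_def e
    by (rule has_derivative_Pair[OF has_derivative_compose[OF has_derivative_fst[OF has_derivative_ident] d]
          has_derivative_snd[OF has_derivative_ident]])
qed

lemma trivec_differentiable:
  assumes "q \<in> TG" "c \<in> A" "fst q \<in> cdom c"
  shows "(\<lambda>z. cmap (tchart A c) (triv (fst q \<otimes> cinv c0 (fst z)) (snd z))) differentiable (at (x0, tau q))"
    and "fd (\<lambda>z. cmap (tchart A c) (triv (fst q \<otimes> cinv c0 (fst z)) (snd z))) (x0, tau q) h
      = fd (Tmap c) (cmap c (fst q), tau q) (L c (cmap c (fst q)) (fst h), snd h)"
proof -
  note p = triv_path[OF assms]
  have T: "(Tmap c has_derivative fd (Tmap c) (cmap c (fst q), tau q)) (at (cmap c (fst q), tau q))"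
    using assms by (intro fd_has_derivative Tmap_differentiable) auto
  have "((\<lambda>z. Tmap c (ltrans (fst q) c0 c (fst z), snd z)) has_derivative
      (\<lambda>h. fd (Tmap c) (cmap c (fst q), tau q) (L c (cmap c (fst q)) (fst h), snd h))) (at (x0, tau q))"
    by (rule has_derivative_compose[OF p(6)]) (use T p(5) in simp)
  then have "((\<lambda>z. cmap (tchart A c) (triv (fst q \<otimes> cinv c0 (fst z)) (snd z))) has_derivative
      (\<lambda>h. fd (Tmap c) (cmap c (fst q), tau q) (L c (cmap c (fst q)) (fst h), snd h))) (at (x0, tau q))"
    by (rule has_derivative_cong_open[OF p(1,2), THEN iffD2, rotated]) (rule p(4))
  then show "(\<lambda>z. cmap (tchart A c) (triv (fst q \<otimes> cinv c0 (fst z)) (snd z))) differentiable (at (x0, tau q))"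
    and "fd (\<lambda>z. cmap (tchart A c) (triv (fst q \<otimes> cinv c0 (fst z)) (snd z))) (x0, tau q) h
      = fd (Tmap c) (cmap c (fst q), tau q) (L c (cmap c (fst q)) (fst h), snd h)"
    by (auto simp: differentiable_def fd_eqI)
qed

lemma triv_base: "q \<in> TG \<Longrightarrow> triv (fst q \<otimes> cinv c0 (fst (x0, tau q))) (snd (x0, tau q)) = q"
  by (simp add: x0 triv_tau TG_iff)

lemma trivec_chart:
  assumes "q \<in> TG" "c \<in> A" "fst q \<in> cdom c"
  shows "trivec q h (tchart A c) = fd (Tmap c) (cmap c (fst q), tau q) (L c (cmap c (fst q)) (fst h), snd h)"
  using trivec_differentiable(2)[OF assms] triv_base[OF assms(1)] assms
  by (simp add: trivec_def map_deriv_def tchart_in TG_tchart o_def)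

lemma trivec_tangent: "q \<in> TG \<Longrightarrow> trivec q h \<in> tangent_space TA q"
proof -
  assume q: "q \<in> TG"
  have "trivec q h \<in> tangent_space TA (triv (fst q \<otimes> cinv c0 (fst (x0, tau q))) (snd (x0, tau q)))"
    unfolding trivec_def
  proof (rule T.map_deriv_tangent)
    fix C assume "C \<in> TA" and C: "triv (fst q \<otimes> cinv c0 (fst (x0, tau q))) (snd (x0, tau q)) \<in> cdom C"
    then obtain c where c: "c \<in> A" "C = tchart A c" by (blast elim: tchart_cases)
    have gc: "fst q \<in> cdom c" using C q by (simp only: triv_base[OF q] c(2) TG_tchart)
    note p = triv_path[OF q c(1) gc]
    show "\<exists>N. open N \<and> (x0, tau q) \<in> N \<and> (\<forall>y\<in>N. triv (fst q \<otimes> cinv c0 (fst y)) (snd y) \<in> cdom C) \<and>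
        (\<lambda>y. cmap C (triv (fst q \<otimes> cinv c0 (fst y)) (snd y))) differentiable (at (x0, tau q))"
      using p(1-3) trivec_differentiable(1)[OF q c(1) gc] unfolding c(2) by blast
  qed
  then show ?thesis by (simp only: triv_base[OF q])
qed

lemma linear_trivec: "q \<in> TG \<Longrightarrow> linear (\<lambda>h. trivec q h C)"
  unfolding trivec_def
proof (rule T.linear_map_deriv)
  fix C assume q: "q \<in> TG" and "C \<in> TA"
    and C: "triv (fst q \<otimes> cinv c0 (fst (x0, tau q))) (snd (x0, tau q)) \<in> cdom C"
  then obtain c where c: "c \<in> A" "C = tchart A c" by (blast elim: tchart_cases)
  have gc: "fst q \<in> cdom c" using C q by (simp only: triv_base[OF q] c(2) TG_tchart)
  show "(\<lambda>y. cmap C (triv (fst q \<otimes> cinv c0 (fst y)) (snd y))) differentiable (at (x0, tau q))"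
    using trivec_differentiable(1)[OF q c(1) gc] unfolding c(2) .
qed

section \<open>The polarization\<close>

text \<open>The vector \<open>(a(\<xi>)f, f)\<close> of the graph over \<open>E\<^sub>\<complex>\<close> that defines the polarization.\<close>

definition polvec :: "'g \<times> ('g, 'e) tvec \<Rightarrow> 'e \<times> 'e \<Rightarrow> ('g \<times> ('g, 'e) tvec, 'e \<times> 'e) ctvec" where
  "polvec q f = (\<lambda>C. (trivec q (fst (slope (tau q) f), fst f) C, trivec q (snd (slope (tau q) f), snd f) C))"

definition pol :: "'g \<times> ('g, 'e) tvec \<Rightarrow> ('g \<times> ('g, 'e) tvec, 'e \<times> 'e) ctvec set" where
  "pol q = range (polvec q)"

lemma polvec_ctangent: "q \<in> TG \<Longrightarrow> polvec q f \<in> ctangent_space TA q"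
  by (simp add: ctangent_space_def polvec_def o_def trivec_tangent)

lemma linear_polvec: "q \<in> TG \<Longrightarrow> linear (\<lambda>f. polvec q f C)"
proof -
  assume q: "q \<in> TG"
  have l1: "linear (\<lambda>f. (fst (slope (tau q) f), fst f))" "linear (\<lambda>f. (snd (slope (tau q) f), snd f))"
    by (rule linearI; simp add: linear_add[OF linear_slope] linear_scale[OF linear_slope])+
  show ?thesis
    unfolding polvec_def
    using linear_compose[OF l1(1) linear_trivec[OF q]] linear_compose[OF l1(2) linear_trivec[OF q]]
    by (auto simp: linear_iff o_def)
qed

lemma polvec_cscale:
  assumes q: "q \<in> TG"
  shows "polvec q (cscale z f) C = cscale z (polvec q f C)"
proof -
  have "polvec q (cscale \<i> f) C = cscale \<i> (polvec q f C)" for f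
  proof -
    obtain a b where ab: "slope (tau q) f = (a, b)" by (cases "slope (tau q) f")
    have "trivec q (- b, - snd f) C = - trivec q (b, snd f) C"
      using linear_neg[OF linear_trivec[OF q], of "(b, snd f)"] by simp
    then show ?thesis
      unfolding polvec_def slope_ii ab by (cases f) simp
  qed
  then show ?thesis
    by (subst (1 2) cscale_expand) (simp add: linear_add[OF linear_polvec[OF q]] linear_scale[OF linear_polvec[OF q]])
qed

lemma fd_Tmap_inj:
  assumes "c \<in> A" "fst z \<in> cimg c" "fd (Tmap c) z h = 0"
  shows "h = 0"
proof -
  have "fd (Tinv c) (Tmap c z) 0 = 0"
    using assms by (intro linear_0 linear_fd Tinv_differentiable) (auto simp: Tmap_def)
  then show ?thesis using fd_Tinv_Tmap[OF assms(1,2), of h] assms(3) by simp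
qed

text \<open>The fibre component recovers \<open>f\<close>.\<close>

lemma polvec_eq_0:
  assumes q: "q \<in> TG" and 0: "\<And>C. polvec q f C = 0"
  shows "f = 0"
proof -
  obtain c where c: "c \<in> A" "fst q \<in> cdom c" using ex_chart q TG_iff by blast
  have x: "fst (cmap c (fst q), tau q) \<in> cimg c" using c by simp
  have "fst (polvec q f (tchart A c)) = 0" "snd (polvec q f (tchart A c)) = 0"
    by (simp_all add: 0)
  then have "fd (Tmap c) (cmap c (fst q), tau q) (L c (cmap c (fst q)) (fst (slope (tau q) f)), fst f) = 0"
    "fd (Tmap c) (cmap c (fst q), tau q) (L c (cmap c (fst q)) (snd (slope (tau q) f)), snd f) = 0"
    by (simp_all only: polvec_def fst_conv snd_conv trivec_chart[OF q c])
  then have "fst f = 0" "snd f = 0"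
    using fd_Tmap_inj[OF c(1) x] by (simp_all only: zero_prod_def) blast+
  then show ?thesis by (intro prod_eqI) simp_all
qed

lemma smooth_polvec:
  assumes c: "c \<in> A"
  shows "smooth_on (cimg c \<times> UNIV) (\<lambda>z. polvec (cinv (tchart A c) z) f (tchart A c))"
proof -
  let ?O = "cimg c \<times> (UNIV :: 'e set)"
  note op = open_tcimg[OF c]
  have tr: "smooth_on ?O (\<lambda>z. fd (Tmap c) (Tinv c z) (L c (fst z) (X z), \<eta>))" if X: "smooth_on ?O X" for X \<eta>
  proof (rule smooth_on_fd_apply[OF op op _ smooth_Tmap[OF c] smooth_Tinv[OF c]])
    show "Tinv c ` ?O \<subseteq> ?O" by (auto simp: Tinv_def)
    have "smooth_on ?O (\<lambda>z. L c (fst z) (X z))"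
      by (rule smooth_on_linear_family[OF open_cimg[OF c] op _ smooth_L[OF c] linear_L[OF c] _ X])
        (auto simp: smooth_on_bounded_linear bounded_linear_fst)
    then show "smooth_on ?O (\<lambda>z. (L c (fst z) (X z), \<eta>))"
      by (rule smooth_on_Pair[OF op _ smooth_on_const])
  qed
  have sl: "smooth_on ?O (\<lambda>z. slope (snd (Tinv c z)) f)"
    by (rule smooth_on_compose[OF op open_UNIV _ smooth_slope smooth_on_snd[OF op smooth_Tinv[OF c]]]) simp
  have "smooth_on ?O (\<lambda>z. (fd (Tmap c) (Tinv c z) (L c (fst z) (fst (slope (snd (Tinv c z)) f)), fst f),
      fd (Tmap c) (Tinv c z) (L c (fst z) (snd (slope (snd (Tinv c z)) f)), snd f)))"
    by (rule smooth_on_Pair[OF op tr[OF smooth_on_fst[OF op sl]] tr[OF smooth_on_snd[OF op sl]]])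
  then show ?thesis
  proof (rule smooth_on_cong_imp[OF op])
    fix z assume z: "z \<in> ?O"
    let ?q = "cinv (tchart A c) z"
    have zi: "z \<in> cimg (tchart A c)" using z by (simp add: cimg_tchart c)
    have q: "?q \<in> TG" "fst ?q \<in> cdom c"
      using cdom_tchart_TG[OF c cinv_in_cdom[OF zi]] by auto
    have t: "Tinv c z = (cmap c (fst ?q), tau ?q)"
      using Tinv_cmap[OF c q] cmap_cinv[OF zi] by simp
    have "fst z = cmap c (fst ?q)" using t by (simp add: Tinv_def)
    then show "(fd (Tmap c) (Tinv c z) (L c (fst z) (fst (slope (snd (Tinv c z)) f)), fst f),
      fd (Tmap c) (Tinv c z) (L c (fst z) (snd (slope (snd (Tinv c z)) f)), snd f)) = polvec ?q f (tchart A c)"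
      by (simp add: polvec_def trivec_chart[OF q(1) c q(2)] t)
  qed
qed

lemma openin_TG: "openin (atlas_topology TA) TG"
  using topspace_atlas_topology[OF T.chart_inj T.open_cimg] by (metis openin_topspace)

lemma sum_cscale_polvec:
  "q \<in> TG \<Longrightarrow> (\<Sum>i<n. cscale (a i) (polvec q (f i) C)) = polvec q (\<Sum>i<(n::nat). cscale (a i) (f i)) C"
  by (simp add: linear_sum[OF linear_polvec] polvec_cscale)

text \<open>The vectors \<open>polvec q (b, 0)\<close> for a basis of \<open>E\<close> form a global smooth frame.\<close>

lemma pol_subbundle: "smooth_complex_subbundle TA (dim (UNIV :: 'e set)) pol"
proof -
  define n where "n = dim (UNIV :: 'e set)"
  obtain e where e: "bij_betw e {..<n} (onb :: 'e set)"
    using ex_bij_betw_nat_finite[OF finite_onb[where 'a='e]] by (auto simp: n_def dim_onb atLeast0LessThan)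
  have esum: "(\<Sum>i<n. h (e i)) = (\<Sum>b\<in>onb. h b)" for h :: "'e \<Rightarrow> 'e"
    by (rule sum.reindex_bij_betw[OF e])
  have comb: "(\<Sum>i<n. cscale (a i) (e i, 0)) = (\<Sum>i<n. Re (a i) *\<^sub>R e i, \<Sum>i<n. Im (a i) *\<^sub>R e i)" for a
    by (rule prod_eqI) (simp_all add: fst_sum snd_sum cscale_def)
  have coeff: "(\<Sum>i<n. r i *\<^sub>R e i) \<bullet> e j = r j" if "j < n" for r j
  proof -
    have o: "e i \<bullet> e j = (if i = j then 1 else 0)" if "i < n" for i
    proof -
      have "e i \<in> onb" "e j \<in> onb" using e \<open>j < n\<close> \<open>i < n\<close> by (auto simp: bij_betw_def)
      moreover have "e i = e j \<longleftrightarrow> i = j"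
        using e \<open>j < n\<close> \<open>i < n\<close> by (auto simp: bij_betw_def inj_on_eq_iff)
      ultimately show ?thesis by (simp add: inner_onb)
    qed
    have "(\<Sum>i<n. r i *\<^sub>R e i) \<bullet> e j = (\<Sum>i<n. r i * (e i \<bullet> e j))"
      by (simp add: inner_sum_left)
    also have "\<dots> = (\<Sum>i<n. if i = j then r i else 0)"
      by (intro sum.cong refl) (simp add: o)
    also have "\<dots> = r j"
      using \<open>j < n\<close> by simp
    finally show ?thesis .
  qed
  have span: "\<exists>a. f = (\<Sum>i<n. cscale (a i) (e i, 0))" for f :: "'e \<times> 'e"
  proof
    have "(\<Sum>i<n. (y \<bullet> e i) *\<^sub>R e i) = y" for y
      using esum[of "\<lambda>b. (y \<bullet> b) *\<^sub>R b"] onb_expand[of y] by simp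
    then show "f = (\<Sum>i<n. cscale (Complex (fst f \<bullet> e i) (snd f \<bullet> e i)) (e i, 0))"
      by (simp add: comb)
  qed
  have indep: "a i = 0" if "(\<Sum>i<n. cscale (a i) (e i, 0)) = 0" "i < n" for a i
    using that coeff[of i "\<lambda>i. Re (a i)"] coeff[of i "\<lambda>i. Im (a i)"]
    by (simp add: comb zero_prod_def complex_eq_iff)
  show ?thesis
    unfolding smooth_complex_subbundle_def n_def[symmetric]
  proof (intro ballI exI conjI allI impI)
    show "openin (atlas_topology TA) TG" by (rule openin_TG)
    fix i
    show "smooth_section TA (ctangent_space TA) TG (\<lambda>q. polvec q (e i, 0))"
      unfolding smooth_section_def
    proof (intro conjI ballI)
      fix C assume "C \<in> TA"
      then obtain c where c: "c \<in> A" "C = tchart A c" by (blast elim: tchart_cases)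
      have "TG \<inter> cdom C = cdom C"
        using \<open>C \<in> TA\<close> unfolding points_def by blast
      then have "cmap C ` (TG \<inter> cdom C) = cimg c \<times> UNIV"
        using cimg_tchart[OF c(1)] by (simp only: c(2))
      then show "smooth_on (cmap C ` (TG \<inter> cdom C)) (\<lambda>x. polvec (cinv C x) (e i, 0) C)"
        using smooth_polvec[OF c(1)] by (simp add: c(2))
    qed (rule polvec_ctangent)
  next
    fix q assume q: "q \<in> TG"
    have "range (\<lambda>a C. \<Sum>i<n. cscale (a i) (polvec q (e i, 0) C)) = range (\<lambda>a. polvec q (\<Sum>i<n. cscale (a i) (e i, 0)))"
      by (simp add: sum_cscale_polvec[OF q])
    also have "\<dots> = pol q"
      using span by (auto simp: pol_def image_iff) metis
    finally show "pol q = range (\<lambda>a C. \<Sum>i<n. cscale (a i) (polvec q (e i, 0) C))" ..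
    fix a :: "nat \<Rightarrow> complex" and i
    assume 0: "\<forall>C. (\<Sum>i<n. cscale (a i) (polvec q (e i, 0) C)) = 0" and "i < n"
    have "(\<Sum>i<n. cscale (a i) (e i, 0)) = 0"
      by (rule polvec_eq_0[OF q]) (use 0 in \<open>simp only: sum_cscale_polvec[OF q]\<close>)
    then show "a i = 0"
      using indep \<open>i < n\<close> by blast
  qed
qed

end

section \<open>Involutivity\<close>

context manifold_charts
begin

lemma tangent_space_linear_combination:
  assumes "v \<in> tangent_space A p" "w \<in> tangent_space A p"
  shows "(\<lambda>c. r *\<^sub>R v c + s *\<^sub>R w c) \<in> tangent_space A p"
  unfolding tangent_space_def
proof (intro CollectI conjI ballI allI impI)
  fix c d assume c: "c \<in> A" "d \<in> A" "p \<in> cdom c \<inter> cdom d"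
  then have "linear (fd (\<lambda>x. cmap d (cinv c x)) (cmap c p))"
    by (intro linear_fd transition_differentiable) auto
  then show "r *\<^sub>R v d + s *\<^sub>R w d = fd (cmap d \<circ> cinv c) (cmap c p) (r *\<^sub>R v c + s *\<^sub>R w c)"
    using tangent_space_transition[OF assms(1), of c d] tangent_space_transition[OF assms(2), of c d] c
    by (simp add: o_def linear_add linear_scale)
next
  fix c assume "\<not> (c \<in> A \<and> p \<in> cdom c)"
  from tangent_space_zero[OF assms(1) this] tangent_space_zero[OF assms(2) this]
  show "r *\<^sub>R v c + s *\<^sub>R w c = 0" by simp
qed

lemma tangent_space_add: "v \<in> tangent_space A p \<Longrightarrow> w \<in> tangent_space A p \<Longrightarrow> (\<lambda>c. v c + w c) \<in> tangent_space A p"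
  using tangent_space_linear_combination[of v p w 1 1] by simp

lemma tangent_space_diff: "v \<in> tangent_space A p \<Longrightarrow> w \<in> tangent_space A p \<Longrightarrow> (\<lambda>c. v c - w c) \<in> tangent_space A p"
  using tangent_space_linear_combination[of v p w 1 "-1"] by simp

lemma tangent_space_scale: "v \<in> tangent_space A p \<Longrightarrow> (\<lambda>c. r *\<^sub>R v c) \<in> tangent_space A p"
  using tangent_space_linear_combination[of v p v r 0] by simp

lemma tangent_space_0: "(\<lambda>c. 0) \<in> tangent_space A p"
  using map_deriv_tangent[of "\<lambda>x::real. p" 0 0]
  by (auto simp: map_deriv_def o_def cong: if_cong intro: exI[of _ UNIV])

end

context lie_group_chart
begin

lemma trivfield_has_derivative:
  assumes c: "c \<in> A" "x \<in> cimg c" and pr: "bounded_linear pr" and f: "(f has_derivative Df) (at (x, \<xi>))"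
  shows "((\<lambda>w. (L c (fst w) (pr (slope (snd w) (f w))), pr (f w))) has_derivative
    (\<lambda>h. (fd (\<lambda>y. L c y (pr (slope \<xi> (f (x, \<xi>))))) x (fst h)
        + L c x (pr (fd (\<lambda>z. slope z (f (x, \<xi>))) \<xi> (snd h) + slope \<xi> (Df h))), pr (Df h)))) (at (x, \<xi>))"
proof -
  have fst: "(fst has_derivative fst) (at (x, \<xi>))" and snd: "(snd has_derivative snd) (at (x, \<xi>))"
    by (rule bounded_linear_imp_has_derivative[OF bounded_linear_fst]
        bounded_linear_imp_has_derivative[OF bounded_linear_snd])+
  have sd: "(\<lambda>z. slope z b) differentiable (at (snd (x, \<xi>)))" for b
    using smooth_on_differentiable[OF smooth_slope] by simp
  have s1: "((\<lambda>w. slope (snd w) b) has_derivative (\<lambda>h. fd (\<lambda>z. slope z b) \<xi> (snd h))) (at (x, \<xi>))" for b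
    using has_derivative_compose[OF snd fd_has_derivative[OF sd]] by simp
  have sl: "((\<lambda>w. slope (snd w) (f w)) has_derivative
      (\<lambda>h. fd (\<lambda>w. slope (snd w) (f (x, \<xi>))) (x, \<xi>) h + slope (snd (x, \<xi>)) (Df h))) (at (x, \<xi>))"
    by (rule has_derivative_linear_family[where L = "\<lambda>w. slope (snd w)", OF open_UNIV UNIV_I linear_slope _ f])
      (use s1 in \<open>auto simp: differentiable_def\<close>)
  have sl': "((\<lambda>w. pr (slope (snd w) (f w))) has_derivative
      (\<lambda>h. pr (fd (\<lambda>z. slope z (f (x, \<xi>))) \<xi> (snd h) + slope \<xi> (Df h)))) (at (x, \<xi>))"
    using bounded_linear.has_derivative[OF pr sl] by (simp add: fd_eqI[OF s1])
  have xi: "(x, \<xi>) \<in> cimg c \<times> UNIV" using c(2) by (simp add: mem_Times_iff)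
  have ld: "(\<lambda>y. L c y b) differentiable (at (fst (x, \<xi>)))" for b
    using L_differentiable[OF c] by simp
  have l1: "((\<lambda>w. L c (fst w) b) has_derivative (\<lambda>h. fd (\<lambda>y. L c y b) x (fst h))) (at (x, \<xi>))" for b
    using has_derivative_compose[OF fst fd_has_derivative[OF ld]] by simp
  have "((\<lambda>w. L c (fst w) (pr (slope (snd w) (f w)))) has_derivative
    (\<lambda>h. fd (\<lambda>w. L c (fst w) (pr (slope (snd (x, \<xi>)) (f (x, \<xi>))))) (x, \<xi>) h
      + L c (fst (x, \<xi>)) (pr (fd (\<lambda>z. slope z (f (x, \<xi>))) \<xi> (snd h) + slope \<xi> (Df h))))) (at (x, \<xi>))"
    by (rule has_derivative_linear_family[where L = "\<lambda>w. L c (fst w)", OF open_tcimg[OF c(1)] xi linear_L[OF c(1)] _ sl'])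
      (use l1 in \<open>auto simp: differentiable_def\<close>)
  then have "((\<lambda>w. L c (fst w) (pr (slope (snd w) (f w)))) has_derivative
    (\<lambda>h. fd (\<lambda>y. L c y (pr (slope \<xi> (f (x, \<xi>))))) x (fst h)
      + L c x (pr (fd (\<lambda>z. slope z (f (x, \<xi>))) \<xi> (snd h) + slope \<xi> (Df h))))) (at (x, \<xi>))"
    by (simp add: fd_eqI[OF l1])
  from has_derivative_Pair[OF this bounded_linear.has_derivative[OF pr f]] show ?thesis .
qed

text \<open>In trivialized coordinates let two sections of the polarization have fibre components \<open>f\<close> and \<open>k\<close>,
  and let \<open>a\<close>, \<open>b\<close> be their slopes at the point. The fibre component of the complex bracket is the
  complex derivative \<open>l\<close> of \<open>k\<close> along the first section minus that of \<open>f\<close> along the second.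
  The base component is \<open>L\<close> applied to three contributions: \<open>[a, b]\<close> from the left-invariant frame,
  the derivative of the slopes, and the slope of \<open>l\<close>. The first two cancel by \<open>slope_flat\<close>.
  \<open>V\<close> is the real (\<open>pr = fst\<close>) or imaginary (\<open>pr = snd\<close>) part of a section, \<open>R\<close> the bracket of such parts.\<close>

lemma trivfield_bracket:
  assumes c: "c \<in> A" "x \<in> cimg c"
    and f: "f differentiable (at (x, \<xi>))" and k: "k differentiable (at (x, \<xi>))"
  defines "V \<equiv> \<lambda>pr f w. (L c (fst w) (pr (slope (snd w) (f w))), pr (f w) :: 'e)"
  defines "R \<equiv> \<lambda>pr pr'. fd (V pr' k) (x, \<xi>) (V pr f (x, \<xi>)) - fd (V pr f) (x, \<xi>) (V pr' k (x, \<xi>))"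
  shows "\<exists>l. R fst fst - R snd snd = (L c x (fst (slope \<xi> l)), fst l)
    \<and> R fst snd + R snd fst = (L c x (snd (slope \<xi> l)), snd l)"
proof -
  define w where "w = (x, \<xi>)"
  define Df where "Df = fd f w"
  define Dk where "Dk = fd k w"
  define a where "a = slope \<xi> (f w)"
  define b where "b = slope \<xi> (k w)"
  define da where "da = (\<lambda>h. fd (\<lambda>z. slope z (f w)) \<xi> (snd h) + slope \<xi> (Df h))"
  define db where "db = (\<lambda>h. fd (\<lambda>z. slope z (k w)) \<xi> (snd h) + slope \<xi> (Dk h))"
  define Z where "Z = (\<lambda>pr. (L c x (pr a), pr (f w) :: 'e))"
  define W where "W = (\<lambda>pr. (L c x (pr b), pr (k w) :: 'e))"
  note lin = linear_L[OF c]
  have R: "R pr pr' = (L c x (br (pr a) (pr' b) + pr' (db (Z pr)) - pr (da (W pr'))), pr' (Dk (Z pr)) - pr (Df (W pr')))"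
    if pr: "bounded_linear pr" "bounded_linear pr'" for pr pr'
  proof -
    have df: "(f has_derivative Df) (at (x, \<xi>))" and dk: "(k has_derivative Dk) (at (x, \<xi>))"
      using fd_has_derivative[OF f] fd_has_derivative[OF k] by (simp_all add: Df_def Dk_def w_def)
    have "R pr pr' = (fd (\<lambda>y. L c y (pr' b)) x (L c x (pr a)) + L c x (pr' (db (Z pr))), pr' (Dk (Z pr)))
      - (fd (\<lambda>y. L c y (pr a)) x (L c x (pr' b)) + L c x (pr (da (W pr'))), pr (Df (W pr')))"
      unfolding R_def V_def fd_eqI[OF trivfield_has_derivative[OF c pr(1) df]] fd_eqI[OF trivfield_has_derivative[OF c pr(2) dk]]
      by (simp add: Z_def W_def a_def b_def da_def db_def w_def)
    also have "\<dots> = (bracket_at c x (pr a) (pr' b) + L c x (pr' (db (Z pr))) - L c x (pr (da (W pr'))),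
        pr' (Dk (Z pr)) - pr (Df (W pr')))"
      by (simp add: bracket_at_def)
    finally show ?thesis
      by (simp add: bracket_at_eq[OF c] linear_add[OF lin] linear_diff[OF lin])
  qed
  define l where "l = (Dk (Z fst) + cscale \<i> (Dk (Z snd))) - (Df (W fst) + cscale \<i> (Df (W snd)))"
  have fl: "(fd (\<lambda>x. slope x (k w)) \<xi> (fst (f w)) + cscale \<i> (fd (\<lambda>x. slope x (k w)) \<xi> (snd (f w))))
    - (fd (\<lambda>x. slope x (f w)) \<xi> (fst (k w)) + cscale \<i> (fd (\<lambda>x. slope x (f w)) \<xi> (snd (k w)))) + cbr a b = 0"
    unfolding a_def b_def by (rule slope_flat)
  have "slope \<xi> l = (slope \<xi> (Dk (Z fst)) + cscale \<i> (slope \<xi> (Dk (Z snd))))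
      - (slope \<xi> (Df (W fst)) + cscale \<i> (slope \<xi> (Df (W snd))))"
    by (simp add: l_def linear_add[OF linear_slope] linear_diff[OF linear_slope] slope_ii)
  also have "\<dots> = cbr a b + (db (Z fst) + cscale \<i> (db (Z snd))) - (da (W fst) + cscale \<i> (da (W snd)))"
    using fl by (simp add: da_def db_def Z_def W_def linear_add[OF linear_cscale] algebra_simps)
  finally have sl: "slope \<xi> l = cbr a b + (db (Z fst) + cscale \<i> (db (Z snd))) - (da (W fst) + cscale \<i> (da (W snd)))" .
  have ii: "fst (cscale \<i> y) = - snd y" "snd (cscale \<i> y) = fst y" for y :: "'e \<times> 'e"
    by (cases y; simp)+
  have "R fst fst - R snd snd = (L c x (fst (slope \<xi> l)), fst l)"
    unfolding sl unfolding R[OF bounded_linear_fst bounded_linear_fst] R[OF bounded_linear_snd bounded_linear_snd]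
    by (simp add: ii l_def complexify_bracket_def linear_diff[OF lin, symmetric] algebra_simps)
  moreover have "R fst snd + R snd fst = (L c x (snd (slope \<xi> l)), snd l)"
    unfolding sl unfolding R[OF bounded_linear_fst bounded_linear_snd] R[OF bounded_linear_snd bounded_linear_fst]
    by (simp add: ii l_def complexify_bracket_def linear_add[OF lin, symmetric] algebra_simps)
  ultimately show ?thesis by blast
qed

text \<open>\<open>Tmap\<close> relates the coordinate fields of a section to the fields treated by \<open>trivfield_bracket\<close>. Their
  fibre components are read off with the derivative of \<open>Tinv\<close>, hence differentiable. This settles
  the claim in one chart, and naturality of the bracket under coordinate changes carries it to all others.\<close>

lemma pol_involutive: "involutive TA pol"
  unfolding involutive_def
proof (intro allI impI ballI, elim conjE)
  fix U Z W p
  assume U: "openin (atlas_topology TA) U" and Z: "smooth_section TA pol U Z"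
    and W: "smooth_section TA pol U W" and p: "p \<in> U"
  have UTG: "q \<in> TG" if "q \<in> U" for q
    using openin_subset[OF U] that topspace_atlas_topology[OF T.chart_inj T.open_cimg] by auto
  obtain c where c: "c \<in> A" "fst p \<in> cdom c"
    using ex_chart UTG[OF p] TG_iff by blast
  define C where "C = tchart A c"
  have C: "C \<in> TA" "p \<in> cdom C"
    using c UTG[OF p] by (simp_all add: C_def tchart_in TG_tchart)
  define Oc where "Oc = cmap C ` (U \<inter> cdom C)"
  have opO: "open Oc" unfolding Oc_def by (rule openin_subset_chart[OF T.chart_inj U C(1)])
  have Oc: "cinv C z \<in> U" "fst (cinv C z) \<in> cdom c" "cmap C (cinv C z) = z" "fst z \<in> cimg c"
    if "z \<in> Oc" for z
  proof -
    obtain q where q: "q \<in> U" "q \<in> cdom C" "z = cmap C q" using \<open>z \<in> Oc\<close> unfolding Oc_def by blast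
    have e: "cinv C z = q" unfolding q(3) by (rule T.cinv_cmap'[OF C(1) q(2)])
    have g: "fst q \<in> cdom c" using q(2) by (simp add: C_def cdom_tchart)
    show "cinv C z \<in> U" "fst (cinv C z) \<in> cdom c" "cmap C (cinv C z) = z"
      unfolding e by (simp_all only: q(1) g q(3))
    show "fst z \<in> cimg c" using g by (simp add: q(3) C_def cmap_tchart)
  qed
  \<comment> \<open>The domain of the sections in trivialized coordinates, and the fibre component of a section.\<close>
  define S where "S = (cimg c \<times> UNIV) \<inter> Tmap c -` Oc"
  have opS: "open S"
    unfolding S_def by (rule continuous_open_preimage[OF smooth_on_continuous[OF smooth_Tmap[OF c(1)]] open_tcimg[OF c(1)] opO])
  define coef where "coef = (\<lambda>(Y :: 'g \<times> ('g, 'e) tvec \<Rightarrow> ('g \<times> ('g, 'e) tvec, 'e \<times> 'e) ctvec) z.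
    (snd (fd (Tinv c) z (fst (Y (cinv C z) C))), snd (fd (Tinv c) z (snd (Y (cinv C z) C)))))"
  have smY: "smooth_on Oc (\<lambda>z. Y (cinv C z) C)" if "smooth_section TA pol U Y" for Y
    using that C(1) by (simp add: smooth_section_def Oc_def)
  have OT: "Oc \<subseteq> cimg c \<times> UNIV" using Oc(4) by (auto simp: mem_Times_iff)
  have smC: "smooth_on Oc (coef Y)" if Y: "smooth_section TA pol U Y" for Y
  proof -
    have "smooth_on Oc (\<lambda>z. fd (Tinv c) z (h z))" if "smooth_on Oc h" for h
      by (rule smooth_on_fd_apply[OF open_tcimg[OF c(1)] opO _ smooth_Tinv[OF c(1)] smooth_on_ident that]) (use OT in auto)
    then show ?thesis
      unfolding coef_def
      by (intro smooth_on_Pair[OF opO] smooth_on_snd[OF opO]) (auto intro: smooth_on_fst[OF opO smY[OF Y]] smooth_on_snd[OF opO smY[OF Y]])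
  qed
  \<comment> \<open>In trivialized coordinates every section of the polarization is determined by its fibre component.\<close>
  have rel: "fst (Y (cinv C (Tmap c w)) C) = fd (Tmap c) w (L c (fst w) (fst (slope (snd w) (coef Y (Tmap c w)))), fst (coef Y (Tmap c w)))"
    "snd (Y (cinv C (Tmap c w)) C) = fd (Tmap c) w (L c (fst w) (snd (slope (snd w) (coef Y (Tmap c w)))), snd (coef Y (Tmap c w)))"
    if Y: "smooth_section TA pol U Y" and w: "w \<in> S" for Y w
  proof -
    have wO: "Tmap c w \<in> Oc" using w by (simp add: S_def)
    let ?q = "cinv C (Tmap c w)"
    have q: "?q \<in> TG" "fst ?q \<in> cdom c" using Oc[OF wO] UTG by auto
    have fw: "fst w \<in> cimg c" using w by (auto simp: S_def)
    have "Tinv c (cmap C ?q) = (cmap c (fst ?q), tau ?q)"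
      unfolding C_def by (rule Tinv_cmap[OF c(1)]) (use q in \<open>simp_all add: C_def\<close>)
    then have we: "w = (cmap c (fst ?q), tau ?q)"
      using Oc(3)[OF wO] Tinv_Tmap[OF c(1) fw] by simp
    have "Y ?q \<in> pol ?q" using Y Oc(1)[OF wO] by (simp add: smooth_section_def)
    then obtain f where f: "Y ?q = polvec ?q f" by (auto simp: pol_def)
    have v: "fst (Y ?q C) = fd (Tmap c) w (L c (fst w) (fst (slope (snd w) f)), fst f)"
      "snd (Y ?q C) = fd (Tmap c) w (L c (fst w) (snd (slope (snd w) f)), snd f)"
      unfolding f polvec_def fst_conv snd_conv
      using trivec_chart[OF q(1) c(1) q(2)] we by (simp_all only: C_def[symmetric]) (metis fst_conv snd_conv)+
    have "coef Y (Tmap c w) = f"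
      unfolding coef_def v fd_Tinv_Tmap[OF c(1) fw] by simp
    then show "fst (Y (cinv C (Tmap c w)) C) = fd (Tmap c) w (L c (fst w) (fst (slope (snd w) (coef Y (Tmap c w)))), fst (coef Y (Tmap c w)))"
      "snd (Y (cinv C (Tmap c w)) C) = fd (Tmap c) w (L c (fst w) (snd (slope (snd w) (coef Y (Tmap c w)))), snd (coef Y (Tmap c w)))"
      using v by simp_all
  qed
  define w where "w = Tinv c (cmap C p)"
  have we: "w = (cmap c (fst p), tau p)"
    unfolding w_def C_def by (rule Tinv_cmap[OF c(1) UTG[OF p] c(2)])
  have x: "cmap c (fst p) \<in> cimg c" using c by simp
  have pO: "cmap C p \<in> Oc" using p C by (simp add: Oc_def)
  have Tw: "Tmap c w = cmap C p"
    unfolding w_def by (rule Tmap_Tinv[OF c(1) Oc(4)[OF pO]])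
  have wS: "w \<in> S" using pO x by (simp add: S_def Tw we mem_Times_iff) (simp add: we[symmetric] Tw)
  define f where "f = (\<lambda>w. coef Z (Tmap c w))"
  define k where "k = (\<lambda>w. coef W (Tmap c w))"
  have dc: "(\<lambda>w. coef Y (Tmap c w)) differentiable (at w)" if "smooth_section TA pol U Y" for Y
  proof -
    have "coef Y differentiable (at (Tmap c w))"
      unfolding Tw by (rule smooth_on_differentiable[OF smC[OF that] pO])
    moreover have "Tmap c differentiable (at w)"
      using Tmap_differentiable[OF c(1), of w] x by (simp add: we)
    ultimately show ?thesis
      using differentiable_chain_at[of "Tmap c" w "coef Y"] by (simp add: o_def)
  qed
  define V where "V = (\<lambda>pr f w. (L c (fst w) (pr (slope (snd w) (f w))), pr (f w) :: 'e))"
  define R where "R = (\<lambda>pr pr'. fd (V pr' k) w (V pr f w) - fd (V pr f) w (V pr' k w))"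
  have "\<exists>l. R fst fst - R snd snd = (L c (cmap c (fst p)) (fst (slope (tau p) l)), fst l)
    \<and> R fst snd + R snd fst = (L c (cmap c (fst p)) (snd (slope (tau p) l)), snd l)"
    unfolding R_def V_def we
    by (rule trivfield_bracket[OF c(1) x]) (use dc[OF Z] dc[OF W] in \<open>simp_all add: f_def k_def we\<close>)
  then obtain l where l: "R fst fst - R snd snd = (L c (cmap c (fst p)) (fst (slope (tau p) l)), fst l)"
    "R fst snd + R snd fst = (L c (cmap c (fst p)) (snd (slope (tau p) l)), snd l)"
    by blast
  have dV: "V pr (\<lambda>w. coef Y (Tmap c w)) differentiable (at w)" if "smooth_section TA pol U Y" "bounded_linear pr" for Y pr
    unfolding V_def we
    using trivfield_has_derivative[OF c(1) x that(2) fd_has_derivative[OF dc[OF that(1), unfolded we]]]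
    by (auto simp: differentiable_def)
  have dpr: "(\<lambda>z. pr (Y (cinv C z) C)) differentiable (at (cmap C p))"
    if "smooth_section TA pol U Y" "pr = fst \<or> pr = snd" for Y and pr :: "_ \<Rightarrow> 'e \<times> 'e"
    using smooth_on_differentiable[OF smooth_on_fst[OF opO smY[OF that(1)]] pO]
      smooth_on_differentiable[OF smooth_on_snd[OF opO smY[OF that(1)]] pO] that(2) by auto
  have br: "lie_bracket TA (\<lambda>q. pr \<circ> Z q) (\<lambda>q. pr' \<circ> W q) p C = fd (Tmap c) w (R pr0 pr0')"
    if pr: "(pr = fst \<and> pr0 = fst) \<or> (pr = snd \<and> pr0 = snd)" "(pr' = fst \<and> pr0' = fst) \<or> (pr' = snd \<and> pr0' = snd)"
    for pr pr' and pr0 pr0' :: "'e \<times> 'e \<Rightarrow> 'e"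
  proof -
    have bl: "bounded_linear pr0" "bounded_linear pr0'"
      using pr bounded_linear_fst bounded_linear_snd by auto
    have "fd (\<lambda>z. pr' (W (cinv C z) C)) (Tmap c w) (pr (Z (cinv C (Tmap c w)) C))
        - fd (\<lambda>z. pr (Z (cinv C z) C)) (Tmap c w) (pr' (W (cinv C (Tmap c w)) C))
      = fd (Tmap c) w (fd (V pr0' k) w (V pr0 f w) - fd (V pr0 f) w (V pr0' k w))"
    proof (rule related_fields_bracket[OF opS wS])
      show "smooth_on S (Tmap c)" by (rule smooth_on_subset[OF smooth_Tmap[OF c(1)]]) (simp add: S_def)
      show "V pr0 f differentiable (at w)" "V pr0' k differentiable (at w)"
        unfolding f_def k_def using dV[OF Z bl(1)] dV[OF W bl(2)] by auto
      show "(\<lambda>z. pr (Z (cinv C z) C)) differentiable (at (Tmap c w))"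
        "(\<lambda>z. pr' (W (cinv C z) C)) differentiable (at (Tmap c w))"
        unfolding Tw using dpr[OF Z, of pr] dpr[OF W, of pr'] pr by auto
      show "pr (Z (cinv C (Tmap c z)) C) = fd (Tmap c) z (V pr0 f z)" if "z \<in> S" for z
        using rel[OF Z that] pr(1) by (auto simp: V_def f_def)
      show "pr' (W (cinv C (Tmap c z)) C) = fd (Tmap c) z (V pr0' k z)" if "z \<in> S" for z
        using rel[OF W that] pr(2) by (auto simp: V_def k_def)
    qed
    then show ?thesis
      using C by (simp add: lie_bracket_def Tw T.cinv_cmap'[OF C] R_def)
  qed
  have dTC: "(\<lambda>x. (pr \<circ> Y (cinv D x)) D) differentiable (at (cmap D p))"
    if "smooth_section TA pol U Y" "pr = fst \<or> pr = snd" "D \<in> TA" "p \<in> cdom D" for Y D and pr :: "_ \<Rightarrow> 'e \<times> 'e"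
  proof -
    have op: "open (cmap D ` (U \<inter> cdom D))" by (rule openin_subset_chart[OF T.chart_inj U that(3)])
    have sm: "smooth_on (cmap D ` (U \<inter> cdom D)) (\<lambda>x. Y (cinv D x) D)"
      using that(1,3) by (simp add: smooth_section_def)
    have pD: "cmap D p \<in> cmap D ` (U \<inter> cdom D)" using p that(4) by blast
    show ?thesis
      using smooth_on_differentiable[OF smooth_on_fst[OF op sm] pD]
        smooth_on_differentiable[OF smooth_on_snd[OF op sm] pD] that(2) by auto
  qed
  have tY: "pr \<circ> Y q \<in> tangent_space TA q"
    if "smooth_section TA pol U Y" "pr = fst \<or> pr = snd" "q \<in> U" for Y q and pr :: "_ \<Rightarrow> 'e \<times> 'e"
  proof -
    have "Y q \<in> pol q" using that by (simp add: smooth_section_def)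
    then have "Y q \<in> ctangent_space TA q" using polvec_ctangent[OF UTG[OF that(3)]] by (auto simp: pol_def)
    then show ?thesis using that(2) by (auto simp: ctangent_space_def)
  qed
  have bt: "lie_bracket TA (\<lambda>q. pr \<circ> Z q) (\<lambda>q. pr' \<circ> W q) p \<in> tangent_space TA p"
    if "pr = fst \<or> pr = snd" "pr' = fst \<or> pr' = snd" for pr pr'
    by (rule T.lie_bracket_tangent[OF U p tY[OF Z that(1)] tY[OF W that(2)] dTC[OF Z that(1)] dTC[OF W that(2)]])
  have wx: "fst w \<in> cimg c" using x by (simp add: we)
  note linT = linear_fd[OF Tmap_differentiable[OF c(1) wx]]
  have "clie_bracket TA Z W p C = polvec p l C"
    unfolding clie_bracket_def Let_def polvec_def trivec_chart[OF UTG[OF p] c, folded C_def] fst_conv snd_conv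
      l[symmetric] we[symmetric]
    by (simp add: br[of fst fst fst fst] br[of snd snd snd snd] br[of fst fst snd snd] br[of snd snd fst fst]
        linear_add[OF linT] linear_diff[OF linT])
  then have e: "fst (clie_bracket TA Z W p C) = fst (polvec p l C)" "snd (clie_bracket TA Z W p C) = snd (polvec p l C)"
    by simp_all
  \<comment> \<open>Both sides are complex tangent vectors at \<open>p\<close>, so agreement in the chart \<open>C\<close> suffices.\<close>
  have 1: "fst \<circ> clie_bracket TA Z W p \<in> tangent_space TA p"
    unfolding clie_bracket_def Let_def o_def[of fst "\<lambda>c. (_ c, _ c)"] fst_conv
    by (intro T.tangent_space_diff bt) auto
  have 2: "snd \<circ> clie_bracket TA Z W p \<in> tangent_space TA p"
    unfolding clie_bracket_def Let_def o_def[of snd "\<lambda>c. (_ c, _ c)"] snd_conv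
    by (intro T.tangent_space_add bt) auto
  have pt: "fst \<circ> polvec p l \<in> tangent_space TA p" "snd \<circ> polvec p l \<in> tangent_space TA p"
    using polvec_ctangent[OF UTG[OF p], of l] by (auto simp: ctangent_space_def)
  have "fst \<circ> clie_bracket TA Z W p = fst \<circ> polvec p l"
    by (rule T.tangent_space_eqI[OF 1 pt(1) C]) (simp add: e)
  moreover have "snd \<circ> clie_bracket TA Z W p = snd \<circ> polvec p l"
    by (rule T.tangent_space_eqI[OF 2 pt(2) C]) (simp add: e)
  ultimately have "clie_bracket TA Z W p = polvec p l"
    by (metis (no_types, lifting) comp_apply ext prod_eqI)
  then show "clie_bracket TA Z W p \<in> pol p"
    by (simp add: pol_def)
qed

lemma pol_polarization: "polarization TA pol"
  unfolding polarization_def using pol_subbundle pol_involutive dim_prod_self[where 'a='e] by metis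

end

section \<open>Geodesics of the canonical connection\<close>

lemma open_atlas_chart:
  "cdom (I, \<lambda>x. x) = I" "cimg (I, \<lambda>x. x) = I" "t \<in> I \<Longrightarrow> cinv (I, \<lambda>x. x) t = t"
  using inv_into_f_f[of "\<lambda>x. x" I t] by (auto simp: cinv_def)

context lie_group_chart
begin

lemma linear_lfield: "g \<in> carrier G \<Longrightarrow> linear (\<lambda>\<zeta>. lfield \<zeta> g c)"
  unfolding lfield_def
proof (rule linear_map_deriv)
  fix c assume g: "g \<in> carrier G" and c: "c \<in> A" "g \<otimes> cinv c0 x0 \<in> cdom c"
  then have "g \<in> cdom c" by (simp add: x0)
  then show "(\<lambda>y. cmap c (g \<otimes> cinv c0 y)) differentiable (at x0)"
    using ltrans_differentiable[OF g c(1) c0(1) x0_ltrans_dom[OF c(1)]] by (simp add: ltrans_def[abs_def])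
qed

lemma lfield_bracket:
  assumes "c \<in> A" "g \<in> cdom c"
  shows "lie_bracket A (lfield v) (lfield w) g c = L c (cmap c g) (br v w)"
  using bracket_at_eq[OF assms(1), of "cmap c g" v w] assms
  by (simp add: lie_bracket_def bracket_at_def L_def[symmetric] lfield_L)

text \<open>The Maurer-Cartan form applied to the velocity.\<close>

definition body_velocity :: "(real \<Rightarrow> 'g) \<Rightarrow> real \<Rightarrow> 'e" where
  "body_velocity \<gamma> t = (SOME \<zeta>. velocity A \<gamma> t = lfield \<zeta> (\<gamma> t))"

lemma smooth_vector_field_lfield: "smooth_vector_field A (lfield \<zeta>)"
  using left_invariant_lfield by (simp add: left_invariant_field_def)

context
  fixes I \<gamma>
  assumes curve: "smooth_curve A I \<gamma>"
begin

lemma open_I: "open I"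
  using curve by (simp add: smooth_curve_def)

lemma curve_chart:
  assumes "c \<in> A"
  shows "open (I \<inter> \<gamma> -` cdom c)" "smooth_on (I \<inter> \<gamma> -` cdom c) (\<lambda>t. cmap c (\<gamma> t))"
proof -
  let ?C = "(I, \<lambda>x. x) :: (real, real) chart"
  have eq: "{x \<in> cimg ?C. \<gamma> (cinv ?C x) \<in> cdom c} = I \<inter> \<gamma> -` cdom c"
    by (auto simp: open_atlas_chart(3))
  have sm: "smooth_map (open_atlas I) A \<gamma>" using curve by (simp add: smooth_curve_def)
  have C: "?C \<in> open_atlas I" by (simp add: open_atlas_def)
  note l = smooth_map_local[OF _ _ manifold sm C assms, unfolded eq]
  show op: "open (I \<inter> \<gamma> -` cdom c)"
    by (rule l(1)) (auto simp: open_atlas_def open_I)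
  have "smooth_on (I \<inter> \<gamma> -` cdom c) (\<lambda>x. cmap c (\<gamma> (cinv ?C x)))"
    by (rule l(2)) (auto simp: open_atlas_def open_I)
  then show "smooth_on (I \<inter> \<gamma> -` cdom c) (\<lambda>t. cmap c (\<gamma> t))"
    by (rule smooth_on_cong_imp[OF op]) (simp add: open_atlas_chart(3))
qed

lemma curve_carrier: "t \<in> I \<Longrightarrow> \<gamma> t \<in> carrier G"
proof -
  assume t: "t \<in> I"
  have "topspace (atlas_topology (open_atlas I)) = points (open_atlas I)"
    by (rule topspace_atlas_topology) (auto simp: open_atlas_def open_I)
  then have "t \<in> topspace (atlas_topology (open_atlas I))"
    using t by (simp add: points_def open_atlas_def)
  moreover have "continuous_map (atlas_topology (open_atlas I)) (atlas_topology A) \<gamma>"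
    using curve by (simp add: smooth_curve_def smooth_map_def)
  ultimately have "\<gamma> t \<in> topspace (atlas_topology A)"
    by (auto simp: continuous_map_def)
  then show ?thesis
    using topspace_atlas_topology[OF chart_inj open_cimg] by (simp add: points_eq)
qed

lemma curve_differentiable:
  "c \<in> A \<Longrightarrow> t \<in> I \<Longrightarrow> \<gamma> t \<in> cdom c \<Longrightarrow> (\<lambda>t. cmap c (\<gamma> t)) differentiable (at t)"
  by (rule smooth_on_differentiable[OF curve_chart(2)]) auto

lemma velocity_chart: "c \<in> A \<Longrightarrow> \<gamma> t \<in> cdom c \<Longrightarrow> velocity A \<gamma> t c = fd (\<lambda>t. cmap c (\<gamma> t)) t 1"
  by (simp add: velocity_def map_deriv_def o_def)

lemma velocity_tangent: "t \<in> I \<Longrightarrow> velocity A \<gamma> t \<in> tangent_space A (\<gamma> t)"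
  unfolding velocity_def
proof (rule map_deriv_tangent)
  fix c assume t: "t \<in> I" and c: "c \<in> A" "\<gamma> t \<in> cdom c"
  then show "\<exists>N. open N \<and> t \<in> N \<and> (\<forall>y\<in>N. \<gamma> y \<in> cdom c) \<and> (\<lambda>y. cmap c (\<gamma> y)) differentiable (at t)"
    using curve_chart(1)[OF c(1)] curve_differentiable[OF c(1) t c(2)]
    by (intro exI[of _ "I \<inter> \<gamma> -` cdom c"]) auto
qed

lemma velocity_eq_lfield: "t \<in> I \<Longrightarrow> velocity A \<gamma> t = lfield (body_velocity \<gamma> t) (\<gamma> t)"
  unfolding body_velocity_def by (rule someI_ex) (rule ex_lfield[OF curve_carrier velocity_tangent])

lemma body_velocity_chart: "t \<in> I \<Longrightarrow> c \<in> A \<Longrightarrow> \<gamma> t \<in> cdom c \<Longrightarrow>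
    body_velocity \<gamma> t = M c (cmap c (\<gamma> t)) (fd (\<lambda>t. cmap c (\<gamma> t)) t 1)"
  using M_L[of c "cmap c (\<gamma> t)" "body_velocity \<gamma> t"] velocity_chart[of c t] velocity_eq_lfield[of t]
  by (simp add: lfield_L)

lemma smooth_body_velocity: "smooth_on I (body_velocity \<gamma>)"
proof (rule smooth_on_local)
  fix t assume t: "t \<in> I"
  obtain c where c: "c \<in> A" "\<gamma> t \<in> cdom c" using ex_chart curve_carrier t by blast
  let ?J = "I \<inter> \<gamma> -` cdom c"
  have "smooth_on ?J (\<lambda>t. M c (cmap c (\<gamma> t)) (fd (\<lambda>t. cmap c (\<gamma> t)) t 1))"
    by (rule smooth_on_linear_family[OF open_cimg[OF c(1)] curve_chart(1)[OF c(1)] _ smooth_M[OF c(1)]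
          linear_M[OF c(1)] curve_chart(2)[OF c(1)] smooth_on_fd[OF curve_chart(2)[OF c(1)]]]) auto
  then have "smooth_on ?J (body_velocity \<gamma>)"
    by (rule smooth_on_cong_imp[OF curve_chart(1)[OF c(1)]]) (rule body_velocity_chart[symmetric]; use c in simp)
  then show "\<exists>T. open T \<and> t \<in> T \<and> smooth_on T (body_velocity \<gamma>)"
    using curve_chart(1)[OF c(1)] t c by (intro exI[of _ ?J]) auto
qed

lemma field_along_velocity: "field_along A I \<gamma> (velocity A \<gamma>)"
  unfolding field_along_def
proof (intro conjI ballI)
  fix c assume c: "c \<in> A"
  have "smooth_on (I \<inter> \<gamma> -` cdom c) (\<lambda>t. fd (\<lambda>t. cmap c (\<gamma> t)) t 1)"
    by (rule smooth_on_fd[OF curve_chart(2)[OF c]])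
  then show "smooth_on (I \<inter> \<gamma> -` cdom c) (\<lambda>t. velocity A \<gamma> t c)"
    by (rule smooth_on_cong_imp[OF curve_chart(1)[OF c]]) (simp add: velocity_chart c)
qed (rule velocity_tangent)

lemma field_along_lfield: "field_along A I \<gamma> (\<lambda>t. lfield \<zeta> (\<gamma> t))"
  unfolding field_along_def
proof (intro conjI ballI)
  fix c assume c: "c \<in> A"
  have "smooth_on (I \<inter> \<gamma> -` cdom c) (\<lambda>t. L c (cmap c (\<gamma> t)) \<zeta>)"
    by (rule smooth_on_compose[OF curve_chart(1)[OF c] open_cimg[OF c] _ smooth_L[OF c] curve_chart(2)[OF c]]) auto
  then show "smooth_on (I \<inter> \<gamma> -` cdom c) (\<lambda>t. lfield \<zeta> (\<gamma> t) c)"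
    by (rule smooth_on_cong_imp[OF curve_chart(1)[OF c]]) (simp add: lfield_L c)
qed (rule lfield_tangent[OF curve_carrier])

lemma field_along_scale:
  assumes "smooth_on I f" "field_along A I \<gamma> V"
  shows "field_along A I \<gamma> (\<lambda>t c. f t *\<^sub>R V t c)"
  using assms unfolding field_along_def
  by (auto intro!: tangent_space_scale smooth_on_scaleR curve_chart(1) smooth_on_subset[OF assms(1)])

lemma field_along_add:
  assumes "field_along A I \<gamma> V" "field_along A I \<gamma> W"
  shows "field_along A I \<gamma> (\<lambda>t c. V t c + W t c)"
  using assms unfolding field_along_def
  by (auto intro!: tangent_space_add smooth_on_add curve_chart(1))

lemma field_along_0: "field_along A I \<gamma> (\<lambda>t c. 0)"
  unfolding field_along_def by (auto intro: tangent_space_0)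

lemma field_along_sum:
  assumes "finite B" "\<And>b. b \<in> B \<Longrightarrow> field_along A I \<gamma> (V b)"
  shows "field_along A I \<gamma> (\<lambda>t c. \<Sum>b\<in>B. V b t c)"
  using assms by (induction B rule: finite_induct) (auto intro: field_along_0 field_along_add)

text \<open>A covariant derivative along \<open>\<gamma>\<close> acts on functions defined on the whole line. Multiplication by the
  indicator of \<open>I\<close>, which is the constant \<open>1\<close> as a smooth function on \<open>I\<close>, erases their values outside \<open>I\<close>.\<close>

lemma covariant_derivative_local:
  assumes D: "covariant_derivative_along A N I \<gamma> D"
    and V: "field_along A I \<gamma> V" and W: "field_along A I \<gamma> W"
    and eq: "\<And>s. s \<in> I \<Longrightarrow> V s = W s" and t: "t \<in> I"
  shows "D V t = D W t"
proof -
  define u :: "real \<Rightarrow> real" where "u = (\<lambda>s. if s \<in> I then 1 else 0)"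
  have sm: "smooth_on I u"
    by (rule smooth_on_cong_imp[OF open_I smooth_on_const[of I 1]]) (simp add: u_def)
  have "(u has_field_derivative 0) (at t)"
    by (rule has_field_derivative_transform_within_open[OF DERIV_const[of 1] open_I t]) (simp add: u_def)
  then have d: "deriv u t = 0" by (rule DERIV_imp_deriv)
  have k: "D (\<lambda>s c. u s *\<^sub>R Y s c) t = D Y t" if "field_along A I \<gamma> Y" for Y
    using D sm that t d unfolding covariant_derivative_along_def by (simp add: u_def)
  have "(\<lambda>s c. u s *\<^sub>R V s c) = (\<lambda>s c. u s *\<^sub>R W s c)"
    using eq by (auto simp: u_def fun_eq_iff)
  then show ?thesis
    unfolding k[OF V, symmetric] k[OF W, symmetric] by (rule arg_cong)
qed

lemma covariant_derivative_sum:
  assumes D: "covariant_derivative_along A N I \<gamma> D"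
    and "finite B" and f: "\<And>b. b \<in> B \<Longrightarrow> smooth_on I (f b)" and V: "\<And>b. b \<in> B \<Longrightarrow> field_along A I \<gamma> (V b)" and t: "t \<in> I"
  shows "D (\<lambda>s c. \<Sum>b\<in>B. f b s *\<^sub>R V b s c) t = (\<lambda>c. \<Sum>b\<in>B. deriv (f b) t *\<^sub>R V b t c + f b t *\<^sub>R D (V b) t c)"
  using assms(2) f V
proof (induction B rule: finite_induct)
  \<comment> \<open>The zero field is \<open>0\<close> times any field along the curve.\<close>
  case empty
  have scale: "\<And>f V t. smooth_on I f \<Longrightarrow> field_along A I \<gamma> V \<Longrightarrow> t \<in> I \<Longrightarrow>
      D (\<lambda>s c. f s *\<^sub>R V s c) t = (\<lambda>c. deriv f t *\<^sub>R V t c + f t *\<^sub>R D V t c)"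
    using D unfolding covariant_derivative_along_def by blast
  show ?case
    using scale[OF smooth_on_const[of I 0] field_along_velocity t] by simp
next
  case (insert b B)
  have scale: "D (\<lambda>s c. f b s *\<^sub>R V b s c) t = (\<lambda>c. deriv (f b) t *\<^sub>R V b t c + f b t *\<^sub>R D (V b) t c)"
    using D insert.prems[of b] t unfolding covariant_derivative_along_def by blast
  have add: "\<And>V W. field_along A I \<gamma> V \<Longrightarrow> field_along A I \<gamma> W \<Longrightarrow>
      D (\<lambda>s c. V s c + W s c) t = (\<lambda>c. D V t c + D W t c)"
    using D t unfolding covariant_derivative_along_def by blast
  have "D (\<lambda>s c. f b s *\<^sub>R V b s c + (\<Sum>b\<in>B. f b s *\<^sub>R V b s c)) t
      = (\<lambda>c. D (\<lambda>s c. f b s *\<^sub>R V b s c) t c + D (\<lambda>s c. \<Sum>b\<in>B. f b s *\<^sub>R V b s c) t c)"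
    by (rule add) (auto intro!: field_along_scale field_along_sum insert)
  then show ?case
    using insert by (simp add: scale)
qed

text \<open>Expand the velocity \<open>X\<close> in a left-invariant frame. The covariant derivatives of the frame fields
  contribute \<open>\<nabla>\<^sub>XX = [X, X] / 2 = 0\<close>, so only the derivatives of the coefficients remain.\<close>

lemma geodesic_body_velocity_deriv:
  assumes can: "canonical_connection G A N" and D: "covariant_derivative_along A N I \<gamma> D"
    and D0: "D (velocity A \<gamma>) t = (\<lambda>c. 0)" and t: "t \<in> I" and b: "b \<in> onb"
  shows "deriv (\<lambda>s. body_velocity \<gamma> s \<bullet> b) t = 0"
proof -
  obtain c where c: "c \<in> A" "\<gamma> t \<in> cdom c" using ex_chart curve_carrier t by blast
  let ?x = "cmap c (\<gamma> t)" let ?f = "\<lambda>b s. body_velocity \<gamma> s \<bullet> b"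
  have x: "?x \<in> cimg c" using c by simp
  note lin = linear_L[OF c(1) x]
  have smf: "smooth_on I (?f b)" for b by (rule smooth_on_inner_const[OF open_I smooth_body_velocity])
  have DX: "D (\<lambda>s. lfield b (\<gamma> s)) t c = (1/2) *\<^sub>R L c ?x (br (body_velocity \<gamma> t) b)" for b
  proof -
    have "D (\<lambda>s. lfield b (\<gamma> s)) t = N (lfield (body_velocity \<gamma> t)) (lfield b) (\<gamma> t)"
      using D t velocity_eq_lfield[OF t] smooth_vector_field_lfield unfolding covariant_derivative_along_def by metis
    also have "\<dots> = (\<lambda>c. (1/2) *\<^sub>R lie_bracket A (lfield (body_velocity \<gamma> t)) (lfield b) (\<gamma> t) c)"
      using can left_invariant_lfield curve_carrier[OF t] unfolding canonical_connection_def points_eq by blast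
    finally show ?thesis by (simp add: lfield_bracket c)
  qed
  have "D (velocity A \<gamma>) t = D (\<lambda>s c. \<Sum>b\<in>onb. ?f b s *\<^sub>R lfield b (\<gamma> s) c) t"
  proof (rule covariant_derivative_local[OF D field_along_velocity])
    show "field_along A I \<gamma> (\<lambda>s c. \<Sum>b\<in>onb. ?f b s *\<^sub>R lfield b (\<gamma> s) c)"
      by (intro field_along_sum field_along_scale smf field_along_lfield) simp
    show "velocity A \<gamma> s = (\<lambda>c. \<Sum>b\<in>onb. ?f b s *\<^sub>R lfield b (\<gamma> s) c)" if "s \<in> I" for s
      unfolding velocity_eq_lfield[OF that] by (rule ext) (rule linear_onb[OF linear_lfield[OF curve_carrier[OF that]]])
  qed (rule t)
  also have "\<dots> = (\<lambda>c. \<Sum>b\<in>onb. deriv (?f b) t *\<^sub>R lfield b (\<gamma> t) c + ?f b t *\<^sub>R D (\<lambda>s. lfield b (\<gamma> s)) t c)"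
    by (rule covariant_derivative_sum[OF D finite_onb smf field_along_lfield t])
  finally have e: "D (velocity A \<gamma>) t = (\<lambda>c. \<Sum>b\<in>onb. deriv (?f b) t *\<^sub>R lfield b (\<gamma> t) c
      + ?f b t *\<^sub>R D (\<lambda>s. lfield b (\<gamma> s)) t c)" .
  have "0 = (\<Sum>b\<in>onb. deriv (?f b) t *\<^sub>R L c ?x b + ?f b t *\<^sub>R (1/2) *\<^sub>R L c ?x (br (body_velocity \<gamma> t) b))"
    using fun_cong[OF e, of c] by (simp add: D0 DX lfield_L c)
  also have "\<dots> = L c ?x (\<Sum>b\<in>onb. deriv (?f b) t *\<^sub>R b) + (1/2) *\<^sub>R L c ?x (\<Sum>b\<in>onb. ?f b t *\<^sub>R br (body_velocity \<gamma> t) b)"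
    by (simp add: sum.distrib linear_sum[OF lin] linear_scale[OF lin] scaleR_sum_right)
  also have "(\<Sum>b\<in>onb. ?f b t *\<^sub>R br (body_velocity \<gamma> t) b) = br (body_velocity \<gamma> t) (body_velocity \<gamma> t)"
    by (rule linear_onb[OF bounded_linear.linear[OF b.bounded_linear_right], symmetric])
  finally have "L c ?x (\<Sum>b\<in>onb. deriv (?f b) t *\<^sub>R b) = 0"
    by (simp add: linear_0[OF lin])
  then have "(\<Sum>b\<in>onb. deriv (?f b) t *\<^sub>R b) = 0"
    using M_L[OF c(1) x, of "\<Sum>b\<in>onb. deriv (?f b) t *\<^sub>R b"] linear_0[OF linear_M[OF c(1) x]] by simp
  then have "(\<Sum>b'\<in>onb. deriv (?f b') t *\<^sub>R b') \<bullet> b = 0" by simp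
  moreover have "(\<Sum>b'\<in>onb. deriv (?f b') t *\<^sub>R b') \<bullet> b = (\<Sum>b'\<in>onb. if b' = b then deriv (?f b') t else 0)"
    unfolding inner_sum_left by (intro sum.cong refl) (simp add: inner_onb b)
  ultimately show ?thesis using b by simp
qed

end

lemma geodesic_left_invariant:
  assumes "canonical_connection G A N" "geodesic A N I \<gamma>"
  shows "\<exists>X. \<forall>t\<in>I. velocity A \<gamma> t = lfield X (\<gamma> t)"
proof -
  have curve: "smooth_curve A I \<gamma>" using assms(2) by (simp add: geodesic_def)
  obtain D where D: "covariant_derivative_along A N I \<gamma> D" "\<And>t. t \<in> I \<Longrightarrow> D (velocity A \<gamma>) t = (\<lambda>c. 0)"
    using assms(2) unfolding geodesic_def by blast
  have conv: "convex I" using curve by (simp add: smooth_curve_def is_interval_convex)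
  have "\<exists>k. \<forall>t\<in>I. body_velocity \<gamma> t \<bullet> b = k" if b: "b \<in> onb" for b
  proof (rule has_field_derivative_zero_constant[OF conv])
    fix t assume t: "t \<in> I"
    have "(\<lambda>s. body_velocity \<gamma> s \<bullet> b) differentiable (at t)"
      by (rule smooth_on_differentiable[OF smooth_on_inner_const[OF open_I[OF curve] smooth_body_velocity[OF curve]] t])
    then have "((\<lambda>s. body_velocity \<gamma> s \<bullet> b) has_field_derivative deriv (\<lambda>s. body_velocity \<gamma> s \<bullet> b) t) (at t)"
      by (simp add: DERIV_deriv_iff_real_differentiable)
    then show "((\<lambda>s. body_velocity \<gamma> s \<bullet> b) has_field_derivative 0) (at t within I)"
      using geodesic_body_velocity_deriv[OF curve assms(1) D(1) D(2)[OF t] t b] by (simp add: has_field_derivative_at_within)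
  qed
  then obtain k where k: "\<And>b t. b \<in> onb \<Longrightarrow> t \<in> I \<Longrightarrow> body_velocity \<gamma> t \<bullet> b = k b"
    by metis
  have "body_velocity \<gamma> t = (\<Sum>b\<in>onb. k b *\<^sub>R b)" if "t \<in> I" for t
    using onb_expand[of "body_velocity \<gamma> t"] k that by simp
  then have "velocity A \<gamma> t = lfield (\<Sum>b\<in>onb. k b *\<^sub>R b) (\<gamma> t)" if "t \<in> I" for t
    using velocity_eq_lfield[OF curve that] that by simp
  then show ?thesis by blast
qed

text \<open>In the trivialization \<open>Omega\<close> is \<open>(\<gamma>(Re z), Im z X)\<close>, and \<open>\<gamma>\<close> moves along the left-invariant field \<open>X\<close>.\<close>

lemma Omega_deriv:
  assumes curve: "smooth_curve A I \<gamma>" and X: "\<And>t. t \<in> I \<Longrightarrow> velocity A \<gamma> t = lfield X (\<gamma> t)"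
    and z: "Re z \<in> I"
  shows "Omega A \<gamma> z = triv (\<gamma> (Re z)) (Im z *\<^sub>R X)"
    and "map_deriv TA (Omega A \<gamma>) z h = trivec (Omega A \<gamma> z) (Re h *\<^sub>R X, Im h *\<^sub>R X)"
proof -
  have Om: "Omega A \<gamma> w = triv (\<gamma> (Re w)) (Im w *\<^sub>R X)" if "Re w \<in> I" for w
    using that by (simp add: Omega_def triv_def X fun_eq_iff linear_scale[OF linear_lfield[OF curve_carrier[OF curve that]]])
  show Oz: "Omega A \<gamma> z = triv (\<gamma> (Re z)) (Im z *\<^sub>R X)" by (rule Om[OF z])
  define q where "q = Omega A \<gamma> z"
  have q: "q \<in> TG" "fst q = \<gamma> (Re z)"
    using triv_TG[OF curve_carrier[OF curve z]] Oz by (simp_all add: q_def) (simp add: triv_def)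
  have tau: "tau q = Im z *\<^sub>R X"
  proof -
    obtain c where c: "c \<in> A" "\<gamma> (Re z) \<in> cdom c" using ex_chart curve_carrier[OF curve z] by blast
    have "Tmap c (cmap c (\<gamma> (Re z)), tau q) = Tmap c (cmap c (\<gamma> (Re z)), Im z *\<^sub>R X)"
      using cmap_tau[OF c(1) q(1)] cmap_triv[OF c, of "Im z *\<^sub>R X"] c q Oz by (simp add: q_def)
    then show ?thesis
      using Tinv_Tmap[OF c(1), of "(cmap c (\<gamma> (Re z)), _)"] c by (metis fst_conv imageI prod.inject)
  qed
  show "map_deriv TA (Omega A \<gamma>) z h = trivec q (Re h *\<^sub>R X, Im h *\<^sub>R X)"
  proof
    fix C
    show "map_deriv TA (Omega A \<gamma>) z h C = trivec q (Re h *\<^sub>R X, Im h *\<^sub>R X) C"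
    proof (cases "C \<in> TA \<and> q \<in> cdom C")
      case False
      then show ?thesis
        using T.tangent_space_zero[OF trivec_tangent[OF q(1)] False] by (auto simp: map_deriv_def q_def)
    next
      case True
      then obtain c where c: "c \<in> A" "C = tchart A c" by (blast elim: tchart_cases)
      have g: "\<gamma> (Re z) \<in> cdom c" using True q by (simp add: c(2) cdom_tchart)
      let ?J = "I \<inter> \<gamma> -` cdom c" let ?N = "Re -` ?J"
      have opN: "open ?N" by (rule open_vimage[OF curve_chart(1)[OF curve c(1)]]) (intro continuous_intros)
      have zN: "z \<in> ?N" using z g by simp
      let ?H = "\<lambda>w. (cmap c (\<gamma> (Re w)), Im w *\<^sub>R X)"
      have d1: "((\<lambda>t. cmap c (\<gamma> t)) has_derivative fd (\<lambda>t. cmap c (\<gamma> t)) (Re z)) (at (Re z))"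
        by (rule fd_has_derivative[OF curve_differentiable[OF curve c(1) z g]])
      have re: "(Re has_derivative Re) (at z)" and im: "(Im has_derivative Im) (at z)"
        by (rule bounded_linear_imp_has_derivative[OF bounded_linear_Re] bounded_linear_imp_has_derivative[OF bounded_linear_Im])+
      have v: "fd (\<lambda>t. cmap c (\<gamma> t)) (Re z) (Re h) = L c (cmap c (\<gamma> (Re z))) (Re h *\<^sub>R X)" for h
      proof -
        have "fd (\<lambda>t. cmap c (\<gamma> t)) (Re z) (Re h *\<^sub>R 1) = Re h *\<^sub>R fd (\<lambda>t. cmap c (\<gamma> t)) (Re z) 1"
          by (rule linear_scale[OF has_derivative_linear[OF d1]])
        also have "fd (\<lambda>t. cmap c (\<gamma> t)) (Re z) 1 = L c (cmap c (\<gamma> (Re z))) X"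
          using velocity_chart[OF curve c(1) g] X[OF z] by (simp add: lfield_L c(1) g)
        finally show ?thesis
          using g by (simp add: linear_scale[OF linear_L[OF c(1)]])
      qed
      have dH: "(?H has_derivative (\<lambda>h. (L c (cmap c (\<gamma> (Re z))) (Re h *\<^sub>R X), Im h *\<^sub>R X))) (at z)"
        using has_derivative_Pair[OF has_derivative_compose[OF re d1] has_derivative_scaleR_left[OF im, of X]]
        by (simp add: v)
      have dT: "(Tmap c has_derivative fd (Tmap c) (?H z)) (at (?H z))"
        by (rule fd_has_derivative[OF Tmap_differentiable[OF c(1)]]) (use g in simp)
      have "((\<lambda>w. cmap C (Omega A \<gamma> w)) has_derivative
          (\<lambda>h. fd (Tmap c) (?H z) (L c (cmap c (\<gamma> (Re z))) (Re h *\<^sub>R X), Im h *\<^sub>R X))) (at z)"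
      proof (rule has_derivative_cong_open[OF opN zN, THEN iffD2, rotated])
        show "((\<lambda>w. Tmap c (?H w)) has_derivative
          (\<lambda>h. fd (Tmap c) (?H z) (L c (cmap c (\<gamma> (Re z))) (Re h *\<^sub>R X), Im h *\<^sub>R X))) (at z)"
          by (rule has_derivative_compose[OF dH dT])
        show "cmap C (Omega A \<gamma> w) = Tmap c (?H w)" if "w \<in> ?N" for w
          using that Om[of w] by (simp add: c(2) cmap_triv[OF c(1)])
      qed
      then show ?thesis
        using True g trivec_chart[OF q(1) c(1), of "(Re h *\<^sub>R X, Im h *\<^sub>R X)"]
        by (simp add: map_deriv_def o_def fd_eqI q_def[symmetric] q(2) tau c(2)[symmetric])
    qed
  qed
qed

text \<open>An element of \<open>T\<^sup>1\<^sup>,\<^sup>0\<close> has the form \<open>(a, -\<i>a)\<close>, and its image under \<open>Omega\<close> has complex fibre component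
  \<open>f = (Im a X, - Re a X)\<close> and base component \<open>\<i>f\<close>. As \<open>f\<close> commutes with the base point \<open>Im z X\<close> of the
  fibre, \<open>\<i>f\<close> is its slope.\<close>

theorem pol_ac_polarization:
  assumes "canonical_connection G A N"
  shows "ac_polarization A N pol"
  unfolding ac_polarization_def
proof (intro conjI ballI allI impI)
  show "polarization TA pol" by (rule pol_polarization)
  fix v I \<gamma> z and ab :: "complex \<times> complex"
  assume "maximal_geodesic A N v I \<gamma>" and "z \<in> complex_strip I" and "ab \<in> T10"
  then have geo: "geodesic A N I \<gamma>" and z: "Re z \<in> I"
    by (auto simp: maximal_geodesic_def complex_strip_def)
  then have curve: "smooth_curve A I \<gamma>" by (simp add: geodesic_def)
  obtain X where X: "\<And>t. t \<in> I \<Longrightarrow> velocity A \<gamma> t = lfield X (\<gamma> t)"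
    using geodesic_left_invariant[OF assms geo] by blast
  obtain a b where ab: "ab = (a, b)" by (cases ab)
  have "\<i> * a = - b" using \<open>ab \<in> T10\<close> by (simp add: T10_def ab)
  then have b: "Re b = Im a" "Im b = - Re a"
    by (simp_all add: complex_eq_iff)
  let ?q = "Omega A \<gamma> z"
  note Om = Omega_deriv[OF curve X z]
  have q: "?q \<in> TG" using triv_TG[OF curve_carrier[OF curve z]] Om(1) by simp
  have tau: "tau ?q = Im z *\<^sub>R X"
  proof -
    obtain c where c: "c \<in> A" "\<gamma> (Re z) \<in> cdom c" using ex_chart curve_carrier[OF curve z] by blast
    have "fst ?q = \<gamma> (Re z)" by (simp add: Om(1) triv_def)
    then show ?thesis
      using Tinv_cmap[OF c(1) q] cmap_triv[OF c, of "Im z *\<^sub>R X"] Tinv_Tmap[OF c(1), of "(cmap c (\<gamma> (Re z)), Im z *\<^sub>R X)"] c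
      by (simp add: Om(1))
  qed
  have "slope (tau ?q) (Im a *\<^sub>R X, Im b *\<^sub>R X) = cscale \<i> (Im a *\<^sub>R X, Im b *\<^sub>R X)"
    by (rule slope_of_commuting) (simp_all add: tau b.scaleR_left b.scaleR_right)
  then have "polvec ?q (Im a *\<^sub>R X, Im b *\<^sub>R X) =
      (\<lambda>C. (map_deriv TA (Omega A \<gamma>) z a C, map_deriv TA (Omega A \<gamma>) z b C))"
    by (simp add: polvec_def Om(2) b)
  then have "(\<lambda>C. (map_deriv TA (Omega A \<gamma>) z a C, map_deriv TA (Omega A \<gamma>) z b C)) \<in> pol ?q"
    unfolding pol_def by (metis rangeI)
  then show "case ab of (a, b) \<Rightarrow>
      (\<lambda>C. (map_deriv TA (Omega A \<gamma>) z a C, map_deriv TA (Omega A \<gamma>) z b C)) \<in> pol ?q"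
    by (simp add: ab)
qed

end

theorem corollary7p9:
  fixes G :: "('g, 'x) monoid_scheme"
    and A :: "('g, 'e::findim_inner) atlas"
    and N :: "('g \<Rightarrow> ('g, 'e) tvec) \<Rightarrow> ('g \<Rightarrow> ('g, 'e) tvec) \<Rightarrow> 'g \<Rightarrow> ('g, 'e) tvec"
  assumes "lie_group G A"
    and "canonical_connection G A N"
  shows "P_complete A N"
proof -
  have "\<one>\<^bsub>G\<^esub> \<in> points A"
    using assms(1) by (auto simp: lie_group_def intro: monoid.one_closed group.is_monoid)
  then obtain c0 where "c0 \<in> A" "\<one>\<^bsub>G\<^esub> \<in> cdom c0"
    by (auto simp: points_def)
  then interpret lie_group_chart G A c0
    using assms(1) by unfold_locales
  show ?thesis
    using pol_ac_polarization[OF assms(2)] by (auto simp: P_complete_def)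
qed

end
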